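(* Let $H$ be a braided vector space and $U\subset H'$ a non-degenerate subspace. Assume that $\Psi_{UU}$ is bijective. Then $\Psi_{UU}$ is a braiding on $U$. If $\Psi_{UH}$ is bijective, then it turns $H$ into a left $U$-braided vector space and $U$ into a right $H$-braided vector space with respect to the braidings $\Psi_{HH}$ and $\Psi_{HH}^{-1}$ on $H$, and $\Psi_{UU}$ and $\Psi_{UU}^{-1}$ on $U$. If $\Psi_{UH}^\circ$ is bijective, it also turns $H$ into a left $U$-braided vector space and $U$ into a right $H$-braided vector space with respect to the braidings $\Psi_{HH}$ and $\Psi_{HH}^{-1}$ on $H$, and $\Psi_{UU}$ and $\Psi_{UU}^{-1}$ on $U$. If $H$ is a braided (unital) algebra, then the braidings $\Psi_{UH}$ and $\Psi_{UH}^\circ$ (whenever bijective) are compatible with the multiplication on $H$. If $H$ is a braided coalgebra, then $\Psi_{UH}$ and $\Psi_{UH}^\circ$ (whenever bijective) are compatible with the comultiplication on $H$. The analogous statements hold for the opposite versions: if $\Psi_{HU}$ (resp. $\Psi_{HU}^\circ$) is bijective, then it turns $U$ into a left $H$-braided vector space and $H$ into a right $U$-braided vector space with respect to the braidings $\Psi_{HH}$ and $\Psi_{HH}^{-1}$ on $H$, and $\Psi_{UU}$ and $\Psi_{UU}^{-1}$ on $U$; and it is compatible with the multiplication (resp. comultiplication) of $H$ if $H$ is a braided (unital) algebra (resp. braided coalgebra).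
   Context: All vector spaces are over a fixed field $\mathbb K$, $\otimes$ is the algebraic tensor product, $X'$ is the full linear dual of $X$, and composition of maps is written by juxtaposition. A braiding on $V$ is a bijective linear map $\Psi_{VV}:V\otimes V\to V\otimes V$ with $(\Psi_{VV}\otimes\mathrm{id})(\mathrm{id}\otimes\Psi_{VV})(\Psi_{VV}\otimes\mathrm{id})=(\mathrm{id}\otimes\Psi_{VV})(\Psi_{VV}\otimes\mathrm{id})(\mathrm{id}\otimes\Psi_{VV})$; $V$ is then a braided vector space. Let $\Psi_{VW}:V\otimes W\to W\otimes V$ be bijective and linear. If $V$ is braided, $W$ is a left $V$-braided vector space if $(\Psi_{VW}\otimes\mathrm{id})(\mathrm{id}\otimes\Psi_{VW})(\Psi_{VV}\otimes\mathrm{id})=(\mathrm{id}\otimes\Psi_{VV})(\Psi_{VW}\otimes\mathrm{id})(\mathrm{id}\otimes\Psi_{VW})$. If $W$ is braided, $V$ is a right $W$-braided vector space if $(\mathrm{id}\otimes\Psi_{VW})(\Psi_{VW}\otimes\mathrm{id})(\mathrm{id}\otimes\Psi_{WW})=(\Psi_{WW}\otimes\mathrm{id})(\mathrm{id}\otimes\Psi_{VW})(\Psi_{VW}\otimes\mathrm{id})$. Compatibility of $\Psi=\Psi_{VW}$: with the multiplication of an algebra $V$: $\Psi(m_V\otimes\mathrm{id})=(\mathrm{id}\otimes m_V)(\Psi\otimes\mathrm{id})(\mathrm{id}\otimes\Psi)$ and $\Psi(1\otimes w)=w\otimes1$ if $1\in V$; with the multiplication of an algebra $W$: $\Psi(\mathrm{id}\otimes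 m_W)=(m_W\otimes\mathrm{id})(\mathrm{id}\otimes\Psi)(\Psi\otimes\mathrm{id})$ and $\Psi(v\otimes1)=1\otimes v$ if $1\in W$; with the comultiplication of a coalgebra $V$: $(\mathrm{id}\otimes\Delta)\Psi=(\Psi\otimes\mathrm{id})(\mathrm{id}\otimes\Psi)(\Delta\otimes\mathrm{id})$ and $(\mathrm{id}\otimes\varepsilon)\Psi=\varepsilon\otimes\mathrm{id}$; with the comultiplication of a coalgebra $W$: $(\Delta\otimes\mathrm{id})\Psi=(\mathrm{id}\otimes\Psi)(\Psi\otimes\mathrm{id})(\mathrm{id}\otimes\Delta)$ and $(\varepsilon\otimes\mathrm{id})\Psi=\mathrm{id}\otimes\varepsilon$. A braided (co)algebra is a (co)algebra with a braiding satisfying both compatibility conditions with its (co)multiplication. Duality notation: $\langle f,a\rangle=\langle a,f\rangle=f(a)$. $U\subset H'$ is non-degenerate if it separates the points of $H$. $\langle\langle\xi\otimes\eta,x\otimes y\rangle\rangle:=\langle\xi,y\rangle\langle\eta,x\rangle$. Tensor products are embedded into duals by $(\xi\otimes\eta)(x\otimes y)=\langle\xi,x\rangle\langle\eta,y\rangle$. For $a,b\in H$ define $\Psi_{UU}(f\otimes g)(b\otimes a):=\langle\langle f\otimes g,\Psi_{HH}(a\otimes b)\rangle\rangle$, $f,g\in U$ (values in $(H\otimes H)'\supset U\otimes U$); $\Psi_{UH}(g\otimes a)(f\otimes b):=\langle\langle f\otimes g,\Psi_{HH}(a\otimes b)\rangle\rangle$ and $\Psi_{UH}^\circ(g\otimes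 a)(f\otimes b):=\langle\langle f\otimes g,\Psi_{HH}^{-1}(a\otimes b)\rangle\rangle$, $g\in U$, $f\in H'$ (values in $(H'\otimes H)'\supset H\otimes U$); $\Psi_{HU}(b\otimes f)(a\otimes g):=\langle\langle f\otimes g,\Psi_{HH}(a\otimes b)\rangle\rangle$ and $\Psi_{HU}^\circ(b\otimes f)(a\otimes g):=\langle\langle f\otimes g,\Psi_{HH}^{-1}(a\otimes b)\rangle\rangle$, $f\in U$, $g\in H'$ (values in $(H\otimes H')'\supset U\otimes H$). Such a map $\Psi_{XY}$ is called bijective if it is a bijection $X\otimes Y\to Y\otimes X$. *)

theory Defs
  imports Complex_Main "HOL-Library.Function_Algebras"
begin

section \<open>Vector spaces, linear maps, duals\<close>

text \<open>A vector space over the field \<open>'k\<close> is a linear subspace \<open>vcar V\<close> of an ambient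
  vector-space type. Carriers are needed because duals and tensor products
  depend on the scalar multiplication and hence cannot be types of their own.\<close>

record ('k, 'v) vsp =
  vcar :: "'v set"
  vscl :: "'k \<Rightarrow> 'v \<Rightarrow> 'v"

definition vspace :: "('k::field, 'v::ab_group_add) vsp \<Rightarrow> bool" where
  "vspace V \<longleftrightarrow> vector_space (vscl V) \<and> module.subspace (vscl V) (vcar V)"

definition subvsp :: "('k::field, 'v::ab_group_add) vsp \<Rightarrow> ('k, 'v) vsp \<Rightarrow> bool" where
  "subvsp U V \<longleftrightarrow> vspace U \<and> vscl U = vscl V \<and> vcar U \<subseteq> vcar V"

definition lin :: "('k::field, 'v::ab_group_add) vsp \<Rightarrow> ('k, 'w::ab_group_add) vsp \<Rightarrow> ('v \<Rightarrow> 'w) \<Rightarrow> bool" where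
  "lin V W f \<longleftrightarrow>
     (\<forall>x\<in>vcar V. f x \<in> vcar W) \<and>
     (\<forall>x\<in>vcar V. \<forall>y\<in>vcar V. f (x + y) = f x + f y) \<and>
     (\<forall>c. \<forall>x\<in>vcar V. f (vscl V c x) = vscl W c (f x))"

definition bilin ::
  "('k::field, 'v::ab_group_add) vsp \<Rightarrow> ('k, 'w::ab_group_add) vsp \<Rightarrow> ('k, 'x::ab_group_add) vsp
    \<Rightarrow> ('v \<Rightarrow> 'w \<Rightarrow> 'x) \<Rightarrow> bool" where
  "bilin V W X \<beta> \<longleftrightarrow>
     (\<forall>v\<in>vcar V. lin W X (\<beta> v)) \<and> (\<forall>w\<in>vcar W. lin V X (\<lambda>v. \<beta> v w))"

definition bij_lin :: "('k::field, 'v::ab_group_add) vsp \<Rightarrow> ('k, 'w::ab_group_add) vsp \<Rightarrow> ('v \<Rightarrow> 'w) \<Rightarrow> bool" where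
  "bij_lin V W f \<longleftrightarrow> lin V W f \<and> bij_betw f (vcar V) (vcar W)"

definition ground :: "('k::field, 'k) vsp" where
  "ground = \<lparr>vcar = UNIV, vscl = (*)\<rparr>"

definition fscale :: "'k::field \<Rightarrow> ('x \<Rightarrow> 'k) \<Rightarrow> 'x \<Rightarrow> 'k" where
  "fscale c f = (\<lambda>x. c * f x)"

text \<open>Functionals on \<open>V\<close> are represented by functions vanishing outside the carrier of \<open>V\<close>, so that
  equality in the dual is equality of functions.\<close>

definition dual :: "('k::field, 'v::ab_group_add) vsp \<Rightarrow> ('k, 'v \<Rightarrow> 'k) vsp" where
  "dual V = \<lparr>vcar = {f. lin V ground f \<and> (\<forall>x. x \<notin> vcar V \<longrightarrow> f x = 0)}, vscl = fscale\<rparr>"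

definition nondegenerate :: "('k::field, 'v::ab_group_add) vsp \<Rightarrow> ('k, 'v \<Rightarrow> 'k) vsp \<Rightarrow> bool" where
  "nondegenerate V U \<longleftrightarrow>
     (\<forall>x\<in>vcar V. \<forall>y\<in>vcar V. x \<noteq> y \<longrightarrow> (\<exists>f\<in>vcar U. f x \<noteq> f y))"

section \<open>The algebraic tensor product\<close>

text \<open>\<open>V \<otimes> W\<close> is realised as the span of the evaluation functionals \<open>B \<mapsto> B v w\<close> on the space of
  bilinear forms on \<open>V \<times> W\<close>. That this is the algebraic tensor product, i.e. has the universal
  property for bilinear maps into arbitrary vector spaces, is proved below
  (\<open>tensor_universal\<close>).\<close>

type_synonym ('k, 'v, 'w) tens = "('v \<Rightarrow> 'w \<Rightarrow> 'k) \<Rightarrow> 'k"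

definition tens :: "('k::field, 'v::ab_group_add) vsp \<Rightarrow> ('k, 'w::ab_group_add) vsp \<Rightarrow> 'v \<Rightarrow> 'w \<Rightarrow> ('k, 'v, 'w) tens" where
  "tens V W v w = (\<lambda>B. if bilin V W ground B then B v w else 0)"

definition tensor :: "('k::field, 'v::ab_group_add) vsp \<Rightarrow> ('k, 'w::ab_group_add) vsp \<Rightarrow> ('k, ('k, 'v, 'w) tens) vsp"
    (infixl "\<otimes>" 75) where
  "V \<otimes> W = \<lparr>vcar = module.span fscale {tens V W v w | v w. v \<in> vcar V \<and> w \<in> vcar W}, vscl = fscale\<rparr>"

text \<open>The linear map \<open>V \<otimes> W \<rightarrow> X\<close> determined by its values on elementary tensors; as for
  functionals, it is extended by zero outside \<open>V \<otimes> W\<close>.\<close>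

definition lift ::
  "('k::field, 'v::ab_group_add) vsp \<Rightarrow> ('k, 'w::ab_group_add) vsp \<Rightarrow> ('k, 'x::ab_group_add) vsp
    \<Rightarrow> ('v \<Rightarrow> 'w \<Rightarrow> 'x) \<Rightarrow> ('k, 'v, 'w) tens \<Rightarrow> 'x" where
  "lift V W X \<beta> = (THE F. lin (V \<otimes> W) X F \<and>
      (\<forall>v\<in>vcar V. \<forall>w\<in>vcar W. F (tens V W v w) = \<beta> v w) \<and>
      (\<forall>t. t \<notin> vcar (V \<otimes> W) \<longrightarrow> F t = 0))"

lemma vector_space_fscale: "vector_space (fscale :: 'k::field \<Rightarrow> ('x \<Rightarrow> 'k) \<Rightarrow> 'x \<Rightarrow> 'k)"
  by unfold_locales (auto simp: fscale_def fun_eq_iff algebra_simps)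

lemma vector_space_mult: "vector_space ((*) :: 'k::field \<Rightarrow> 'k \<Rightarrow> 'k)"
  by unfold_locales (auto simp: algebra_simps)

lemma vspace_add: "vspace V \<Longrightarrow> x \<in> vcar V \<Longrightarrow> y \<in> vcar V \<Longrightarrow> x + y \<in> vcar V"
  unfolding vspace_def by (meson module.subspace_add module_iff_vector_space)

lemma vspace_scale: "vspace V \<Longrightarrow> x \<in> vcar V \<Longrightarrow> vscl V c x \<in> vcar V"
  unfolding vspace_def by (meson module.subspace_scale module_iff_vector_space)

lemma vspace_zero: "vspace V \<Longrightarrow> 0 \<in> vcar V"
  unfolding vspace_def by (meson module.subspace_0 module_iff_vector_space)

lemma vspace_ground: "vspace (ground :: ('k::field, 'k) vsp)"
proof -
  interpret vector_space "(*) :: 'k \<Rightarrow> 'k \<Rightarrow> 'k" by (rule vector_space_mult)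
  show ?thesis
    unfolding vspace_def ground_def by (simp add: vector_space_axioms)
qed

lemma vspace_dual: "vspace (V :: ('k::field, 'v::ab_group_add) vsp) \<Longrightarrow> vspace (dual V)"
proof -
  interpret vector_space "fscale :: 'k \<Rightarrow> ('v \<Rightarrow> 'k) \<Rightarrow> 'v \<Rightarrow> 'k" by (rule vector_space_fscale)
  show ?thesis
    unfolding vspace_def dual_def
    by (auto simp: vector_space_axioms subspace_def lin_def ground_def fscale_def algebra_simps)
qed

lemma vspace_tensor:
  "vspace ((V :: ('k::field, 'v::ab_group_add) vsp) \<otimes> (W :: ('k, 'w::ab_group_add) vsp))"
proof -
  interpret vector_space "fscale :: 'k \<Rightarrow> (('v \<Rightarrow> 'w \<Rightarrow> 'k) \<Rightarrow> 'k) \<Rightarrow> _" by (rule vector_space_fscale)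
  show ?thesis
    unfolding vspace_def tensor_def by (simp add: vector_space_axioms)
qed

lemma tens_in_tensor:
  fixes V :: "('k::field, 'v::ab_group_add) vsp" and W :: "('k, 'w::ab_group_add) vsp"
  assumes "v \<in> vcar V" "w \<in> vcar W"
  shows "tens V W v w \<in> vcar (V \<otimes> W)"
proof -
  interpret vector_space "fscale :: 'k \<Rightarrow> (('v \<Rightarrow> 'w \<Rightarrow> 'k) \<Rightarrow> 'k) \<Rightarrow> _" by (rule vector_space_fscale)
  show ?thesis
    unfolding tensor_def using assms by (auto intro: span_base)
qed

lemma bilin_tens: "vspace V \<Longrightarrow> vspace W \<Longrightarrow> bilin V W (V \<otimes> W) (tens V W)"
  unfolding bilin_def[where X = "V \<otimes> W"] lin_def
  by (auto simp: tens_in_tensor vspace_add vspace_scale)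
     (auto simp: tens_def bilin_def lin_def ground_def tensor_def fscale_def fun_eq_iff)

lemma tensor_induct [consumes 1, case_names zero add scale tens]:
  fixes V :: "('k::field, 'v::ab_group_add) vsp" and W :: "('k, 'w::ab_group_add) vsp"
  assumes "t \<in> vcar (V \<otimes> W)"
    and zero: "P 0"
    and add: "\<And>s t. s \<in> vcar (V \<otimes> W) \<Longrightarrow> t \<in> vcar (V \<otimes> W) \<Longrightarrow> P s \<Longrightarrow> P t \<Longrightarrow> P (s + t)"
    and scale: "\<And>c t. t \<in> vcar (V \<otimes> W) \<Longrightarrow> P t \<Longrightarrow> P (vscl (V \<otimes> W) c t)"
    and tens: "\<And>v w. v \<in> vcar V \<Longrightarrow> w \<in> vcar W \<Longrightarrow> P (tens V W v w)"
  shows "P t"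
proof -
  interpret vector_space "fscale :: 'k \<Rightarrow> (('v \<Rightarrow> 'w \<Rightarrow> 'k) \<Rightarrow> 'k) \<Rightarrow> _" by (rule vector_space_fscale)
  have "t \<in> vcar (V \<otimes> W) \<and> P t"
  proof (rule span_induct[where S = "{tens V W v w | v w. v \<in> vcar V \<and> w \<in> vcar W}"
        and P = "\<lambda>t. t \<in> vcar (V \<otimes> W) \<and> P t"])
    show "t \<in> span {tens V W v w | v w. v \<in> vcar V \<and> w \<in> vcar W}"
      using assms(1) by (simp add: tensor_def)
    show "subspace {t. t \<in> vcar (V \<otimes> W) \<and> P t}"
      using vspace_zero[OF vspace_tensor, of V W] vspace_add[OF vspace_tensor, of _ V W]
        vspace_scale[OF vspace_tensor, of _ V W] zero add scale
      by (auto simp: subspace_def tensor_def)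
  qed (auto simp: tens_in_tensor tens)
  then show ?thesis by simp
qed

lemma separating_functional:
  fixes s :: "'k::field \<Rightarrow> 'x::ab_group_add \<Rightarrow> 'x"
  assumes "vector_space s" "x \<noteq> y"
  obtains \<phi> where "Vector_Spaces.linear s (*) \<phi>" "\<phi> x \<noteq> \<phi> y"
proof -
  interpret vector_space_pair s "(*) :: 'k \<Rightarrow> 'k \<Rightarrow> 'k"
    by (simp add: vector_space_pair_def assms(1) vector_space_mult)
  have "vs1.independent {x - y}" using assms(2) by simp
  from linear_independent_extend[OF this, of "\<lambda>_. 1"]
  obtain \<phi> where *: "Vector_Spaces.linear s (*) \<phi>" "\<phi> (x - y) = 1" by auto
  then have "\<phi> x - \<phi> y = 1" by (simp add: linear_diff)
  with * show ?thesis by (intro that[of \<phi>]) auto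
qed

theorem tensor_universal:
  fixes V :: "('k::field, 'v::ab_group_add) vsp" and W :: "('k, 'w::ab_group_add) vsp"
    and X :: "('k, 'x::ab_group_add) vsp"
  assumes X: "vspace X" and \<beta>: "bilin V W X \<beta>"
  shows "\<exists>!F. lin (V \<otimes> W) X F \<and>
      (\<forall>v\<in>vcar V. \<forall>w\<in>vcar W. F (tens V W v w) = \<beta> v w) \<and>
      (\<forall>t. t \<notin> vcar (V \<otimes> W) \<longrightarrow> F t = 0)"
proof (rule ex_ex1I)
  interpret X: vector_space "vscl X" using X by (simp add: vspace_def)
  let ?L = "{\<phi>. Vector_Spaces.linear (vscl X) (*) \<phi>}"
  define R where "R t x \<longleftrightarrow> x \<in> vcar X \<and> (\<forall>\<phi>\<in>?L. t (\<lambda>v w. \<phi> (\<beta> v w)) = \<phi> x)" for t x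
  have lin_add: "\<phi> (a + b) = \<phi> a + \<phi> b" and lin_scale: "\<phi> (vscl X c a) = c * \<phi> a"
    if "\<phi> \<in> ?L" for \<phi> a b c
    using that by (auto simp: Vector_Spaces.linear_iff)
  have B: "bilin V W ground (\<lambda>v w. \<phi> (\<beta> v w))" if "\<phi> \<in> ?L" for \<phi>
    using \<beta> lin_add[OF that] lin_scale[OF that] unfolding bilin_def lin_def ground_def by auto
  have uniq: "x = y" if "R t x" "R t y" for t x y
  proof (rule ccontr)
    assume "x \<noteq> y"
    then obtain \<phi> where "Vector_Spaces.linear (vscl X) (*) \<phi>" "\<phi> x \<noteq> \<phi> y"
      using separating_functional[OF X.vector_space_axioms] by blast
    then show False using that by (simp add: R_def)
  qed
  have R_tens: "R (tens V W v w) (\<beta> v w)" if "v \<in> vcar V" "w \<in> vcar W" for v w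
    using that B \<beta> by (auto simp: R_def tens_def bilin_def lin_def)
  have R_add: "R (s + t) (x + y)" if "R s x" "R t y" for s t x y
    using that lin_add vspace_add[OF X] by (simp add: R_def)
  have R_scale: "R (vscl (V \<otimes> W) c t) (vscl X c x)" if "R t x" for c t x
    using that lin_scale vspace_scale[OF X] by (simp add: R_def tensor_def fscale_def)
  have ex: "\<exists>x. R t x" if "t \<in> vcar (V \<otimes> W)" for t
    using that
  proof (induction rule: tensor_induct)
    case zero
    have "R 0 0"
      using vspace_zero[OF X] lin_scale[of _ 0 0] by (auto simp: R_def)
    then show ?case ..
  next
    case (add s t)
    then show ?case using R_add by blast
  next
    case (scale c t)
    then show ?case using R_scale by blast
  next
    case (tens v w)
    then show ?case using R_tens by blast
  qed
  define F where "F t = (if t \<in> vcar (V \<otimes> W) then THE x. R t x else 0)" for t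
  have F_eq: "F t = x" if "t \<in> vcar (V \<otimes> W)" "R t x" for t x
    using that uniq by (auto simp: F_def)
  have RF: "R t (F t)" if "t \<in> vcar (V \<otimes> W)" for t
    using ex[OF that] F_eq[OF that] by auto
  have "lin (V \<otimes> W) X F"
    unfolding lin_def
  proof (intro conjI ballI allI)
    show "F s \<in> vcar X" if "s \<in> vcar (V \<otimes> W)" for s
      using RF[OF that] by (simp add: R_def)
    show "F (s + t) = F s + F t" if "s \<in> vcar (V \<otimes> W)" "t \<in> vcar (V \<otimes> W)" for s t
      by (intro F_eq R_add RF vspace_add[OF vspace_tensor] that)
    show "F (vscl (V \<otimes> W) c s) = vscl X c (F s)" if "s \<in> vcar (V \<otimes> W)" for c s
      by (intro F_eq R_scale RF vspace_scale[OF vspace_tensor] that)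
  qed
  moreover have "F (tens V W v w) = \<beta> v w" if "v \<in> vcar V" "w \<in> vcar W" for v w
    using F_eq R_tens tens_in_tensor that by blast
  ultimately show "\<exists>F. lin (V \<otimes> W) X F \<and>
      (\<forall>v\<in>vcar V. \<forall>w\<in>vcar W. F (tens V W v w) = \<beta> v w) \<and>
      (\<forall>t. t \<notin> vcar (V \<otimes> W) \<longrightarrow> F t = 0)"
    by (intro exI[of _ F]) (auto simp: F_def)
next
  interpret X: vector_space "vscl X" using X by (simp add: vspace_def)
  have lin_0: "F 0 = 0" if "lin (V \<otimes> W) X F" for F
  proof -
    have "F (0 + 0) = F 0 + F 0"
      using that vspace_zero[OF vspace_tensor, of V W] unfolding lin_def by blast
    then show ?thesis by simp
  qed
  fix F G
  assume F: "lin (V \<otimes> W) X F \<and> (\<forall>v\<in>vcar V. \<forall>w\<in>vcar W. F (tens V W v w) = \<beta> v w) \<and>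
      (\<forall>t. t \<notin> vcar (V \<otimes> W) \<longrightarrow> F t = 0)"
    and G: "lin (V \<otimes> W) X G \<and> (\<forall>v\<in>vcar V. \<forall>w\<in>vcar W. G (tens V W v w) = \<beta> v w) \<and>
      (\<forall>t. t \<notin> vcar (V \<otimes> W) \<longrightarrow> G t = 0)"
  have "F t = G t" if "t \<in> vcar (V \<otimes> W)" for t
    using that
  proof (induction rule: tensor_induct)
    case zero
    show ?case using lin_0[of F] lin_0[of G] F G by argo
  next
    case (add s t)
    then have "F (s + t) = F s + F t" "G (s + t) = G s + G t"
      using F G unfolding lin_def by blast+
    then show ?case using add by argo
  next
    case (scale c t)
    then have "F (vscl (V \<otimes> W) c t) = vscl X c (F t)" "G (vscl (V \<otimes> W) c t) = vscl X c (G t)"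
      using F G unfolding lin_def by blast+
    then show ?case using scale by argo
  next
    case (tens v w)
    then show ?case using F G by simp
  qed
  then show "F = G" using F G by fastforce
qed

lemma lift_props:
  assumes "vspace X" "bilin V W X \<beta>"
  shows lin_lift: "lin (V \<otimes> W) X (lift V W X \<beta>)"
    and lift_tens: "v \<in> vcar V \<Longrightarrow> w \<in> vcar W \<Longrightarrow> lift V W X \<beta> (tens V W v w) = \<beta> v w"
    and lift_outside: "t \<notin> vcar (V \<otimes> W) \<Longrightarrow> lift V W X \<beta> t = 0"
proof -
  note * = theI'[OF tensor_universal[OF assms], folded lift_def]
  show "lin (V \<otimes> W) X (lift V W X \<beta>)" using * by (elim conjE)
  show "lift V W X \<beta> (tens V W v w) = \<beta> v w" if "v \<in> vcar V" "w \<in> vcar W" using * that by simp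
  show "lift V W X \<beta> t = 0" if "t \<notin> vcar (V \<otimes> W)" using * that by simp
qed

text \<open>\<open>tmap V W V' W' f g\<close> is \<open>f \<otimes> g\<close> for \<open>f : V \<rightarrow> V'\<close> and \<open>g : W \<rightarrow> W'\<close>.\<close>

definition tmap ::
  "('k::field, 'v::ab_group_add) vsp \<Rightarrow> ('k, 'w::ab_group_add) vsp
    \<Rightarrow> ('k, 'a::ab_group_add) vsp \<Rightarrow> ('k, 'b::ab_group_add) vsp
    \<Rightarrow> ('v \<Rightarrow> 'a) \<Rightarrow> ('w \<Rightarrow> 'b) \<Rightarrow> ('k, 'v, 'w) tens \<Rightarrow> ('k, 'a, 'b) tens" where
  "tmap V W V' W' f g = lift V W (V' \<otimes> W') (\<lambda>v w. tens V' W' (f v) (g w))"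

definition assoc ::
  "('k::field, 'v::ab_group_add) vsp \<Rightarrow> ('k, 'w::ab_group_add) vsp \<Rightarrow> ('k, 'x::ab_group_add) vsp
    \<Rightarrow> ('k, ('k, 'v, 'w) tens, 'x) tens \<Rightarrow> ('k, 'v, ('k, 'w, 'x) tens) tens" where
  "assoc V W X = lift (V \<otimes> W) X (V \<otimes> (W \<otimes> X))
     (\<lambda>t x. lift V W (V \<otimes> (W \<otimes> X)) (\<lambda>v w. tens V (W \<otimes> X) v (tens W X w x)) t)"

definition assoc_inv ::
  "('k::field, 'v::ab_group_add) vsp \<Rightarrow> ('k, 'w::ab_group_add) vsp \<Rightarrow> ('k, 'x::ab_group_add) vsp
    \<Rightarrow> ('k, 'v, ('k, 'w, 'x) tens) tens \<Rightarrow> ('k, ('k, 'v, 'w) tens, 'x) tens" where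
  "assoc_inv V W X = lift V (W \<otimes> X) (V \<otimes> W \<otimes> X)
     (\<lambda>v t. lift W X (V \<otimes> W \<otimes> X) (\<lambda>w x. tens (V \<otimes> W) X (tens V W v w) x) t)"

section \<open>Braidings\<close>

text \<open>Triple tensor products are bracketed to the left, \<open>V \<otimes> W \<otimes> X = (V \<otimes> W) \<otimes> X\<close>, unless written
  otherwise. For \<open>\<Psi> : V \<otimes> W \<rightarrow> W \<otimes> V\<close> the maps \<open>\<Psi> \<otimes> id\<close> and \<open>id \<otimes> \<Psi>\<close> with a third factor \<open>X\<close> are
  \<open>psi_id V W X \<Psi> : V \<otimes> W \<otimes> X \<rightarrow> W \<otimes> V \<otimes> X\<close> and
  \<open>id_psi X V W \<Psi> : X \<otimes> V \<otimes> W \<rightarrow> X \<otimes> W \<otimes> V\<close>.\<close>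

definition psi_id ::
  "('k::field, 'v::ab_group_add) vsp \<Rightarrow> ('k, 'w::ab_group_add) vsp \<Rightarrow> ('k, 'x::ab_group_add) vsp
    \<Rightarrow> (('k, 'v, 'w) tens \<Rightarrow> ('k, 'w, 'v) tens)
    \<Rightarrow> ('k, ('k, 'v, 'w) tens, 'x) tens \<Rightarrow> ('k, ('k, 'w, 'v) tens, 'x) tens" where
  "psi_id V W X \<Psi> = tmap (V \<otimes> W) X (W \<otimes> V) X \<Psi> id"

definition id_psi ::
  "('k::field, 'x::ab_group_add) vsp \<Rightarrow> ('k, 'v::ab_group_add) vsp \<Rightarrow> ('k, 'w::ab_group_add) vsp
    \<Rightarrow> (('k, 'v, 'w) tens \<Rightarrow> ('k, 'w, 'v) tens)
    \<Rightarrow> ('k, ('k, 'x, 'v) tens, 'w) tens \<Rightarrow> ('k, ('k, 'x, 'w) tens, 'v) tens" where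
  "id_psi X V W \<Psi> = assoc_inv X W V \<circ> tmap X (V \<otimes> W) X (W \<otimes> V) id \<Psi> \<circ> assoc X V W"

definition braiding :: "('k::field, 'v::ab_group_add) vsp \<Rightarrow> (('k, 'v, 'v) tens \<Rightarrow> ('k, 'v, 'v) tens) \<Rightarrow> bool" where
  "braiding V \<Psi> \<longleftrightarrow> vspace V \<and> bij_lin (V \<otimes> V) (V \<otimes> V) \<Psi> \<and>
     (\<forall>t \<in> vcar (V \<otimes> V \<otimes> V).
        psi_id V V V \<Psi> (id_psi V V V \<Psi> (psi_id V V V \<Psi> t))
      = id_psi V V V \<Psi> (psi_id V V V \<Psi> (id_psi V V V \<Psi> t)))"

text \<open>\<open>left_braided V \<Psi>V W \<Psi>\<close>: the map \<open>\<Psi> : V \<otimes> W \<rightarrow> W \<otimes> V\<close> turns \<open>W\<close> into a left \<open>V\<close>-braided vector space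
  with respect to the braiding \<open>\<Psi>V\<close> of \<open>V\<close>.\<close>

definition left_braided ::
  "('k::field, 'v::ab_group_add) vsp \<Rightarrow> (('k, 'v, 'v) tens \<Rightarrow> ('k, 'v, 'v) tens)
    \<Rightarrow> ('k, 'w::ab_group_add) vsp \<Rightarrow> (('k, 'v, 'w) tens \<Rightarrow> ('k, 'w, 'v) tens) \<Rightarrow> bool" where
  "left_braided V \<Psi>V W \<Psi> \<longleftrightarrow> braiding V \<Psi>V \<and> vspace W \<and> bij_lin (V \<otimes> W) (W \<otimes> V) \<Psi> \<and>
     (\<forall>t \<in> vcar (V \<otimes> V \<otimes> W).
        psi_id V W V \<Psi> (id_psi V V W \<Psi> (psi_id V V W \<Psi>V t))
      = id_psi W V V \<Psi>V (psi_id V W V \<Psi> (id_psi V V W \<Psi> t)))"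

text \<open>\<open>right_braided W \<Psi>W V \<Psi>\<close>: the map \<open>\<Psi> : V \<otimes> W \<rightarrow> W \<otimes> V\<close> turns \<open>V\<close> into a right \<open>W\<close>-braided vector
  space with respect to the braiding \<open>\<Psi>W\<close> of \<open>W\<close>.\<close>

definition right_braided ::
  "('k::field, 'w::ab_group_add) vsp \<Rightarrow> (('k, 'w, 'w) tens \<Rightarrow> ('k, 'w, 'w) tens)
    \<Rightarrow> ('k, 'v::ab_group_add) vsp \<Rightarrow> (('k, 'v, 'w) tens \<Rightarrow> ('k, 'w, 'v) tens) \<Rightarrow> bool" where
  "right_braided W \<Psi>W V \<Psi> \<longleftrightarrow> braiding W \<Psi>W \<and> vspace V \<and> bij_lin (V \<otimes> W) (W \<otimes> V) \<Psi> \<and>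
     (\<forall>t \<in> vcar (V \<otimes> W \<otimes> W).
        id_psi W V W \<Psi> (psi_id V W W \<Psi> (id_psi V W W \<Psi>W t))
      = psi_id W W V \<Psi>W (id_psi W V W \<Psi> (psi_id V W W \<Psi> t)))"

section \<open>Braided algebras and coalgebras\<close>

text \<open>Algebras are associative but need not have a unit: the unit is \<open>None\<close> for an algebra
  without (specified) unit and \<open>Some e\<close> for a unital one.\<close>

definition is_algebra ::
  "('k::field, 'v::ab_group_add) vsp \<Rightarrow> (('k, 'v, 'v) tens \<Rightarrow> 'v) \<Rightarrow> 'v option \<Rightarrow> bool" where
  "is_algebra V m u \<longleftrightarrow> vspace V \<and> lin (V \<otimes> V) V m \<and>
     (\<forall>t \<in> vcar (V \<otimes> V \<otimes> V).
        m (tmap (V \<otimes> V) V V V m id t) = m (tmap V (V \<otimes> V) V V id m (assoc V V V t))) \<and>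
     (\<forall>e. u = Some e \<longrightarrow> e \<in> vcar V \<and> (\<forall>x\<in>vcar V. m (tens V V e x) = x \<and> m (tens V V x e) = x))"

text \<open>For \<open>\<epsilon> : C \<rightarrow> \<bbbK>\<close>, the maps \<open>\<epsilon> \<otimes> id : C \<otimes> X \<rightarrow> X\<close> and \<open>id \<otimes> \<epsilon> : X \<otimes> C \<rightarrow> X\<close>, with \<open>\<bbbK> \<otimes> X\<close> and \<open>X \<otimes> \<bbbK>\<close>
  identified with \<open>X\<close>.\<close>

definition eps_id ::
  "('k::field, 'c::ab_group_add) vsp \<Rightarrow> ('k, 'x::ab_group_add) vsp \<Rightarrow> ('c \<Rightarrow> 'k) \<Rightarrow> ('k, 'c, 'x) tens \<Rightarrow> 'x" where
  "eps_id C X \<epsilon> = lift C X X (\<lambda>c x. vscl X (\<epsilon> c) x)"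

definition id_eps ::
  "('k::field, 'x::ab_group_add) vsp \<Rightarrow> ('k, 'c::ab_group_add) vsp \<Rightarrow> ('c \<Rightarrow> 'k) \<Rightarrow> ('k, 'x, 'c) tens \<Rightarrow> 'x" where
  "id_eps X C \<epsilon> = lift X C X (\<lambda>x c. vscl X (\<epsilon> c) x)"

definition is_coalgebra ::
  "('k::field, 'v::ab_group_add) vsp \<Rightarrow> ('v \<Rightarrow> ('k, 'v, 'v) tens) \<Rightarrow> ('v \<Rightarrow> 'k) \<Rightarrow> bool" where
  "is_coalgebra V \<Delta> \<epsilon> \<longleftrightarrow> vspace V \<and> lin V (V \<otimes> V) \<Delta> \<and> lin V ground \<epsilon> \<and>
     (\<forall>x\<in>vcar V.
        assoc V V V (tmap V V (V \<otimes> V) V \<Delta> id (\<Delta> x)) = tmap V V V (V \<otimes> V) id \<Delta> (\<Delta> x) \<and>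
        eps_id V V \<epsilon> (\<Delta> x) = x \<and> id_eps V V \<epsilon> (\<Delta> x) = x)"

text \<open>Compatibility of \<open>\<Psi> : V \<otimes> W \<rightarrow> W \<otimes> V\<close> with the (co)multiplication of the left factor \<open>V\<close>
  (suffix \<open>_left\<close>) or of the right factor \<open>W\<close> (suffix \<open>_right\<close>).\<close>

definition mult_compat_left ::
  "('k::field, 'v::ab_group_add) vsp \<Rightarrow> ('k, 'w::ab_group_add) vsp
    \<Rightarrow> (('k, 'v, 'w) tens \<Rightarrow> ('k, 'w, 'v) tens) \<Rightarrow> (('k, 'v, 'v) tens \<Rightarrow> 'v) \<Rightarrow> 'v option \<Rightarrow> bool" where
  "mult_compat_left V W \<Psi> m u \<longleftrightarrow>
     (\<forall>t \<in> vcar (V \<otimes> V \<otimes> W).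
        \<Psi> (tmap (V \<otimes> V) W V W m id t)
      = tmap W (V \<otimes> V) W V id m (assoc W V V (psi_id V W V \<Psi> (id_psi V V W \<Psi> t)))) \<and>
     (\<forall>e. u = Some e \<longrightarrow> (\<forall>w\<in>vcar W. \<Psi> (tens V W e w) = tens W V w e))"

definition mult_compat_right ::
  "('k::field, 'v::ab_group_add) vsp \<Rightarrow> ('k, 'w::ab_group_add) vsp
    \<Rightarrow> (('k, 'v, 'w) tens \<Rightarrow> ('k, 'w, 'v) tens) \<Rightarrow> (('k, 'w, 'w) tens \<Rightarrow> 'w) \<Rightarrow> 'w option \<Rightarrow> bool" where
  "mult_compat_right V W \<Psi> m u \<longleftrightarrow>
     (\<forall>t \<in> vcar (V \<otimes> W \<otimes> W).
        \<Psi> (tmap V (W \<otimes> W) V W id m (assoc V W W t))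
      = tmap (W \<otimes> W) V W V m id (id_psi W V W \<Psi> (psi_id V W W \<Psi> t))) \<and>
     (\<forall>e. u = Some e \<longrightarrow> (\<forall>v\<in>vcar V. \<Psi> (tens V W v e) = tens W V e v))"

definition comult_compat_left ::
  "('k::field, 'v::ab_group_add) vsp \<Rightarrow> ('k, 'w::ab_group_add) vsp
    \<Rightarrow> (('k, 'v, 'w) tens \<Rightarrow> ('k, 'w, 'v) tens) \<Rightarrow> ('v \<Rightarrow> ('k, 'v, 'v) tens) \<Rightarrow> ('v \<Rightarrow> 'k) \<Rightarrow> bool" where
  "comult_compat_left V W \<Psi> \<Delta> \<epsilon> \<longleftrightarrow>
     (\<forall>t \<in> vcar (V \<otimes> W).
        tmap W V W (V \<otimes> V) id \<Delta> (\<Psi> t)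
      = assoc W V V (psi_id V W V \<Psi> (id_psi V V W \<Psi> (tmap V W (V \<otimes> V) W \<Delta> id t))) \<and>
        id_eps W V \<epsilon> (\<Psi> t) = eps_id V W \<epsilon> t)"

definition comult_compat_right ::
  "('k::field, 'v::ab_group_add) vsp \<Rightarrow> ('k, 'w::ab_group_add) vsp
    \<Rightarrow> (('k, 'v, 'w) tens \<Rightarrow> ('k, 'w, 'v) tens) \<Rightarrow> ('w \<Rightarrow> ('k, 'w, 'w) tens) \<Rightarrow> ('w \<Rightarrow> 'k) \<Rightarrow> bool" where
  "comult_compat_right V W \<Psi> \<Delta> \<epsilon> \<longleftrightarrow>
     (\<forall>t \<in> vcar (V \<otimes> W).
        tmap W V (W \<otimes> W) V \<Delta> id (\<Psi> t)
      = id_psi W V W \<Psi> (psi_id V W W \<Psi> (assoc_inv V W W (tmap V W V (W \<otimes> W) id \<Delta> t))) \<and>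
        eps_id W V \<epsilon> (\<Psi> t) = id_eps V W \<epsilon> t)"

definition braided_algebra ::
  "('k::field, 'v::ab_group_add) vsp \<Rightarrow> (('k, 'v, 'v) tens \<Rightarrow> ('k, 'v, 'v) tens)
    \<Rightarrow> (('k, 'v, 'v) tens \<Rightarrow> 'v) \<Rightarrow> 'v option \<Rightarrow> bool" where
  "braided_algebra V \<Psi> m u \<longleftrightarrow> braiding V \<Psi> \<and> is_algebra V m u \<and>
     mult_compat_left V V \<Psi> m u \<and> mult_compat_right V V \<Psi> m u"

definition braided_coalgebra ::
  "('k::field, 'v::ab_group_add) vsp \<Rightarrow> (('k, 'v, 'v) tens \<Rightarrow> ('k, 'v, 'v) tens)
    \<Rightarrow> ('v \<Rightarrow> ('k, 'v, 'v) tens) \<Rightarrow> ('v \<Rightarrow> 'k) \<Rightarrow> bool" where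
  "braided_coalgebra V \<Psi> \<Delta> \<epsilon> \<longleftrightarrow> braiding V \<Psi> \<and> is_coalgebra V \<Delta> \<epsilon> \<and>
     comult_compat_left V V \<Psi> \<Delta> \<epsilon> \<and> comult_compat_right V V \<Psi> \<Delta> \<epsilon>"

section \<open>Dual braidings\<close>

text \<open>The functional \<open>x \<otimes> y \<mapsto> \<langle>\<langle>\<xi> \<otimes> \<eta>, x \<otimes> y\<rangle>\<rangle> = \<langle>\<xi>, y\<rangle> \<langle>\<eta>, x\<rangle>\<close> on \<open>H \<otimes> H\<close>.\<close>

definition pairing :: "('k::field, 'h::ab_group_add) vsp \<Rightarrow> ('h \<Rightarrow> 'k) \<Rightarrow> ('h \<Rightarrow> 'k) \<Rightarrow> ('k, 'h, 'h) tens \<Rightarrow> 'k" where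
  "pairing H \<xi> \<eta> = lift H H ground (\<lambda>x y. \<xi> y * \<eta> x)"

text \<open>The embedding \<open>A \<otimes> B \<rightarrow> (P \<otimes> Q)'\<close>, \<open>(\<xi> \<otimes> \<eta>)(x \<otimes> y) = \<langle>\<xi>, x\<rangle> \<langle>\<eta>, y\<rangle>\<close>, where \<open>p\<close> and \<open>q\<close> are the
  pairings of \<open>A\<close> with \<open>P\<close> and of \<open>B\<close> with \<open>Q\<close>.\<close>

definition tensor_embed ::
  "('k::field, 'a::ab_group_add) vsp \<Rightarrow> ('k, 'b::ab_group_add) vsp
    \<Rightarrow> ('k, 'p::ab_group_add) vsp \<Rightarrow> ('k, 'q::ab_group_add) vsp
    \<Rightarrow> ('a \<Rightarrow> 'p \<Rightarrow> 'k) \<Rightarrow> ('b \<Rightarrow> 'q \<Rightarrow> 'k) \<Rightarrow> ('k, 'a, 'b) tens \<Rightarrow> ('k, 'p, 'q) tens \<Rightarrow> 'k" where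
  "tensor_embed A B P Q p q =
     lift A B (dual (P \<otimes> Q)) (\<lambda>\<xi> \<eta>. lift P Q ground (\<lambda>x y. p \<xi> x * q \<eta> y))"

definition emb_UU :: "('k::field, 'h::ab_group_add) vsp \<Rightarrow> ('k, 'h \<Rightarrow> 'k) vsp
    \<Rightarrow> ('k, 'h \<Rightarrow> 'k, 'h \<Rightarrow> 'k) tens \<Rightarrow> ('k, 'h, 'h) tens \<Rightarrow> 'k" where
  "emb_UU H U = tensor_embed U U H H (\<lambda>f x. f x) (\<lambda>f x. f x)"

definition emb_HU :: "('k::field, 'h::ab_group_add) vsp \<Rightarrow> ('k, 'h \<Rightarrow> 'k) vsp
    \<Rightarrow> ('k, 'h, 'h \<Rightarrow> 'k) tens \<Rightarrow> ('k, 'h \<Rightarrow> 'k, 'h) tens \<Rightarrow> 'k" where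
  "emb_HU H U = tensor_embed H U (dual H) H (\<lambda>x f. f x) (\<lambda>f x. f x)"

definition emb_UH :: "('k::field, 'h::ab_group_add) vsp \<Rightarrow> ('k, 'h \<Rightarrow> 'k) vsp
    \<Rightarrow> ('k, 'h \<Rightarrow> 'k, 'h) tens \<Rightarrow> ('k, 'h, 'h \<Rightarrow> 'k) tens \<Rightarrow> 'k" where
  "emb_UH H U = tensor_embed U H H (dual H) (\<lambda>f x. f x) (\<lambda>x f. f x)"

text \<open>The dual-valued maps \<open>U \<otimes> U \<rightarrow> (H \<otimes> H)'\<close>, \<open>U \<otimes> H \<rightarrow> (H' \<otimes> H)'\<close> and \<open>H \<otimes> U \<rightarrow> (H \<otimes> H')'\<close> induced by a
  linear map \<open>\<Psi>\<close> on \<open>H \<otimes> H\<close>. The circle versions arise by taking the inverse braiding for \<open>\<Psi>\<close>.\<close>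

definition form_UU :: "('k::field, 'h::ab_group_add) vsp \<Rightarrow> (('k, 'h, 'h) tens \<Rightarrow> ('k, 'h, 'h) tens)
    \<Rightarrow> ('k, 'h \<Rightarrow> 'k) vsp \<Rightarrow> ('k, 'h \<Rightarrow> 'k, 'h \<Rightarrow> 'k) tens \<Rightarrow> ('k, 'h, 'h) tens \<Rightarrow> 'k" where
  "form_UU H \<Psi> U = lift U U (dual (H \<otimes> H))
     (\<lambda>f g. lift H H ground (\<lambda>b a. pairing H f g (\<Psi> (tens H H a b))))"

definition form_UH :: "('k::field, 'h::ab_group_add) vsp \<Rightarrow> (('k, 'h, 'h) tens \<Rightarrow> ('k, 'h, 'h) tens)
    \<Rightarrow> ('k, 'h \<Rightarrow> 'k) vsp \<Rightarrow> ('k, 'h \<Rightarrow> 'k, 'h) tens \<Rightarrow> ('k, 'h \<Rightarrow> 'k, 'h) tens \<Rightarrow> 'k" where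
  "form_UH H \<Psi> U = lift U H (dual (dual H \<otimes> H))
     (\<lambda>g a. lift (dual H) H ground (\<lambda>f b. pairing H f g (\<Psi> (tens H H a b))))"

definition form_HU :: "('k::field, 'h::ab_group_add) vsp \<Rightarrow> (('k, 'h, 'h) tens \<Rightarrow> ('k, 'h, 'h) tens)
    \<Rightarrow> ('k, 'h \<Rightarrow> 'k) vsp \<Rightarrow> ('k, 'h, 'h \<Rightarrow> 'k) tens \<Rightarrow> ('k, 'h, 'h \<Rightarrow> 'k) tens \<Rightarrow> 'k" where
  "form_HU H \<Psi> U = lift H U (dual (H \<otimes> dual H))
     (\<lambda>b f. lift H (dual H) ground (\<lambda>a g. pairing H f g (\<Psi> (tens H H a b))))"

text \<open>Bijectivity means that the dual-valued map is a bijection onto the embedded copy of the target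
  tensor product. In that case \<open>psi_UU\<close>, \<open>psi_UH\<close>, \<open>psi_HU\<close> are the maps regarded as maps between the tensor
  products themselves.\<close>

definition bij_UU :: "('k::field, 'h::ab_group_add) vsp \<Rightarrow> (('k, 'h, 'h) tens \<Rightarrow> ('k, 'h, 'h) tens)
    \<Rightarrow> ('k, 'h \<Rightarrow> 'k) vsp \<Rightarrow> bool" where
  "bij_UU H \<Psi> U \<longleftrightarrow> bij_betw (form_UU H \<Psi> U) (vcar (U \<otimes> U)) (emb_UU H U ` vcar (U \<otimes> U))"

definition bij_UH :: "('k::field, 'h::ab_group_add) vsp \<Rightarrow> (('k, 'h, 'h) tens \<Rightarrow> ('k, 'h, 'h) tens)
    \<Rightarrow> ('k, 'h \<Rightarrow> 'k) vsp \<Rightarrow> bool" where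
  "bij_UH H \<Psi> U \<longleftrightarrow> bij_betw (form_UH H \<Psi> U) (vcar (U \<otimes> H)) (emb_HU H U ` vcar (H \<otimes> U))"

definition bij_HU :: "('k::field, 'h::ab_group_add) vsp \<Rightarrow> (('k, 'h, 'h) tens \<Rightarrow> ('k, 'h, 'h) tens)
    \<Rightarrow> ('k, 'h \<Rightarrow> 'k) vsp \<Rightarrow> bool" where
  "bij_HU H \<Psi> U \<longleftrightarrow> bij_betw (form_HU H \<Psi> U) (vcar (H \<otimes> U)) (emb_UH H U ` vcar (U \<otimes> H))"

definition psi_UU :: "('k::field, 'h::ab_group_add) vsp \<Rightarrow> (('k, 'h, 'h) tens \<Rightarrow> ('k, 'h, 'h) tens)
    \<Rightarrow> ('k, 'h \<Rightarrow> 'k) vsp \<Rightarrow> ('k, 'h \<Rightarrow> 'k, 'h \<Rightarrow> 'k) tens \<Rightarrow> ('k, 'h \<Rightarrow> 'k, 'h \<Rightarrow> 'k) tens" where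
  "psi_UU H \<Psi> U t = inv_into (vcar (U \<otimes> U)) (emb_UU H U) (form_UU H \<Psi> U t)"

definition psi_UH :: "('k::field, 'h::ab_group_add) vsp \<Rightarrow> (('k, 'h, 'h) tens \<Rightarrow> ('k, 'h, 'h) tens)
    \<Rightarrow> ('k, 'h \<Rightarrow> 'k) vsp \<Rightarrow> ('k, 'h \<Rightarrow> 'k, 'h) tens \<Rightarrow> ('k, 'h, 'h \<Rightarrow> 'k) tens" where
  "psi_UH H \<Psi> U t = inv_into (vcar (H \<otimes> U)) (emb_HU H U) (form_UH H \<Psi> U t)"

definition psi_HU :: "('k::field, 'h::ab_group_add) vsp \<Rightarrow> (('k, 'h, 'h) tens \<Rightarrow> ('k, 'h, 'h) tens)
    \<Rightarrow> ('k, 'h \<Rightarrow> 'k) vsp \<Rightarrow> ('k, 'h, 'h \<Rightarrow> 'k) tens \<Rightarrow> ('k, 'h \<Rightarrow> 'k, 'h) tens" where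
  "psi_HU H \<Psi> U t = inv_into (vcar (U \<otimes> H)) (emb_UH H U) (form_HU H \<Psi> U t)"

definition inv_braiding :: "('k::field, 'v::ab_group_add) vsp \<Rightarrow> (('k, 'v, 'v) tens \<Rightarrow> ('k, 'v, 'v) tens)
    \<Rightarrow> ('k, 'v, 'v) tens \<Rightarrow> ('k, 'v, 'v) tens" where
  "inv_braiding V \<Psi> = inv_into (vcar (V \<otimes> V)) \<Psi>"

end

theory Submission
  imports Defs
begin

text \<open>Under the nested pairing
  \<open>\<langle>\<langle>f \<otimes> g, x \<otimes> y\<rangle>\<rangle> = f(y) g(x)\<close> the map \<open>\<Psi>\<^sub>U\<^sub>U\<close> is the transpose of \<open>\<Psi>\<^sub>H\<^sub>H\<close>: \<open>\<langle>\<langle>\<Psi>\<^sub>U\<^sub>U q, s\<rangle>\<rangle> = \<langle>\<langle>q, \<Psi>\<^sub>H\<^sub>H s\<rangle>\<rangle>\<close>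
  (\<open>full_transpose\<close>). Likewise \<open>\<Psi>\<^sub>U\<^sub>H\<close> is a transpose in only one of the two factors: with \<open>\<Phi>\<close> the
  braiding \<open>\<Psi>\<^sub>H\<^sub>H\<close> or its inverse, applying \<open>\<Psi>\<^sub>U\<^sub>H\<close> to \<open>g \<otimes> a\<close> and then evaluating the \<open>U\<close>-factor
  at \<open>b\<close> gives the same element of \<open>H\<close> as applying \<open>g\<close> to the first factor of \<open>\<Phi>(a \<otimes> b)\<close>
  (\<open>half_transpose\<close>). This holds because the defining formula tests both elements of \<open>H\<close> against all
  functionals \<open>f \<in> H'\<close>, and these separate points.\<close>

text \<open>Everything else is transposition of an identity between maps on \<open>H \<otimes> H \<otimes> H\<close>. Let \<open>\<Theta>\<close> be one of the
  two braidings \<open>\<Psi>\<^sub>H\<^sub>H\<close>, \<open>\<Psi>\<^sub>H\<^sub>H\<^sup>-\<^sup>1\<close>. Evaluating the last \<open>U\<close>-factor at \<open>b\<close> turns the composite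
  \<open>(id \<otimes> \<Psi>\<^sub>U\<^sub>H)(\<Psi>\<^sub>U\<^sub>H \<otimes> id)\<close> on \<open>g \<otimes> s\<close> into \<open>(g \<otimes> id \<otimes> id)(\<Phi> \<otimes> id)(id \<otimes> \<Phi>)(s \<otimes> b)\<close>
  (\<open>half_transpose_right\<close>), so that the equation making \<open>U\<close> right \<open>H\<close>-braided becomes
  \<open>\<Phi>\<^sub>1\<^sub>2 \<Phi>\<^sub>2\<^sub>3 \<Theta>\<^sub>1\<^sub>2 = \<Theta>\<^sub>2\<^sub>3 \<Phi>\<^sub>1\<^sub>2 \<Phi>\<^sub>2\<^sub>3\<close>, and compatibility of \<open>\<Psi>\<^sub>U\<^sub>H\<close> with a (co)multiplication of \<open>H\<close> becomes
  compatibility of \<open>\<Phi>\<close> with it on the left. Pairing \<open>U \<otimes> U\<close> with \<open>w \<in> H \<otimes> H\<close> turns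
  \<open>(\<Psi>\<^sub>U\<^sub>H \<otimes> id)(id \<otimes> \<Psi>\<^sub>U\<^sub>H)\<close> on \<open>q \<otimes> a\<close> into \<open>(\<langle>\<langle>q, -\<rangle>\<rangle> \<otimes> id)(id \<otimes> \<Phi>)(\<Phi> \<otimes> id)(a \<otimes> w)\<close>
  (\<open>half_transpose_left\<close>), so that the equation making \<open>H\<close> left \<open>U\<close>-braided becomes
  \<open>\<Theta>\<^sub>1\<^sub>2 \<Phi>\<^sub>2\<^sub>3 \<Phi>\<^sub>1\<^sub>2 = \<Phi>\<^sub>2\<^sub>3 \<Phi>\<^sub>1\<^sub>2 \<Theta>\<^sub>2\<^sub>3\<close>. For all choices of \<open>\<Theta>\<close> and \<open>\<Phi>\<close> these relations follow from
  the braid equation of \<open>\<Psi>\<^sub>H\<^sub>H\<close> by inverting factors (\<open>mixed_hexagons\<close>), and inverting exchanges left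
  and right compatibility. That these evaluations detect equality is
  \<open>tensor_zero_if_slices_zero\<close>: a tensor in \<open>X \<otimes> Y\<close> vanishes if all its slices along a separating set
  of functionals on \<open>Y\<close> do.\<close>

text \<open>The statements about \<open>\<Psi>\<^sub>H\<^sub>U\<close> are mirror images. Conjugating with the flip \<open>x \<otimes> y \<mapsto> y \<otimes> x\<close> turns
  \<open>\<Psi>\<^sub>H\<^sub>U\<close> into a half transpose \<open>U \<otimes> H \<rightarrow> H \<otimes> U\<close> of the flipped braiding, and exchanges left with right
  in all equations; opposite multiplications and comultiplications replace the given ones.\<close>

section \<open>Linear maps on tensor products\<close>

lemma linI:
  assumes "\<And>x. x \<in> vcar V \<Longrightarrow> f x \<in> vcar W"
    and "\<And>x y. x \<in> vcar V \<Longrightarrow> y \<in> vcar V \<Longrightarrow> f (x + y) = f x + f y"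
    and "\<And>c x. x \<in> vcar V \<Longrightarrow> f (vscl V c x) = vscl W c (f x)"
  shows "lin V W f"
  using assms by (simp add: lin_def)

lemma lin_mem: "lin V W f \<Longrightarrow> x \<in> vcar V \<Longrightarrow> f x \<in> vcar W"
  and lin_add: "lin V W f \<Longrightarrow> x \<in> vcar V \<Longrightarrow> y \<in> vcar V \<Longrightarrow> f (x + y) = f x + f y"
  and lin_scale: "lin V W f \<Longrightarrow> x \<in> vcar V \<Longrightarrow> f (vscl V c x) = vscl W c (f x)"
  by (auto simp: lin_def)

lemma lin_ident [simp]: "lin V V (\<lambda>x. x)" "lin V V id"
  by (auto simp: lin_def)

lemma lin_comp: "lin W X g \<Longrightarrow> lin V W f \<Longrightarrow> lin V X (\<lambda>v. g (f v))"
  by (simp add: lin_def)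

lemma vscl_zero [simp]: "vspace V \<Longrightarrow> vscl V 0 x = 0"
  unfolding vspace_def by (meson module.scale_zero_left module_iff_vector_space)

lemma vscl_assoc: "vspace V \<Longrightarrow> vscl V a (vscl V b x) = vscl V (a * b) x"
  unfolding vspace_def by (meson module.scale_scale module_iff_vector_space)

lemma vscl_add_left: "vspace V \<Longrightarrow> vscl V (a + b) x = vscl V a x + vscl V b x"
  unfolding vspace_def by (meson module.scale_left_distrib module_iff_vector_space)

lemma vscl_add_right: "vspace V \<Longrightarrow> vscl V a (x + y) = vscl V a x + vscl V a y"
  unfolding vspace_def by (meson module.scale_right_distrib module_iff_vector_space)

lemma lin_zero: "vspace V \<Longrightarrow> vspace W \<Longrightarrow> lin V W f \<Longrightarrow> f 0 = 0"
  by (metis lin_scale vscl_zero vspace_zero)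

lemma lin_sum:
  assumes "vspace V" "vspace W" "lin V W f" "\<And>i. i \<in> I \<Longrightarrow> x i \<in> vcar V"
  shows "f (sum x I) = (\<Sum>i\<in>I. f (x i)) \<and> sum x I \<in> vcar V"
  using assms(4)
proof (induction I rule: infinite_finite_induct)
  case (insert i I)
  then show ?case using assms(1-3) by (auto simp: lin_add vspace_add)
qed (use assms(1-3) in \<open>auto simp: lin_zero vspace_zero\<close>)

lemma ground_simps [simp]: "vspace ground" "x \<in> vcar ground" "vscl ground = (*)"
  by (rule vspace_ground) (simp_all add: ground_def)

lemma vscl_tensor [simp]: "vscl (V \<otimes> W) = fscale"
  by (simp add: tensor_def)

lemma vscl_dual [simp]: "vscl (dual V) = fscale"
  by (simp add: dual_def)

text \<open>Elements of duals and of tensor products are functions. Evaluating their sums pointwise would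
  hide the linear structure from rewriting.\<close>

declare plus_fun_apply [simp del] zero_fun_apply [simp del]
declare vspace_tensor [simp] vspace_dual [simp] tens_in_tensor [simp]

lemma lin_scaled: "vspace X \<Longrightarrow> lin V ground \<epsilon> \<Longrightarrow> x \<in> vcar X \<Longrightarrow> lin V X (\<lambda>v. vscl X (\<epsilon> v) x)"
  by (rule linI) (simp_all add: vspace_scale lin_add lin_scale vscl_assoc vscl_add_left)

lemma lin_scaling: "vspace X \<Longrightarrow> lin V X f \<Longrightarrow> lin V X (\<lambda>v. vscl X c (f v))"
  by (rule linI) (simp_all add: vspace_scale lin_mem lin_add lin_scale vscl_assoc vscl_add_right mult.commute)

lemma lin_plus: "vspace X \<Longrightarrow> lin V X f \<Longrightarrow> lin V X g \<Longrightarrow> lin V X (\<lambda>v. f v + g v)"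
  by (rule linI) (simp_all add: vspace_add lin_mem lin_add[of V X f] lin_add[of V X g] lin_scale[of V X f]
      lin_scale[of V X g] vscl_add_right algebra_simps)

lemma lin_tens_left: "vspace V \<Longrightarrow> vspace W \<Longrightarrow> w \<in> vcar W \<Longrightarrow> lin V (V \<otimes> W) (\<lambda>v. tens V W v w)"
  and lin_tens_right: "vspace V \<Longrightarrow> vspace W \<Longrightarrow> v \<in> vcar V \<Longrightarrow> lin W (V \<otimes> W) (tens V W v)"
  using bilin_tens unfolding bilin_def by blast+

lemma bilinI:
  assumes "\<And>v. v \<in> vcar V \<Longrightarrow> lin W X (\<beta> v)" "\<And>w. w \<in> vcar W \<Longrightarrow> lin V X (\<lambda>v. \<beta> v w)"
  shows "bilin V W X \<beta>"
  using assms by (simp add: bilin_def)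

text \<open>The extension principle by which every identity between linear maps below is reduced to
  elementary tensors.\<close>

lemma tensor_eqI:
  assumes "vspace X" "lin (V \<otimes> W) X F" "lin (V \<otimes> W) X G"
    and "\<And>v w. v \<in> vcar V \<Longrightarrow> w \<in> vcar W \<Longrightarrow> F (tens V W v w) = G (tens V W v w)"
    and "t \<in> vcar (V \<otimes> W)"
  shows "F t = G t"
  using assms(5)
proof (induction rule: tensor_induct)
  case zero
  show ?case
    using lin_zero[OF vspace_tensor assms(1,2)] lin_zero[OF vspace_tensor assms(1,3)] by argo
next
  case (add s t)
  show ?case
    using lin_add[OF assms(2) add(1,2)] lin_add[OF assms(3) add(1,2)] add(3,4) by argo
next
  case (scale c t)
  show ?case
    using lin_scale[OF assms(2) scale(1), of c] lin_scale[OF assms(3) scale(1), of c] scale(2) by argo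
next
  case (tens v w)
  then show ?case by (rule assms(4))
qed

text \<open>A lifted map also depends linearly on any parameter on which the underlying bilinear map
  depends linearly. This gives the linearity of maps built from nested lifts, such as
  \<open>assoc\<close> and the dual-valued maps.\<close>

lemma lin_lift_parameter:
  assumes "vspace X" "\<And>q. q \<in> vcar Q \<Longrightarrow> bilin V W X (\<beta> q)" "vspace Q"
    and "\<And>v w. v \<in> vcar V \<Longrightarrow> w \<in> vcar W \<Longrightarrow> lin Q X (\<lambda>q. \<beta> q v w)"
    and "t \<in> vcar (V \<otimes> W)"
  shows "lin Q X (\<lambda>q. lift V W X (\<beta> q) t)"
  using assms(5)
proof (induction rule: tensor_induct)
  case zero
  have "lift V W X (\<beta> q) 0 = 0" if "q \<in> vcar Q" for q
    using lin_zero[OF vspace_tensor assms(1) lin_lift[OF assms(1) assms(2)[OF that]]] .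
  moreover have "vscl X c 0 = 0" for c
    using vscl_assoc[OF assms(1), of c 0 0] assms(1) by simp
  ultimately show ?case using assms(1,3)
    by (intro linI) (auto simp: vspace_zero vspace_add vspace_scale)
next
  case (add s t)
  have "lift V W X (\<beta> q) (s + t) = lift V W X (\<beta> q) s + lift V W X (\<beta> q) t" if "q \<in> vcar Q" for q
    using lin_add[OF lin_lift[OF assms(1) assms(2)[OF that]]] add by blast
  then show ?case using lin_plus[OF assms(1) add(3,4)] assms(3)
    by (simp add: lin_def vspace_add vspace_scale)
next
  case (scale c t)
  have "lift V W X (\<beta> q) (vscl (V \<otimes> W) c t) = vscl X c (lift V W X (\<beta> q) t)" if "q \<in> vcar Q" for q
    using lin_scale[OF lin_lift[OF assms(1) assms(2)[OF that]]] scale by blast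
  then show ?case using lin_scaling[OF assms(1) scale(2), of c] assms(3)
    by (simp add: lin_def vspace_add vspace_scale)
next
  case (tens v w)
  then show ?case using assms(1-4) by (simp add: lift_tens lin_def vspace_add vspace_scale)
qed

lemma bilin_tmap:
  assumes "vspace V'" "vspace W'" "lin V V' f" "lin W W' g"
  shows "bilin V W (V' \<otimes> W') (\<lambda>v w. tens V' W' (f v) (g w))"
  by (rule bilinI)
    (auto intro!: lin_comp[OF lin_tens_left assms(3)] lin_comp[OF lin_tens_right assms(4)] assms
      simp: assms lin_mem[OF assms(3)] lin_mem[OF assms(4)])

lemma lin_tmap [simp]:
  "vspace V' \<Longrightarrow> vspace W' \<Longrightarrow> lin V V' f \<Longrightarrow> lin W W' g \<Longrightarrow> lin (V \<otimes> W) (V' \<otimes> W') (tmap V W V' W' f g)"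
  unfolding tmap_def by (simp add: lin_lift bilin_tmap)

lemma tmap_tens [simp]:
  "vspace V' \<Longrightarrow> vspace W' \<Longrightarrow> lin V V' f \<Longrightarrow> lin W W' g \<Longrightarrow> v \<in> vcar V \<Longrightarrow> w \<in> vcar W \<Longrightarrow>
   tmap V W V' W' f g (tens V W v w) = tens V' W' (f v) (g w)"
  unfolding tmap_def by (simp add: lift_tens bilin_tmap)

context
  fixes V :: "('k::field, 'v::ab_group_add) vsp" and W :: "('k, 'w::ab_group_add) vsp"
    and X :: "('k, 'x::ab_group_add) vsp"
  assumes vs [simp]: "vspace V" "vspace W" "vspace X"
begin

lemma bilin_assoc_inner:
  "x \<in> vcar X \<Longrightarrow> bilin V W (V \<otimes> (W \<otimes> X)) (\<lambda>v w. tens V (W \<otimes> X) v (tens W X w x))"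
  by (rule bilin_tmap) (simp_all add: lin_tens_left)

lemma bilin_assoc:
  "bilin (V \<otimes> W) X (V \<otimes> (W \<otimes> X))
     (\<lambda>t x. lift V W (V \<otimes> (W \<otimes> X)) (\<lambda>v w. tens V (W \<otimes> X) v (tens W X w x)) t)"
  by (rule bilinI)
    (auto intro!: lin_lift_parameter bilin_assoc_inner lin_lift lin_comp[OF lin_tens_right] simp: lin_tens_right)

lemma lin_assoc [simp]: "lin (V \<otimes> W \<otimes> X) (V \<otimes> (W \<otimes> X)) (assoc V W X)"
  unfolding assoc_def by (simp add: lin_lift bilin_assoc)

lemma assoc_tens [simp]:
  "v \<in> vcar V \<Longrightarrow> w \<in> vcar W \<Longrightarrow> x \<in> vcar X \<Longrightarrow>
   assoc V W X (tens (V \<otimes> W) X (tens V W v w) x) = tens V (W \<otimes> X) v (tens W X w x)"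
  unfolding assoc_def by (simp add: lift_tens bilin_assoc bilin_assoc_inner)

lemma bilin_assoc_inv_inner:
  "v \<in> vcar V \<Longrightarrow> bilin W X (V \<otimes> W \<otimes> X) (\<lambda>w x. tens (V \<otimes> W) X (tens V W v w) x)"
  by (rule bilin_tmap) (simp_all add: lin_tens_right)

lemma bilin_assoc_inv:
  "bilin V (W \<otimes> X) (V \<otimes> W \<otimes> X)
     (\<lambda>v t. lift W X (V \<otimes> W \<otimes> X) (\<lambda>w x. tens (V \<otimes> W) X (tens V W v w) x) t)"
  by (rule bilinI)
    (auto intro!: lin_lift_parameter bilin_assoc_inv_inner lin_lift lin_comp[OF lin_tens_left] simp: lin_tens_left)

lemma lin_assoc_inv [simp]: "lin (V \<otimes> (W \<otimes> X)) (V \<otimes> W \<otimes> X) (assoc_inv V W X)"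
  unfolding assoc_inv_def by (simp add: lin_lift bilin_assoc_inv)

lemma assoc_inv_tens [simp]:
  "v \<in> vcar V \<Longrightarrow> w \<in> vcar W \<Longrightarrow> x \<in> vcar X \<Longrightarrow>
   assoc_inv V W X (tens V (W \<otimes> X) v (tens W X w x)) = tens (V \<otimes> W) X (tens V W v w) x"
  unfolding assoc_inv_def by (simp add: lift_tens bilin_assoc_inv bilin_assoc_inv_inner)

lemma tensor3_eqI:
  assumes "vspace Y" "lin (V \<otimes> W \<otimes> X) Y F" "lin (V \<otimes> W \<otimes> X) Y G"
    and "\<And>v w x. v \<in> vcar V \<Longrightarrow> w \<in> vcar W \<Longrightarrow> x \<in> vcar X \<Longrightarrow>
      F (tens (V \<otimes> W) X (tens V W v w) x) = G (tens (V \<otimes> W) X (tens V W v w) x)"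
    and "t \<in> vcar (V \<otimes> W \<otimes> X)"
  shows "F t = G t"
  using assms(1-3) _ assms(5)
proof (rule tensor_eqI)
  fix s x assume s: "s \<in> vcar (V \<otimes> W)" and x: "x \<in> vcar X"
  show "F (tens (V \<otimes> W) X s x) = G (tens (V \<otimes> W) X s x)"
    by (rule tensor_eqI[OF assms(1) _ _ _ s])
      (use x in \<open>auto intro!: lin_comp[OF assms(2)] lin_comp[OF assms(3)] lin_tens_left assms(4)\<close>)
qed

lemma tensor3_eqI':
  assumes "vspace Y" "lin (V \<otimes> (W \<otimes> X)) Y F" "lin (V \<otimes> (W \<otimes> X)) Y G"
    and "\<And>v w x. v \<in> vcar V \<Longrightarrow> w \<in> vcar W \<Longrightarrow> x \<in> vcar X \<Longrightarrow>
      F (tens V (W \<otimes> X) v (tens W X w x)) = G (tens V (W \<otimes> X) v (tens W X w x))"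
    and "t \<in> vcar (V \<otimes> (W \<otimes> X))"
  shows "F t = G t"
  using assms(1-3) _ assms(5)
proof (rule tensor_eqI)
  fix v s assume s: "s \<in> vcar (W \<otimes> X)" and v: "v \<in> vcar V"
  show "F (tens V (W \<otimes> X) v s) = G (tens V (W \<otimes> X) v s)"
    by (rule tensor_eqI[OF assms(1) _ _ _ s])
      (use v in \<open>auto intro!: lin_comp[OF assms(2)] lin_comp[OF assms(3)] lin_tens_right assms(4)\<close>)
qed

lemma assoc_in: "t \<in> vcar (V \<otimes> W \<otimes> X) \<Longrightarrow> assoc V W X t \<in> vcar (V \<otimes> (W \<otimes> X))"
  by (rule lin_mem[OF lin_assoc])

lemma assoc_inv_in: "t \<in> vcar (V \<otimes> (W \<otimes> X)) \<Longrightarrow> assoc_inv V W X t \<in> vcar (V \<otimes> W \<otimes> X)"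
  by (rule lin_mem[OF lin_assoc_inv])

lemma assoc_inv_assoc [simp]: "t \<in> vcar (V \<otimes> W \<otimes> X) \<Longrightarrow> assoc_inv V W X (assoc V W X t) = t"
  by (rule tensor3_eqI[where F = "\<lambda>t. assoc_inv V W X (assoc V W X t)" and G = "\<lambda>t. t"])
    (auto intro: lin_comp[OF lin_assoc_inv])

lemma assoc_assoc_inv [simp]: "t \<in> vcar (V \<otimes> (W \<otimes> X)) \<Longrightarrow> assoc V W X (assoc_inv V W X t) = t"
  by (rule tensor3_eqI'[where F = "\<lambda>t. assoc V W X (assoc_inv V W X t)" and G = "\<lambda>t. t"])
    (auto intro: lin_comp[OF lin_assoc])

text \<open>With \<open>tensor_eqI\<close>, this allows a test on \<open>s \<otimes> x\<close> or on \<open>v \<otimes> s\<close>, with \<open>s\<close> arbitrary: the two forms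
  on which \<open>\<Psi> \<otimes> id\<close> and \<open>id \<otimes> \<Psi>\<close>, respectively, are computed by \<open>\<Psi> s\<close>.\<close>

lemma tensor_eq_assocI:
  assumes "vspace Y" "lin (V \<otimes> W \<otimes> X) Y F" "lin (V \<otimes> W \<otimes> X) Y G"
    and "\<And>v s. v \<in> vcar V \<Longrightarrow> s \<in> vcar (W \<otimes> X) \<Longrightarrow>
      F (assoc_inv V W X (tens V (W \<otimes> X) v s)) = G (assoc_inv V W X (tens V (W \<otimes> X) v s))"
    and "t \<in> vcar (V \<otimes> W \<otimes> X)"
  shows "F t = G t"
  by (rule tensor3_eqI[OF assms(1-3) _ assms(5)]) (metis assms(4) assoc_inv_tens tens_in_tensor)

end

section \<open>Slicing tensors with functionals\<close>

lemma bilin_eps_id: "vspace X \<Longrightarrow> lin C ground \<epsilon> \<Longrightarrow> bilin C X X (\<lambda>c x. vscl X (\<epsilon> c) x)"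
  by (rule bilinI) (simp_all add: lin_scaling lin_scaled)

lemma bilin_id_eps: "vspace X \<Longrightarrow> lin C ground \<epsilon> \<Longrightarrow> bilin X C X (\<lambda>x c. vscl X (\<epsilon> c) x)"
  by (rule bilinI) (simp_all add: lin_scaling lin_scaled)

lemma lin_eps_id [simp]: "vspace X \<Longrightarrow> lin C ground \<epsilon> \<Longrightarrow> lin (C \<otimes> X) X (eps_id C X \<epsilon>)"
  and lin_id_eps [simp]: "vspace X \<Longrightarrow> lin C ground \<epsilon> \<Longrightarrow> lin (X \<otimes> C) X (id_eps X C \<epsilon>)"
  unfolding eps_id_def id_eps_def by (simp_all add: lin_lift bilin_eps_id bilin_id_eps)

lemma eps_id_tens [simp]:
  "vspace X \<Longrightarrow> lin C ground \<epsilon> \<Longrightarrow> c \<in> vcar C \<Longrightarrow> x \<in> vcar X \<Longrightarrow>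
   eps_id C X \<epsilon> (tens C X c x) = vscl X (\<epsilon> c) x"
  and id_eps_tens [simp]:
  "vspace X \<Longrightarrow> lin C ground \<epsilon> \<Longrightarrow> c \<in> vcar C \<Longrightarrow> x \<in> vcar X \<Longrightarrow>
   id_eps X C \<epsilon> (tens X C x c) = vscl X (\<epsilon> c) x"
  unfolding eps_id_def id_eps_def by (simp_all add: lift_tens bilin_eps_id bilin_id_eps)

lemma eps_id_in: "vspace X \<Longrightarrow> lin C ground \<epsilon> \<Longrightarrow> t \<in> vcar (C \<otimes> X) \<Longrightarrow> eps_id C X \<epsilon> t \<in> vcar X"
  and id_eps_in: "vspace X \<Longrightarrow> lin C ground \<epsilon> \<Longrightarrow> s \<in> vcar (X \<otimes> C) \<Longrightarrow> id_eps X C \<epsilon> s \<in> vcar X"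
  using lin_mem[OF lin_eps_id] lin_mem[OF lin_id_eps] by blast+

lemma lin_eps_id_parameter:
  assumes "vspace X" "vspace Q" "\<And>q. q \<in> vcar Q \<Longrightarrow> lin C ground (\<epsilon> q)"
    and "\<And>c. c \<in> vcar C \<Longrightarrow> lin Q ground (\<lambda>q. \<epsilon> q c)" "t \<in> vcar (C \<otimes> X)"
  shows "lin Q X (\<lambda>q. eps_id C X (\<epsilon> q) t)"
  unfolding eps_id_def
  by (rule lin_lift_parameter) (use assms in \<open>auto simp: bilin_eps_id lin_scaled\<close>)

lemma lin_id_eps_parameter:
  assumes "vspace X" "vspace Q" "\<And>q. q \<in> vcar Q \<Longrightarrow> lin C ground (\<epsilon> q)"
    and "\<And>c. c \<in> vcar C \<Longrightarrow> lin Q ground (\<lambda>q. \<epsilon> q c)" "t \<in> vcar (X \<otimes> C)"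
  shows "lin Q X (\<lambda>q. id_eps X C (\<epsilon> q) t)"
  unfolding id_eps_def
  by (rule lin_lift_parameter) (use assms in \<open>auto simp: bilin_id_eps lin_scaled\<close>)

lemma eps_id_cong:
  assumes "vspace X" "lin C ground \<epsilon>" "lin C ground \<epsilon>'" "\<And>c. c \<in> vcar C \<Longrightarrow> \<epsilon> c = \<epsilon>' c" "t \<in> vcar (C \<otimes> X)"
  shows "eps_id C X \<epsilon> t = eps_id C X \<epsilon>' t"
  by (rule tensor_eqI[OF _ _ _ _ assms(5)]) (use assms in auto)

lemma id_eps_cong:
  assumes "vspace X" "lin C ground \<epsilon>" "lin C ground \<epsilon>'" "\<And>c. c \<in> vcar C \<Longrightarrow> \<epsilon> c = \<epsilon>' c" "t \<in> vcar (X \<otimes> C)"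
  shows "id_eps X C \<epsilon> t = id_eps X C \<epsilon>' t"
  by (rule tensor_eqI[OF _ _ _ _ assms(5)]) (use assms in auto)

lemma eps_id_tmap:
  assumes "vspace C" "vspace X" "vspace Y" "lin C ground \<epsilon>" "lin X Y f" "t \<in> vcar (C \<otimes> X)"
  shows "eps_id C Y \<epsilon> (tmap C X C Y id f t) = f (eps_id C X \<epsilon> t)"
  by (rule tensor_eqI[OF _ _ _ _ assms(6)])
    (use assms in \<open>auto intro!: lin_comp[OF lin_eps_id] lin_comp[OF assms(5)] simp: lin_mem[OF assms(5)] lin_scale[OF assms(5)]\<close>)

lemma id_eps_tmap:
  assumes "vspace C" "vspace X" "vspace Y" "lin C ground \<epsilon>" "lin X Y f" "t \<in> vcar (X \<otimes> C)"
  shows "id_eps Y C \<epsilon> (tmap X C Y C f id t) = f (id_eps X C \<epsilon> t)"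
  by (rule tensor_eqI[OF _ _ _ _ assms(6)])
    (use assms in \<open>auto intro!: lin_comp[OF lin_id_eps] lin_comp[OF assms(5)] simp: lin_mem[OF assms(5)] lin_scale[OF assms(5)]\<close>)

lemma eps_id_tmap_left:
  assumes "vspace C" "vspace D" "vspace X" "lin D ground \<epsilon>" "lin C D f" "t \<in> vcar (C \<otimes> X)"
  shows "eps_id D X \<epsilon> (tmap C X D X f id t) = eps_id C X (\<lambda>c. \<epsilon> (f c)) t"
  by (rule tensor_eqI[OF _ _ _ _ assms(6)])
    (use assms lin_comp[OF assms(4,5)] in \<open>auto intro!: lin_comp[OF lin_eps_id] simp: lin_mem[OF assms(5)]\<close>)

lemma id_eps_tmap_right:
  assumes "vspace C" "vspace D" "vspace X" "lin D ground \<epsilon>" "lin C D f" "t \<in> vcar (X \<otimes> C)"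
  shows "id_eps X D \<epsilon> (tmap X C X D id f t) = id_eps X C (\<lambda>c. \<epsilon> (f c)) t"
  by (rule tensor_eqI[OF _ _ _ _ assms(6)])
    (use assms lin_comp[OF assms(4,5)] in \<open>auto intro!: lin_comp[OF lin_id_eps] simp: lin_mem[OF assms(5)]\<close>)

text \<open>Expand the tensor as \<open>\<Sum> x \<otimes> c(x)\<close> over finitely many elements \<open>x\<close> of a basis of \<open>X\<close>. The slice along
  \<open>\<epsilon>\<close> is \<open>\<Sum> \<epsilon>(c(x)) x\<close>, so by linear independence all \<open>\<epsilon>(c(x))\<close> vanish, hence all \<open>c(x)\<close>.\<close>

lemma tensor_zero_if_slices_zero:
  fixes X :: "('k::field, 'x::ab_group_add) vsp" and Y :: "('k, 'y::ab_group_add) vsp"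
  assumes X: "vspace X" and Y: "vspace Y" and E: "\<And>\<epsilon>. \<epsilon> \<in> E \<Longrightarrow> lin Y ground \<epsilon>"
    and sep: "\<And>y. y \<in> vcar Y \<Longrightarrow> \<forall>\<epsilon>\<in>E. \<epsilon> y = 0 \<Longrightarrow> y = 0"
    and t: "t \<in> vcar (X \<otimes> Y)" and slices: "\<And>\<epsilon>. \<epsilon> \<in> E \<Longrightarrow> id_eps X Y \<epsilon> t = 0"
  shows "t = 0"
proof -
  interpret X: vector_space "vscl X" using X by (simp add: vspace_def)
  obtain B where B: "B \<subseteq> vcar X" "X.independent B" "vcar X \<subseteq> X.span B"
    using X.maximal_independent_subset by blast
  have tens0: "tens X Y x 0 = 0" "tens X Y 0 y = 0" if "x \<in> vcar X" "y \<in> vcar Y" for x y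
    using lin_zero[OF Y vspace_tensor lin_tens_right[OF X Y that(1)]]
      lin_zero[OF X vspace_tensor lin_tens_left[OF X Y that(2)]] by auto
  have tens_add: "tens X Y x (y + z) = tens X Y x y + tens X Y x z"
    "tens X Y x (vscl Y c y) = fscale c (tens X Y x y)"
    if "x \<in> vcar X" "y \<in> vcar Y" "z \<in> vcar Y" for x y z c
    using lin_add[OF lin_tens_right[OF X Y that(1)] that(2,3)]
      lin_scale[OF lin_tens_right[OF X Y that(1)] that(2)] by auto
  \<comment> \<open>The coefficient function vanishes off \<open>F\<close>, so that two expansions can be added over the union of their supports.\<close>
  have "\<exists>F c. finite F \<and> F \<subseteq> B \<and> (\<forall>x. c x \<in> vcar Y) \<and> (\<forall>x. x \<notin> F \<longrightarrow> c x = 0) \<and>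
      t = (\<Sum>x\<in>F. tens X Y x (c x))"
    using t
  proof (induction rule: tensor_induct)
    case zero
    show ?case using vspace_zero[OF Y] by (intro exI[of _ "{}"] exI[of _ "\<lambda>_. 0"]) auto
  next
    case (add s t)
    then obtain F c G d where F: "finite F" "F \<subseteq> B" "\<forall>x. c x \<in> vcar Y" "\<forall>x. x \<notin> F \<longrightarrow> c x = 0"
      "s = (\<Sum>x\<in>F. tens X Y x (c x))" and G: "finite G" "G \<subseteq> B" "\<forall>x. d x \<in> vcar Y"
      "\<forall>x. x \<notin> G \<longrightarrow> d x = 0" "t = (\<Sum>x\<in>G. tens X Y x (d x))" by blast
    have s: "s = (\<Sum>x\<in>F \<union> G. tens X Y x (c x))"
      unfolding F(5) using F G B(1) tens0 vspace_zero[OF Y] by (intro sum.mono_neutral_left) auto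
    have t: "t = (\<Sum>x\<in>F \<union> G. tens X Y x (d x))"
      unfolding G(5) using F G B(1) tens0 vspace_zero[OF Y] by (intro sum.mono_neutral_left) auto
    have "s + t = (\<Sum>x\<in>F \<union> G. tens X Y x (c x + d x))"
      unfolding s t sum.distrib[symmetric]
      using F(2,3) G(2,3) B(1) by (intro sum.cong refl tens_add(1)[symmetric]) auto
    then show ?case using F(1-4) G(1-4)
      by (intro exI[of _ "F \<union> G"] exI[of _ "\<lambda>x. c x + d x"]) (auto intro: vspace_add[OF Y])
  next
    case (scale a t)
    then obtain F c where F: "finite F" "F \<subseteq> B" "\<forall>x. c x \<in> vcar Y" "\<forall>x. x \<notin> F \<longrightarrow> c x = 0"
      "t = (\<Sum>x\<in>F. tens X Y x (c x))" by blast
    interpret T: vector_space "fscale :: 'k \<Rightarrow> (('x \<Rightarrow> 'y \<Rightarrow> 'k) \<Rightarrow> 'k) \<Rightarrow> _" by (rule vector_space_fscale)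
    interpret Y: vector_space "vscl Y" using Y by (simp add: vspace_def)
    have "vscl (X \<otimes> Y) a t = (\<Sum>x\<in>F. tens X Y x (vscl Y a (c x)))"
      unfolding F(5) vscl_tensor T.scale_sum_right
      using F(2,3) B(1) by (intro sum.cong refl tens_add(2)[symmetric]) auto
    then show ?case using F(1-4)
      by (intro exI[of _ F] exI[of _ "\<lambda>x. vscl Y a (c x)"]) (auto intro: vspace_scale[OF Y])
  next
    case (tens x y)
    then have "x \<in> X.span B" using B(3) by blast
    then obtain F r where F: "finite F" "F \<subseteq> B" "x = (\<Sum>b\<in>F. vscl X (r b) b)"
      unfolding X.span_explicit by blast
    have FX: "b \<in> vcar X" if "b \<in> F" for b using that F(2) B(1) by blast
    have "tens X Y x y = (\<Sum>b\<in>F. tens X Y (vscl X (r b) b) y)"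
      using lin_sum[OF X vspace_tensor lin_tens_left[OF X Y tens(2)], of F "\<lambda>b. vscl X (r b) b"]
        vspace_scale[OF X FX] F(3) by auto
    also have "\<dots> = (\<Sum>b\<in>F. tens X Y b (if b \<in> F then vscl Y (r b) y else 0))"
      using lin_scale[OF lin_tens_left[OF X Y tens(2)] FX] tens_add(2)[OF FX tens(2) tens(2)]
      by (intro sum.cong) auto
    finally show ?case using F(1,2) tens(2)
      by (intro exI[of _ F] exI[of _ "\<lambda>b. if b \<in> F then vscl Y (r b) y else 0"])
        (auto intro: vspace_scale[OF Y] vspace_zero[OF Y])
  qed
  then obtain F c where F: "finite F" "F \<subseteq> B" "\<And>x. c x \<in> vcar Y" "t = (\<Sum>x\<in>F. tens X Y x (c x))"
    by blast
  have FX: "b \<in> vcar X" if "b \<in> F" for b using that F(2) B(1) by blast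
  have "c b = 0" if b: "b \<in> F" for b
  proof (rule sep[OF F(3)], intro ballI)
    fix \<epsilon> assume \<epsilon>: "\<epsilon> \<in> E"
    have "(\<Sum>x\<in>F. vscl X (\<epsilon> (c x)) x) = id_eps X Y \<epsilon> t"
      using lin_sum[OF vspace_tensor X lin_id_eps[OF X E[OF \<epsilon>]], of F "\<lambda>x. tens X Y x (c x)"]
        FX F(3,4) by (simp add: X E[OF \<epsilon>])
    then have "(\<Sum>x\<in>F. vscl X (\<epsilon> (c x)) x) = 0" using slices[OF \<epsilon>] by simp
    then show "\<epsilon> (c b) = 0"
      using X.independentD[OF X.independent_mono[OF B(2) F(2)] F(1) order_refl _ b,
          where u = "\<lambda>x. \<epsilon> (c x)"] by blast
  qed
  then show ?thesis using F(4) FX tens0 vspace_zero[OF Y] by simp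
qed

section \<open>Applying a map to two neighbouring factors\<close>

context
  fixes V :: "('k::field, 'v::ab_group_add) vsp" and W :: "('k, 'w::ab_group_add) vsp"
    and X :: "('k, 'x::ab_group_add) vsp" and \<Psi>
  assumes vs [simp]: "vspace V" "vspace W" "vspace X" and lin\<Psi> [simp]: "lin (V \<otimes> W) (W \<otimes> V) \<Psi>"
begin

lemma lin_psi_id [simp]: "lin (V \<otimes> W \<otimes> X) (W \<otimes> V \<otimes> X) (psi_id V W X \<Psi>)"
  by (simp add: psi_id_def)

lemma psi_id_tens [simp]:
  "s \<in> vcar (V \<otimes> W) \<Longrightarrow> x \<in> vcar X \<Longrightarrow> psi_id V W X \<Psi> (tens (V \<otimes> W) X s x) = tens (W \<otimes> V) X (\<Psi> s) x"
  by (simp add: psi_id_def)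

lemma lin_id_psi [simp]: "lin (X \<otimes> V \<otimes> W) (X \<otimes> W \<otimes> V) (id_psi X V W \<Psi>)"
  unfolding id_psi_def comp_def by (intro lin_comp[OF lin_assoc_inv] lin_comp[OF lin_tmap]) simp_all

lemma id_psi_tens [simp]:
  "x \<in> vcar X \<Longrightarrow> s \<in> vcar (V \<otimes> W) \<Longrightarrow>
   id_psi X V W \<Psi> (assoc_inv X V W (tens X (V \<otimes> W) x s)) = assoc_inv X W V (tens X (W \<otimes> V) x (\<Psi> s))"
  by (simp add: id_psi_def)

lemma id_psi_tens' [simp]:
  "x \<in> vcar X \<Longrightarrow> v \<in> vcar V \<Longrightarrow> w \<in> vcar W \<Longrightarrow>
   id_psi X V W \<Psi> (tens (X \<otimes> V) W (tens X V x v) w) = assoc_inv X W V (tens X (W \<otimes> V) x (\<Psi> (tens V W v w)))"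
  by (simp add: id_psi_def)

lemma psi_id_in: "t \<in> vcar (V \<otimes> W \<otimes> X) \<Longrightarrow> psi_id V W X \<Psi> t \<in> vcar (W \<otimes> V \<otimes> X)"
  by (rule lin_mem[OF lin_psi_id])

lemma id_psi_in: "t \<in> vcar (X \<otimes> V \<otimes> W) \<Longrightarrow> id_psi X V W \<Psi> t \<in> vcar (X \<otimes> W \<otimes> V)"
  by (rule lin_mem[OF lin_id_psi])

lemma psi_id_inverse:
  assumes "lin (W \<otimes> V) (V \<otimes> W) \<Psi>'" "\<And>t. t \<in> vcar (V \<otimes> W) \<Longrightarrow> \<Psi>' (\<Psi> t) = t" "t \<in> vcar (V \<otimes> W \<otimes> X)"
  shows "psi_id W V X \<Psi>' (psi_id V W X \<Psi> t) = t"
  unfolding psi_id_def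
  by (rule tensor_eqI[OF _ _ _ _ assms(3)])
    (use assms in \<open>auto intro!: lin_comp[OF lin_tmap] simp: lin_mem[OF lin\<Psi>]\<close>)

lemma id_psi_inverse:
  assumes "lin (W \<otimes> V) (V \<otimes> W) \<Psi>'" "\<And>t. t \<in> vcar (V \<otimes> W) \<Longrightarrow> \<Psi>' (\<Psi> t) = t" "t \<in> vcar (X \<otimes> V \<otimes> W)"
  shows "id_psi X W V \<Psi>' (id_psi X V W \<Psi> t) = t"
proof -
  have "tmap X (W \<otimes> V) X (V \<otimes> W) id \<Psi>' (tmap X (V \<otimes> W) X (W \<otimes> V) id \<Psi> s) = s" if "s \<in> vcar (X \<otimes> (V \<otimes> W))" for s
    by (rule tensor_eqI[OF _ _ _ _ that])
      (use assms in \<open>auto intro!: lin_comp[OF lin_tmap] simp: lin_mem[OF lin\<Psi>]\<close>)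
  then show ?thesis
    using assms(3) by (simp add: id_psi_def assoc_in lin_mem[OF lin_tmap])
qed

end

section \<open>Mirror images\<close>

text \<open>Exchanging the two arguments of the bilinear forms on which a tensor is evaluated realises
  \<open>v \<otimes> w \<mapsto> w \<otimes> v\<close>. Unlike the lift of this bilinear map it is an involution on all functions,
  which makes \<open>mirror\<close> below an involution without restriction to carriers.\<close>

definition flip :: "('k::field, 'v, 'w) tens \<Rightarrow> ('k, 'w, 'v) tens" where
  "flip t = (\<lambda>B. t (\<lambda>v w. B w v))"

lemma flip_flip [simp]: "flip (flip t) = t"
  by (simp add: flip_def)

lemma flip_tens [simp]: "flip (tens V W v w) = tens W V w v"
  by (auto simp: flip_def tens_def bilin_def fun_eq_iff)

lemma flip_in [simp]: "t \<in> vcar (V \<otimes> W) \<Longrightarrow> flip t \<in> vcar (W \<otimes> V)"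
proof (induction rule: tensor_induct)
  case zero
  then show ?case using vspace_zero[OF vspace_tensor, of W V] by (simp add: flip_def zero_fun_def)
next
  case (add s t)
  moreover have "flip (s + t) = flip s + flip t" by (simp add: flip_def plus_fun_def)
  ultimately show ?case by (simp add: vspace_add)
next
  case (scale c t)
  moreover have "flip (fscale c t) = fscale c (flip t)" by (simp add: flip_def fscale_def)
  ultimately show ?case using vspace_scale[OF vspace_tensor, of "flip t" W V c] by simp
qed auto

lemma lin_flip [simp]: "lin (V \<otimes> W) (W \<otimes> V) flip"
proof (rule linI)
  show "flip t \<in> vcar (W \<otimes> V)" if "t \<in> vcar (V \<otimes> W)" for t using that by (rule flip_in)
qed (auto simp: flip_def plus_fun_def fscale_def)

lemma eps_id_flip:
  assumes "vspace X" "vspace C" "lin C ground \<epsilon>" "t \<in> vcar (X \<otimes> C)"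
  shows "eps_id C X \<epsilon> (flip t) = id_eps X C \<epsilon> t"
  by (rule tensor_eqI[OF _ _ _ _ assms(4)]) (use assms in \<open>auto intro!: lin_comp[OF lin_eps_id]\<close>)

lemma id_eps_flip:
  assumes "vspace X" "vspace C" "lin C ground \<epsilon>" "t \<in> vcar (C \<otimes> X)"
  shows "id_eps X C \<epsilon> (flip t) = eps_id C X \<epsilon> t"
  using eps_id_flip[OF assms(1-3), of "flip t"] assms(4) by simp

definition mirror ::
  "(('k::field, 'v, 'w) tens \<Rightarrow> ('k, 'x, 'y) tens) \<Rightarrow> ('k, 'w, 'v) tens \<Rightarrow> ('k, 'y, 'x) tens" where
  "mirror \<Psi> = (\<lambda>t. flip (\<Psi> (flip t)))"

lemma mirror_mirror [simp]: "mirror (mirror \<Psi>) = \<Psi>"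
  by (simp add: mirror_def)

lemma mirror_flip [simp]: "mirror \<Psi> (flip t) = flip (\<Psi> t)"
  by (simp add: mirror_def)

lemma lin_mirror [simp]: "lin (V \<otimes> W) (X \<otimes> Y) \<Psi> \<Longrightarrow> lin (W \<otimes> V) (Y \<otimes> X) (mirror \<Psi>)"
  unfolding mirror_def by (rule lin_comp[OF lin_flip lin_comp[OF _ lin_flip]])

text \<open>The map \<open>v \<otimes> w \<otimes> x \<mapsto> x \<otimes> w \<otimes> v\<close>. The bracketing must move as well, so it is assembled from two flips.\<close>

definition reverse ::
  "('k::field, 'v::ab_group_add) vsp \<Rightarrow> ('k, 'w::ab_group_add) vsp \<Rightarrow> ('k, 'x::ab_group_add) vsp
    \<Rightarrow> ('k, ('k, 'v, 'w) tens, 'x) tens \<Rightarrow> ('k, ('k, 'x, 'w) tens, 'v) tens" where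
  "reverse V W X t = assoc_inv X W V (flip (tmap (V \<otimes> W) X (W \<otimes> V) X flip id t))"

context
  fixes V :: "('k::field, 'v::ab_group_add) vsp" and W :: "('k, 'w::ab_group_add) vsp"
    and X :: "('k, 'x::ab_group_add) vsp"
  assumes vs [simp]: "vspace V" "vspace W" "vspace X"
begin

lemma lin_reverse [simp]: "lin (V \<otimes> W \<otimes> X) (X \<otimes> W \<otimes> V) (reverse V W X)"
  unfolding reverse_def
  by (intro lin_comp[OF lin_assoc_inv] lin_comp[OF lin_flip] lin_tmap) simp_all

lemma reverse_in: "t \<in> vcar (V \<otimes> W \<otimes> X) \<Longrightarrow> reverse V W X t \<in> vcar (X \<otimes> W \<otimes> V)"
  by (rule lin_mem[OF lin_reverse])

lemma reverse_tens [simp]: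
  "s \<in> vcar (V \<otimes> W) \<Longrightarrow> x \<in> vcar X \<Longrightarrow>
   reverse V W X (tens (V \<otimes> W) X s x) = assoc_inv X W V (tens X (W \<otimes> V) x (flip s))"
  by (simp add: reverse_def)

end

lemma reverse_reverse:
  assumes "vspace V" "vspace W" "vspace X" "t \<in> vcar (V \<otimes> W \<otimes> X)"
  shows "reverse X W V (reverse V W X t) = t"
  by (rule tensor3_eqI[OF _ _ _ _ _ _ _ assms(4)])
    (use assms in \<open>auto intro!: lin_comp[OF lin_reverse]\<close>)

context
  fixes V :: "('k::field, 'v::ab_group_add) vsp" and W :: "('k, 'w::ab_group_add) vsp"
    and X :: "('k, 'x::ab_group_add) vsp"
  assumes vs [simp]: "vspace V" "vspace W" "vspace X"
begin

lemma reverse_assoc_inv [simp]: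
  "v \<in> vcar V \<Longrightarrow> s \<in> vcar (W \<otimes> X) \<Longrightarrow>
   reverse V W X (assoc_inv V W X (tens V (W \<otimes> X) v s)) = tens (X \<otimes> W) V (flip s) v"
  using reverse_reverse[of X W V "tens (X \<otimes> W) V (flip s) v"] by simp

end

context
  fixes V :: "('k::field, 'v::ab_group_add) vsp" and W :: "('k, 'w::ab_group_add) vsp"
    and X :: "('k, 'x::ab_group_add) vsp"
  assumes vs [simp]: "vspace V" "vspace W" "vspace X"
begin

text \<open>Reversing the three factors exchanges \<open>\<Psi> \<otimes> id\<close> with \<open>id \<otimes> \<Psi>\<close>, with \<open>\<Psi>\<close> replaced by its mirror image.
  All passages between left and right rest on this lemma and the next.\<close>

lemma reverse_psi_id:
  assumes [simp]: "lin (V \<otimes> W) (W \<otimes> V) \<Psi>" and t: "t \<in> vcar (V \<otimes> W \<otimes> X)"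
  shows "reverse W V X (psi_id V W X \<Psi> t) = id_psi X W V (mirror \<Psi>) (reverse V W X t)"
  by (rule tensor_eqI[OF _ _ _ _ t])
    (auto intro!: lin_comp[OF lin_reverse] lin_comp[OF lin_id_psi] simp: lin_mem[OF assms(1)])

lemma reverse_id_psi:
  assumes [simp]: "lin (W \<otimes> X) (X \<otimes> W) \<Psi>" and t: "t \<in> vcar (V \<otimes> W \<otimes> X)"
  shows "reverse V X W (id_psi V W X \<Psi> t) = psi_id X W V (mirror \<Psi>) (reverse V W X t)"
  by (rule tensor_eq_assocI[OF _ _ _ _ _ _ _ t])
    (auto intro!: lin_comp[OF lin_reverse] lin_comp[OF lin_psi_id] simp: lin_mem[OF assms(1)])

end

section \<open>Hexagon equations\<close>

text \<open>The equations in \<open>left_braided\<close> and \<open>right_braided\<close> by themselves. They are also used for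
  \<open>V = W\<close> with two different maps \<open>\<Theta>\<close> and \<open>\<Psi>\<close>, where they are the mixed braid relations
  \<open>\<Psi>\<^sub>1\<^sub>2 \<Psi>\<^sub>2\<^sub>3 \<Theta>\<^sub>1\<^sub>2 = \<Theta>\<^sub>2\<^sub>3 \<Psi>\<^sub>1\<^sub>2 \<Psi>\<^sub>2\<^sub>3\<close> and \<open>\<Psi>\<^sub>2\<^sub>3 \<Psi>\<^sub>1\<^sub>2 \<Theta>\<^sub>2\<^sub>3 = \<Theta>\<^sub>1\<^sub>2 \<Psi>\<^sub>2\<^sub>3 \<Psi>\<^sub>1\<^sub>2\<close>.\<close>

definition left_hexagon ::
  "('k::field, 'v::ab_group_add) vsp \<Rightarrow> (('k, 'v, 'v) tens \<Rightarrow> ('k, 'v, 'v) tens)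
    \<Rightarrow> ('k, 'w::ab_group_add) vsp \<Rightarrow> (('k, 'v, 'w) tens \<Rightarrow> ('k, 'w, 'v) tens) \<Rightarrow> bool" where
  "left_hexagon V \<Theta> W \<Psi> \<longleftrightarrow> (\<forall>t \<in> vcar (V \<otimes> V \<otimes> W).
     psi_id V W V \<Psi> (id_psi V V W \<Psi> (psi_id V V W \<Theta> t)) = id_psi W V V \<Theta> (psi_id V W V \<Psi> (id_psi V V W \<Psi> t)))"

definition right_hexagon ::
  "('k::field, 'w::ab_group_add) vsp \<Rightarrow> (('k, 'w, 'w) tens \<Rightarrow> ('k, 'w, 'w) tens)
    \<Rightarrow> ('k, 'v::ab_group_add) vsp \<Rightarrow> (('k, 'v, 'w) tens \<Rightarrow> ('k, 'w, 'v) tens) \<Rightarrow> bool" where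
  "right_hexagon W \<Theta> V \<Psi> \<longleftrightarrow> (\<forall>t \<in> vcar (V \<otimes> W \<otimes> W).
     id_psi W V W \<Psi> (psi_id V W W \<Psi> (id_psi V W W \<Theta> t)) = psi_id W W V \<Theta> (id_psi W V W \<Psi> (psi_id V W W \<Psi> t)))"

lemma left_braided_iff:
  "left_braided V \<Theta> W \<Psi> \<longleftrightarrow> braiding V \<Theta> \<and> vspace W \<and> bij_lin (V \<otimes> W) (W \<otimes> V) \<Psi> \<and> left_hexagon V \<Theta> W \<Psi>"
  by (simp add: left_braided_def left_hexagon_def)

lemma right_braided_iff:
  "right_braided W \<Theta> V \<Psi> \<longleftrightarrow> braiding W \<Theta> \<and> vspace V \<and> bij_lin (V \<otimes> W) (W \<otimes> V) \<Psi> \<and> right_hexagon W \<Theta> V \<Psi>"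
  by (simp add: right_braided_def right_hexagon_def)

lemma braiding_iff:
  "braiding V \<Psi> \<longleftrightarrow> vspace V \<and> bij_lin (V \<otimes> V) (V \<otimes> V) \<Psi> \<and> left_hexagon V \<Psi> V \<Psi>"
  by (simp add: braiding_def left_hexagon_def)

lemma left_hexagon_self_iff: "left_hexagon V \<Psi> V \<Psi> \<longleftrightarrow> right_hexagon V \<Psi> V \<Psi>"
  by (auto simp: left_hexagon_def right_hexagon_def)

lemma ball_reverse:
  assumes "vspace V" "vspace W" "vspace X"
  shows "(\<forall>s\<in>vcar (X \<otimes> W \<otimes> V). P s) \<longleftrightarrow> (\<forall>t\<in>vcar (V \<otimes> W \<otimes> X). P (reverse V W X t))"
proof
  assume *: "\<forall>t\<in>vcar (V \<otimes> W \<otimes> X). P (reverse V W X t)"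
  show "\<forall>s\<in>vcar (X \<otimes> W \<otimes> V). P s"
  proof
    fix s assume s: "s \<in> vcar (X \<otimes> W \<otimes> V)"
    then have "P (reverse V W X (reverse X W V s))" using * assms by (simp add: reverse_in)
    then show "P s" using s assms by (simp add: reverse_reverse)
  qed
qed (use assms in \<open>simp add: reverse_in\<close>)

text \<open>Conjugating the equation with the reversal of the three factors turns each \<open>\<Psi>\<^sub>1\<^sub>2\<close> into a \<open>\<Psi>\<^sub>2\<^sub>3\<close>.\<close>

lemma left_hexagon_mirror_iff:
  assumes vs: "vspace V" "vspace W" and lins: "lin (W \<otimes> W) (W \<otimes> W) \<Theta>" "lin (V \<otimes> W) (W \<otimes> V) \<Psi>"
  shows "left_hexagon W (mirror \<Theta>) V (mirror \<Psi>) \<longleftrightarrow> right_hexagon W \<Theta> V \<Psi>"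
proof -
  have eq: "psi_id W V W (mirror \<Psi>) (id_psi W W V (mirror \<Psi>) (psi_id W W V (mirror \<Theta>) (reverse V W W t)))
        = reverse W W V (id_psi W V W \<Psi> (psi_id V W W \<Psi> (id_psi V W W \<Theta> t)))"
      "id_psi V W W (mirror \<Theta>) (psi_id W V W (mirror \<Psi>) (id_psi W W V (mirror \<Psi>) (reverse V W W t)))
        = reverse W W V (psi_id W W V \<Theta> (id_psi W V W \<Psi> (psi_id V W W \<Psi> t)))"
    if "t \<in> vcar (V \<otimes> W \<otimes> W)" for t
    using that vs lins by (simp_all add: reverse_psi_id reverse_id_psi psi_id_in id_psi_in)
  have inj: "reverse W W V x = reverse W W V y \<longleftrightarrow> x = y" if "x \<in> vcar (W \<otimes> W \<otimes> V)" "y \<in> vcar (W \<otimes> W \<otimes> V)" for x y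
    using that reverse_reverse[OF vs(2,2,1)] by metis
  have "left_hexagon W (mirror \<Theta>) V (mirror \<Psi>) \<longleftrightarrow> (\<forall>t\<in>vcar (V \<otimes> W \<otimes> W).
      psi_id W V W (mirror \<Psi>) (id_psi W W V (mirror \<Psi>) (psi_id W W V (mirror \<Theta>) (reverse V W W t)))
      = id_psi V W W (mirror \<Theta>) (psi_id W V W (mirror \<Psi>) (id_psi W W V (mirror \<Psi>) (reverse V W W t))))"
    unfolding left_hexagon_def by (rule ball_reverse[OF vs(1,2,2)])
  also have "\<dots> \<longleftrightarrow> right_hexagon W \<Theta> V \<Psi>"
    unfolding right_hexagon_def using vs lins by (simp add: eq inj psi_id_in id_psi_in)
  finally show ?thesis .
qed

lemma right_hexagon_mirror_iff:
  assumes "vspace V" "vspace W" "lin (V \<otimes> V) (V \<otimes> V) \<Theta>" "lin (V \<otimes> W) (W \<otimes> V) \<Psi>"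
  shows "right_hexagon V (mirror \<Theta>) W (mirror \<Psi>) \<longleftrightarrow> left_hexagon V \<Theta> W \<Psi>"
  using left_hexagon_mirror_iff[of W V "mirror \<Theta>" "mirror \<Psi>"] assms by simp

section \<open>Inverse braidings\<close>

text \<open>Stating invertibility through an explicit partner, determined on the carrier only, is stable under
  \<open>mirror\<close>, whereas the values of \<open>inv_braiding\<close> outside the carrier are arbitrary.\<close>

definition inverse_pair ::
  "('k::field, 'v::ab_group_add) vsp \<Rightarrow> (('k, 'v, 'v) tens \<Rightarrow> ('k, 'v, 'v) tens)
    \<Rightarrow> (('k, 'v, 'v) tens \<Rightarrow> ('k, 'v, 'v) tens) \<Rightarrow> bool" where
  "inverse_pair V \<Psi> \<Psi>' \<longleftrightarrow> lin (V \<otimes> V) (V \<otimes> V) \<Psi> \<and> lin (V \<otimes> V) (V \<otimes> V) \<Psi>' \<and>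
     (\<forall>t \<in> vcar (V \<otimes> V). \<Psi>' (\<Psi> t) = t \<and> \<Psi> (\<Psi>' t) = t)"

lemma inverse_pair_sym: "inverse_pair V \<Psi> \<Psi>' \<Longrightarrow> inverse_pair V \<Psi>' \<Psi>"
  by (auto simp: inverse_pair_def)

lemma inverse_pair_mirror: "inverse_pair V \<Psi> \<Psi>' \<Longrightarrow> inverse_pair V (mirror \<Psi>) (mirror \<Psi>')"
  unfolding inverse_pair_def by (simp add: lin_mirror) (simp add: mirror_def)

lemma inverse_pair_bij_lin: "inverse_pair V \<Psi> \<Psi>' \<Longrightarrow> bij_lin (V \<otimes> V) (V \<otimes> V) \<Psi>"
  unfolding inverse_pair_def bij_lin_def
  by (auto intro!: bij_betw_byWitness[where f' = \<Psi>'] simp: lin_mem)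

lemma inverse_pair_inv_braiding:
  assumes "bij_lin (V \<otimes> V) (V \<otimes> V) \<Psi>"
  shows "inverse_pair V \<Psi> (inv_braiding V \<Psi>)"
proof -
  have l: "lin (V \<otimes> V) (V \<otimes> V) \<Psi>" and b: "bij_betw \<Psi> (vcar (V \<otimes> V)) (vcar (V \<otimes> V))"
    using assms by (auto simp: bij_lin_def)
  have in': "inv_braiding V \<Psi> t \<in> vcar (V \<otimes> V)" and r: "\<Psi> (inv_braiding V \<Psi> t) = t" if "t \<in> vcar (V \<otimes> V)" for t
    using that b unfolding inv_braiding_def by (auto simp: bij_betw_def inv_into_into f_inv_into_f)
  have inj: "s = t" if "\<Psi> s = \<Psi> t" "s \<in> vcar (V \<otimes> V)" "t \<in> vcar (V \<otimes> V)" for s t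
    using that b by (auto simp: bij_betw_def inj_on_def)
  have "lin (V \<otimes> V) (V \<otimes> V) (inv_braiding V \<Psi>)"
  proof (rule linI)
    fix s t assume st: "s \<in> vcar (V \<otimes> V)" "t \<in> vcar (V \<otimes> V)"
    show "inv_braiding V \<Psi> (s + t) = inv_braiding V \<Psi> s + inv_braiding V \<Psi> t"
      by (rule inj) (use st in \<open>simp_all add: in' r vspace_add[OF vspace_tensor] lin_add[OF l]\<close>)
  next
    fix c t assume t: "t \<in> vcar (V \<otimes> V)"
    show "inv_braiding V \<Psi> (vscl (V \<otimes> V) c t) = vscl (V \<otimes> V) c (inv_braiding V \<Psi> t)"
      by (rule inj) (use t in \<open>simp_all only: in' r vspace_scale[OF vspace_tensor] lin_scale[OF l]\<close>)
  qed (rule in')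
  moreover have "inv_braiding V \<Psi> (\<Psi> t) = t" if "t \<in> vcar (V \<otimes> V)" for t
    by (rule inj) (use that in \<open>simp_all add: in' r lin_mem[OF l]\<close>)
  ultimately show ?thesis using l r by (simp add: inverse_pair_def)
qed

context
  fixes V :: "('k::field, 'v::ab_group_add) vsp" and \<Psi> \<Psi>'
  assumes V: "vspace V" and inverse: "inverse_pair V \<Psi> \<Psi>'"
begin

lemma psi_id_cancel:
  "vspace X \<Longrightarrow> t \<in> vcar (V \<otimes> V \<otimes> X) \<Longrightarrow> psi_id V V X \<Psi>' (psi_id V V X \<Psi> t) = t"
  "vspace X \<Longrightarrow> t \<in> vcar (V \<otimes> V \<otimes> X) \<Longrightarrow> psi_id V V X \<Psi> (psi_id V V X \<Psi>' t) = t"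
  using inverse V by (auto intro!: psi_id_inverse simp: inverse_pair_def)

lemma id_psi_cancel:
  "vspace X \<Longrightarrow> t \<in> vcar (X \<otimes> V \<otimes> V) \<Longrightarrow> id_psi X V V \<Psi>' (id_psi X V V \<Psi> t) = t"
  "vspace X \<Longrightarrow> t \<in> vcar (X \<otimes> V \<otimes> V) \<Longrightarrow> id_psi X V V \<Psi> (id_psi X V V \<Psi>' t) = t"
  using inverse V by (auto intro!: id_psi_inverse simp: inverse_pair_def)

lemma neighbours_in:
  "vspace X \<Longrightarrow> t \<in> vcar (V \<otimes> V \<otimes> X) \<Longrightarrow> psi_id V V X \<Psi> t \<in> vcar (V \<otimes> V \<otimes> X)"
  "vspace X \<Longrightarrow> t \<in> vcar (V \<otimes> V \<otimes> X) \<Longrightarrow> psi_id V V X \<Psi>' t \<in> vcar (V \<otimes> V \<otimes> X)"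
  "vspace X \<Longrightarrow> s \<in> vcar (X \<otimes> V \<otimes> V) \<Longrightarrow> id_psi X V V \<Psi> s \<in> vcar (X \<otimes> V \<otimes> V)"
  "vspace X \<Longrightarrow> s \<in> vcar (X \<otimes> V \<otimes> V) \<Longrightarrow> id_psi X V V \<Psi>' s \<in> vcar (X \<otimes> V \<otimes> V)"
  using inverse V by (auto intro!: psi_id_in id_psi_in simp: inverse_pair_def)

text \<open>The equation says that \<open>X = R\<^sub>1\<^sub>2 R\<^sub>2\<^sub>3\<close> satisfies \<open>X \<Psi>\<^sub>1\<^sub>2 = \<Psi>\<^sub>2\<^sub>3 X\<close>; cancelling \<open>\<Psi>\<close> on both sides gives
  \<open>X \<Psi>\<^sub>1\<^sub>2\<^sup>-\<^sup>1 = \<Psi>\<^sub>2\<^sub>3\<^sup>-\<^sup>1 X\<close>.\<close>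

lemma left_hexagon_inverse_braiding:
  assumes W: "vspace W" and R: "lin (V \<otimes> W) (W \<otimes> V) R" and "left_hexagon V \<Psi> W R"
  shows "left_hexagon V \<Psi>' W R"
  unfolding left_hexagon_def
proof
  fix t assume t: "t \<in> vcar (V \<otimes> V \<otimes> W)"
  define s where "s = psi_id V V W \<Psi>' t"
  have s: "s \<in> vcar (V \<otimes> V \<otimes> W)" "t = psi_id V V W \<Psi> s"
    using t W by (simp_all add: s_def neighbours_in psi_id_cancel)
  have "psi_id V W V R (id_psi V V W R t) = id_psi W V V \<Psi> (psi_id V W V R (id_psi V V W R s))"
    using assms(3) s by (simp add: left_hexagon_def)
  then show "psi_id V W V R (id_psi V V W R (psi_id V V W \<Psi>' t)) = id_psi W V V \<Psi>' (psi_id V W V R (id_psi V V W R t))"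
    using s(1) V W R by (simp add: id_psi_cancel psi_id_in id_psi_in s_def[symmetric])
qed

lemma right_hexagon_inverse_braiding:
  assumes W: "vspace W" and R: "lin (W \<otimes> V) (V \<otimes> W) R" and "right_hexagon V \<Psi> W R"
  shows "right_hexagon V \<Psi>' W R"
  unfolding right_hexagon_def
proof
  fix t assume t: "t \<in> vcar (W \<otimes> V \<otimes> V)"
  define s where "s = id_psi W V V \<Psi>' t"
  have s: "s \<in> vcar (W \<otimes> V \<otimes> V)" "t = id_psi W V V \<Psi> s"
    using t W by (simp_all add: s_def neighbours_in id_psi_cancel)
  have "id_psi V W V R (psi_id W V V R t) = psi_id V V W \<Psi> (id_psi V W V R (psi_id W V V R s))"
    using assms(3) s by (simp add: right_hexagon_def)
  then show "id_psi V W V R (psi_id W V V R (id_psi W V V \<Psi>' t)) = psi_id V V W \<Psi>' (id_psi V W V R (psi_id W V V R t))"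
    using s(1) V W R by (simp add: psi_id_cancel psi_id_in id_psi_in s_def[symmetric])
qed

text \<open>Here \<open>X = \<Psi>\<^sub>1\<^sub>2 \<Psi>\<^sub>2\<^sub>3\<close> is itself inverted: \<open>X \<Theta>\<^sub>1\<^sub>2 = \<Theta>\<^sub>2\<^sub>3 X\<close> becomes \<open>\<Theta>\<^sub>1\<^sub>2 X\<^sup>-\<^sup>1 = X\<^sup>-\<^sup>1 \<Theta>\<^sub>2\<^sub>3\<close>, and
  \<open>X\<^sup>-\<^sup>1 = \<Psi>\<^sub>2\<^sub>3\<^sup>-\<^sup>1 \<Psi>\<^sub>1\<^sub>2\<^sup>-\<^sup>1\<close> has the order of the factors of the other hexagon.\<close>

lemma right_hexagon_of_inverse:
  assumes "lin (V \<otimes> V) (V \<otimes> V) \<Theta>" "left_hexagon V \<Theta> V \<Psi>"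
  shows "right_hexagon V \<Theta> V \<Psi>'"
  unfolding right_hexagon_def
proof
  fix t assume t: "t \<in> vcar (V \<otimes> V \<otimes> V)"
  define s where "s = id_psi V V V \<Psi>' (psi_id V V V \<Psi>' t)"
  have s: "s \<in> vcar (V \<otimes> V \<otimes> V)" "t = psi_id V V V \<Psi> (id_psi V V V \<Psi> s)"
    using t V by (simp_all add: s_def neighbours_in id_psi_cancel psi_id_cancel)
  have eq: "id_psi V V V \<Theta> t = psi_id V V V \<Psi> (id_psi V V V \<Psi> (psi_id V V V \<Theta> s))"
    using assms(2) s by (simp add: left_hexagon_def)
  have "psi_id V V V \<Theta> s \<in> vcar (V \<otimes> V \<otimes> V)" using s(1) V assms(1) by (simp add: psi_id_in)
  then show "id_psi V V V \<Psi>' (psi_id V V V \<Psi>' (id_psi V V V \<Theta> t)) = psi_id V V V \<Theta> (id_psi V V V \<Psi>' (psi_id V V V \<Psi>' t))"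
    unfolding eq s_def[symmetric] using V by (simp add: neighbours_in id_psi_cancel psi_id_cancel)
qed

lemma left_hexagon_of_inverse:
  assumes "lin (V \<otimes> V) (V \<otimes> V) \<Theta>" "right_hexagon V \<Theta> V \<Psi>"
  shows "left_hexagon V \<Theta> V \<Psi>'"
  unfolding left_hexagon_def
proof
  fix t assume t: "t \<in> vcar (V \<otimes> V \<otimes> V)"
  define s where "s = psi_id V V V \<Psi>' (id_psi V V V \<Psi>' t)"
  have s: "s \<in> vcar (V \<otimes> V \<otimes> V)" "t = id_psi V V V \<Psi> (psi_id V V V \<Psi> s)"
    using t V by (simp_all add: s_def neighbours_in id_psi_cancel psi_id_cancel)
  have eq: "psi_id V V V \<Theta> t = id_psi V V V \<Psi> (psi_id V V V \<Psi> (id_psi V V V \<Theta> s))"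
    using assms(2) s by (simp add: right_hexagon_def)
  have "id_psi V V V \<Theta> s \<in> vcar (V \<otimes> V \<otimes> V)" using s(1) V assms(1) by (simp add: id_psi_in)
  then show "psi_id V V V \<Psi>' (id_psi V V V \<Psi>' (psi_id V V V \<Theta> t)) = id_psi V V V \<Theta> (psi_id V V V \<Psi>' (id_psi V V V \<Psi>' t))"
    unfolding eq s_def[symmetric] using V by (simp add: neighbours_in id_psi_cancel psi_id_cancel)
qed

text \<open>The braid equation is both hexagons for \<open>\<Theta> = \<Phi> = \<Psi>\<close>. The two kinds of inversion above reach the
  remaining combinations.\<close>

lemma mixed_hexagons:
  assumes "left_hexagon V \<Psi> V \<Psi>" "\<Theta> \<in> {\<Psi>, \<Psi>'}" "\<Phi> \<in> {\<Psi>, \<Psi>'}"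
  shows "left_hexagon V \<Theta> V \<Phi>" "right_hexagon V \<Theta> V \<Phi>"
proof -
  have l: "lin (V \<otimes> V) (V \<otimes> V) \<Psi>" "lin (V \<otimes> V) (V \<otimes> V) \<Psi>'"
    using inverse by (simp_all add: inverse_pair_def)
  have "left_hexagon V \<Psi> V \<Phi> \<and> right_hexagon V \<Psi> V \<Phi>"
    using assms l left_hexagon_self_iff left_hexagon_of_inverse right_hexagon_of_inverse by auto
  moreover have "lin (V \<otimes> V) (V \<otimes> V) \<Phi>" using assms(3) l by auto
  ultimately show "left_hexagon V \<Theta> V \<Phi>" "right_hexagon V \<Theta> V \<Phi>"
    using assms(2) V left_hexagon_inverse_braiding right_hexagon_inverse_braiding by auto
qed

lemma braiding_inverse: "left_hexagon V \<Psi> V \<Psi> \<Longrightarrow> braiding V \<Psi>'"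
  using V mixed_hexagons(1)[of \<Psi>' \<Psi>'] inverse_pair_bij_lin[OF inverse_pair_sym[OF inverse]]
  by (simp add: braiding_iff)

text \<open>Substitute \<open>t = \<Psi>\<^sub>2\<^sub>3 \<Psi>\<^sub>1\<^sub>2 s\<close> and apply \<open>\<Psi>\<^sup>-\<^sup>1\<close>: the order of the two factors is reversed by inversion, so
  right compatibility becomes left compatibility.\<close>

lemma mult_compat_left_of_inverse:
  assumes m: "lin (V \<otimes> V) V m" and u: "\<forall>e. u = Some e \<longrightarrow> e \<in> vcar V"
    and compat: "mult_compat_right V V \<Psi> m u"
  shows "mult_compat_left V V \<Psi>' m u"
  unfolding mult_compat_left_def
proof (intro conjI ballI allI impI)
  fix t assume t: "t \<in> vcar (V \<otimes> V \<otimes> V)"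
  define s where "s = psi_id V V V \<Psi>' (id_psi V V V \<Psi>' t)"
  have s: "s \<in> vcar (V \<otimes> V \<otimes> V)" "t = id_psi V V V \<Psi> (psi_id V V V \<Psi> s)"
    using t V by (simp_all add: s_def neighbours_in id_psi_cancel psi_id_cancel)
  have "tmap V (V \<otimes> V) V V id m (assoc V V V s) \<in> vcar (V \<otimes> V)"
    using s(1) V m by (intro lin_mem[OF lin_tmap] assoc_in) auto
  moreover have eq: "tmap (V \<otimes> V) V V V m id t = \<Psi> (tmap V (V \<otimes> V) V V id m (assoc V V V s))"
    using compat s by (simp add: mult_compat_right_def)
  ultimately show "\<Psi>' (tmap (V \<otimes> V) V V V m id t)
      = tmap V (V \<otimes> V) V V id m (assoc V V V (psi_id V V V \<Psi>' (id_psi V V V \<Psi>' t)))"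
    unfolding eq s_def[symmetric] using inverse by (simp add: inverse_pair_def)
next
  fix e v assume "u = Some e" "v \<in> vcar V"
  then have "\<Psi>' (\<Psi> (tens V V v e)) = tens V V v e" and eq: "\<Psi> (tens V V v e) = tens V V e v"
    using compat inverse u unfolding mult_compat_right_def inverse_pair_def by (blast intro: tens_in_tensor)+
  then show "\<Psi>' (tens V V e v) = tens V V v e" unfolding eq by simp
qed

lemma comult_compat_left_of_inverse:
  assumes \<Delta>: "lin V (V \<otimes> V) \<Delta>" and compat: "comult_compat_right V V \<Psi> \<Delta> \<epsilon>"
  shows "comult_compat_left V V \<Psi>' \<Delta> \<epsilon>"
  unfolding comult_compat_left_def
proof (intro conjI ballI)
  fix s assume "s \<in> vcar (V \<otimes> V)"
  then obtain t where t: "t \<in> vcar (V \<otimes> V)" "s = \<Psi> t" "\<Psi>' s = t"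
    using inverse lin_mem[of "V \<otimes> V" "V \<otimes> V" \<Psi>' s] by (auto simp: inverse_pair_def)
  have y: "tmap V V V (V \<otimes> V) id \<Delta> t \<in> vcar (V \<otimes> (V \<otimes> V))"
    using t(1) V \<Delta> by (intro lin_mem[OF lin_tmap]) auto
  have "tmap V V (V \<otimes> V) V \<Delta> id s
      = id_psi V V V \<Psi> (psi_id V V V \<Psi> (assoc_inv V V V (tmap V V V (V \<otimes> V) id \<Delta> t)))"
    using compat t by (simp add: comult_compat_right_def)
  then show "tmap V V V (V \<otimes> V) id \<Delta> (\<Psi>' s)
      = assoc V V V (psi_id V V V \<Psi>' (id_psi V V V \<Psi>' (tmap V V (V \<otimes> V) V \<Delta> id s)))"
    using y V t by (simp add: id_psi_cancel psi_id_cancel neighbours_in assoc_inv_in)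
  show "id_eps V V \<epsilon> (\<Psi>' s) = eps_id V V \<epsilon> s"
    using compat t by (simp add: comult_compat_right_def)
qed

end

section \<open>Mirror images of compatibility conditions\<close>

lemma flip_eq_flip [simp]: "flip s = flip t \<longleftrightarrow> s = t"
  by (metis flip_flip)

lemma flip_eq_tens: "flip t = tens V W v w \<longleftrightarrow> t = tens W V w v"
  by (metis flip_flip flip_tens)

lemma mirror_tens: "mirror \<Psi> (tens V W v w) = flip (\<Psi> (tens W V w v))"
  by (simp add: mirror_def)

context
  fixes V :: "('k::field, 'v::ab_group_add) vsp" and W :: "('k, 'w::ab_group_add) vsp" and \<Psi>
  assumes vs [simp]: "vspace V" "vspace W" and lin\<Psi> [simp]: "lin (V \<otimes> W) (W \<otimes> V) \<Psi>"
begin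

text \<open>Reversing the three factors exchanges the roles of left and right, and the multiplication
  becomes the opposite one.\<close>

lemma mult_compat_right_mirror_iff:
  assumes m [simp]: "lin (V \<otimes> V) V m"
  shows "mult_compat_right W V (mirror \<Psi>) (\<lambda>t. m (flip t)) u \<longleftrightarrow> mult_compat_left V W \<Psi> m u"
proof -
  have m' [simp]: "lin (V \<otimes> V) V (\<lambda>t. m (flip t))" by (rule lin_comp[OF m lin_flip])
  have in_W: "tmap (V \<otimes> V) W V W m id t \<in> vcar (V \<otimes> W)" if "t \<in> vcar (V \<otimes> V \<otimes> W)" for t
    using that by (intro lin_mem[OF lin_tmap]) auto
  have 1: "tmap W (V \<otimes> V) W V id (\<lambda>t. m (flip t)) (assoc W V V (reverse V V W t)) = flip (tmap (V \<otimes> V) W V W m id t)"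
    if "t \<in> vcar (V \<otimes> V \<otimes> W)" for t
    by (rule tensor_eqI[OF _ _ _ _ that])
      (auto intro!: lin_comp[OF lin_tmap] lin_comp[OF lin_assoc] lin_comp[OF lin_flip])
  have 2: "tmap (V \<otimes> V) W V W (\<lambda>t. m (flip t)) id (reverse W V V t) = flip (tmap W (V \<otimes> V) W V id m (assoc W V V t))"
    if "t \<in> vcar (W \<otimes> V \<otimes> V)" for t
    by (rule tensor_eq_assocI[OF _ _ _ _ _ _ _ that])
      (auto intro!: lin_comp[OF lin_tmap] lin_comp[OF lin_assoc] lin_comp[OF lin_flip])
  have eq: "id_psi V W V (mirror \<Psi>) (psi_id W V V (mirror \<Psi>) (reverse V V W t))
      = reverse W V V (psi_id V W V \<Psi> (id_psi V V W \<Psi> t))" if "t \<in> vcar (V \<otimes> V \<otimes> W)" for t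
    using that by (simp add: reverse_psi_id reverse_id_psi psi_id_in id_psi_in)
  have "(\<forall>t\<in>vcar (W \<otimes> V \<otimes> V). mirror \<Psi> (tmap W (V \<otimes> V) W V id (\<lambda>t. m (flip t)) (assoc W V V t))
        = tmap (V \<otimes> V) W V W (\<lambda>t. m (flip t)) id (id_psi V W V (mirror \<Psi>) (psi_id W V V (mirror \<Psi>) t)))
    \<longleftrightarrow> (\<forall>t\<in>vcar (V \<otimes> V \<otimes> W). mirror \<Psi> (tmap W (V \<otimes> V) W V id (\<lambda>t. m (flip t)) (assoc W V V (reverse V V W t)))
        = tmap (V \<otimes> V) W V W (\<lambda>t. m (flip t)) id (id_psi V W V (mirror \<Psi>) (psi_id W V V (mirror \<Psi>) (reverse V V W t))))"
    by (rule ball_reverse) simp_all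
  also have "\<dots> \<longleftrightarrow> (\<forall>t\<in>vcar (V \<otimes> V \<otimes> W). flip (\<Psi> (tmap (V \<otimes> V) W V W m id t))
        = flip (tmap W (V \<otimes> V) W V id m (assoc W V V (psi_id V W V \<Psi> (id_psi V V W \<Psi> t)))))"
    by (simp add: 1 2 eq psi_id_in id_psi_in)
  finally show ?thesis
    unfolding mult_compat_right_def mult_compat_left_def by (simp add: mirror_tens flip_eq_tens)
qed

lemma comult_compat_right_mirror_iff:
  assumes \<Delta> [simp]: "lin V (V \<otimes> V) \<Delta>" and \<epsilon> [simp]: "lin V ground \<epsilon>"
  shows "comult_compat_right W V (mirror \<Psi>) (\<lambda>x. flip (\<Delta> x)) \<epsilon> \<longleftrightarrow> comult_compat_left V W \<Psi> \<Delta> \<epsilon>"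
proof -
  have \<Delta>' [simp]: "lin V (V \<otimes> V) (\<lambda>x. flip (\<Delta> x))" by (rule lin_comp[OF lin_flip \<Delta>])
  have [simp]: "\<Delta> x \<in> vcar (V \<otimes> V)" if "x \<in> vcar V" for x using that by (rule lin_mem[OF \<Delta>])
  have \<Psi>_in: "\<Psi> t \<in> vcar (W \<otimes> V)" if "t \<in> vcar (V \<otimes> W)" for t using that by (rule lin_mem[OF lin\<Psi>])
  have in3: "tmap V W (V \<otimes> V) W \<Delta> id t \<in> vcar (V \<otimes> V \<otimes> W)" if "t \<in> vcar (V \<otimes> W)" for t
    using that by (intro lin_mem[OF lin_tmap]) auto
  have in3': "tmap W V W (V \<otimes> V) id \<Delta> t \<in> vcar (W \<otimes> (V \<otimes> V))" if "t \<in> vcar (W \<otimes> V)" for t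
    using that by (intro lin_mem[OF lin_tmap]) auto
  have 1: "tmap V W (V \<otimes> V) W (\<lambda>x. flip (\<Delta> x)) id (flip t) = reverse W V V (assoc_inv W V V (tmap W V W (V \<otimes> V) id \<Delta> t))"
    if "t \<in> vcar (W \<otimes> V)" for t
    by (rule tensor_eqI[OF _ _ _ _ that])
      (auto intro!: lin_comp[OF lin_tmap] lin_comp[OF lin_reverse] lin_comp[OF lin_assoc_inv])
  have 2: "assoc_inv W V V (tmap W V W (V \<otimes> V) id (\<lambda>x. flip (\<Delta> x)) (flip t)) = reverse V V W (tmap V W (V \<otimes> V) W \<Delta> id t)"
    if "t \<in> vcar (V \<otimes> W)" for t
    by (rule tensor_eqI[OF _ _ _ _ that])
      (auto intro!: lin_comp[OF lin_tmap] lin_comp[OF lin_reverse] lin_comp[OF lin_assoc_inv])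
  have eq: "id_psi V W V (mirror \<Psi>) (psi_id W V V (mirror \<Psi>) (reverse V V W t))
      = reverse W V V (psi_id V W V \<Psi> (id_psi V V W \<Psi> t))" if "t \<in> vcar (V \<otimes> V \<otimes> W)" for t
    using that by (simp add: reverse_psi_id reverse_id_psi psi_id_in id_psi_in)
  have inj: "reverse W V V (assoc_inv W V V x) = reverse W V V y \<longleftrightarrow> x = assoc W V V y"
    if "x \<in> vcar (W \<otimes> (V \<otimes> V))" "y \<in> vcar (W \<otimes> V \<otimes> V)" for x y
  proof -
    have "reverse W V V (assoc_inv W V V x) = reverse W V V y \<longleftrightarrow> assoc_inv W V V x = y"
      using reverse_reverse[OF vs(2,1,1)] assoc_inv_in[OF vs(2,1,1) that(1)] that(2) by metis
    also have "\<dots> \<longleftrightarrow> x = assoc W V V y" using that by auto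
    finally show ?thesis .
  qed
  have surj: "(\<forall>s\<in>vcar (W \<otimes> V). P s) \<longleftrightarrow> (\<forall>t\<in>vcar (V \<otimes> W). P (flip t))" for P
    using flip_in[of _ V W] flip_in[of _ W V] by (metis flip_flip)
  show ?thesis
    unfolding comult_compat_right_def comult_compat_left_def surj
    by (simp add: 1 2 eq inj in3 in3' \<Psi>_in psi_id_in id_psi_in eps_id_flip id_eps_flip)
qed

end

lemma mult_compat_left_mirror_iff:
  assumes "vspace V" "vspace W" "lin (V \<otimes> W) (W \<otimes> V) \<Psi>" "lin (W \<otimes> W) W m"
  shows "mult_compat_left W V (mirror \<Psi>) (\<lambda>t. m (flip t)) u \<longleftrightarrow> mult_compat_right V W \<Psi> m u"
  using mult_compat_right_mirror_iff[of W V "mirror \<Psi>" "\<lambda>t. m (flip t)" u] assms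
    lin_comp[OF assms(4) lin_flip] by simp

lemma comult_compat_left_mirror_iff:
  assumes "vspace V" "vspace W" "lin (V \<otimes> W) (W \<otimes> V) \<Psi>" "lin W (W \<otimes> W) \<Delta>" "lin W ground \<epsilon>"
  shows "comult_compat_left W V (mirror \<Psi>) (\<lambda>x. flip (\<Delta> x)) \<epsilon> \<longleftrightarrow> comult_compat_right V W \<Psi> \<Delta> \<epsilon>"
  using comult_compat_right_mirror_iff[of W V "mirror \<Psi>" "\<lambda>x. flip (\<Delta> x)" \<epsilon>] assms
    lin_comp[OF lin_flip assms(4)] by simp

lemma mult_compat_right_of_inverse:
  assumes "vspace V" "inverse_pair V \<Psi> \<Psi>'" "lin (V \<otimes> V) V m" "\<forall>e. u = Some e \<longrightarrow> e \<in> vcar V"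
    and "mult_compat_left V V \<Psi> m u"
  shows "mult_compat_right V V \<Psi>' m u"
proof -
  have "mult_compat_right V V (mirror \<Psi>) (\<lambda>t. m (flip t)) u"
    using assms by (simp add: mult_compat_right_mirror_iff inverse_pair_def)
  then have "mult_compat_left V V (mirror \<Psi>') (\<lambda>t. m (flip t)) u"
    by (rule mult_compat_left_of_inverse[OF assms(1) inverse_pair_mirror[OF assms(2)] lin_comp[OF assms(3) lin_flip] assms(4)])
  then show ?thesis
    using assms by (simp add: mult_compat_left_mirror_iff inverse_pair_def)
qed

lemma comult_compat_right_of_inverse:
  assumes "vspace V" "inverse_pair V \<Psi> \<Psi>'" "lin V (V \<otimes> V) \<Delta>" "lin V ground \<epsilon>"
    and "comult_compat_left V V \<Psi> \<Delta> \<epsilon>"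
  shows "comult_compat_right V V \<Psi>' \<Delta> \<epsilon>"
proof -
  have "comult_compat_right V V (mirror \<Psi>) (\<lambda>x. flip (\<Delta> x)) \<epsilon>"
    using assms by (simp add: comult_compat_right_mirror_iff inverse_pair_def)
  then have "comult_compat_left V V (mirror \<Psi>') (\<lambda>x. flip (\<Delta> x)) \<epsilon>"
    by (rule comult_compat_left_of_inverse[OF assms(1) inverse_pair_mirror[OF assms(2)] lin_comp[OF lin_flip assms(3)]])
  then show ?thesis
    using assms by (simp add: comult_compat_left_mirror_iff inverse_pair_def)
qed

section \<open>Tensor products embedded into duals\<close>

lemma lin_dual_apply: "lin V (dual T) F \<Longrightarrow> lin V ground (\<lambda>v. F v t)"
  by (simp add: lin_def plus_fun_def fscale_def)

lemma dual_lin: "f \<in> vcar (dual T) \<Longrightarrow> lin T ground f"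
  by (simp add: dual_def)

lemma dual_eqI: "f \<in> vcar (dual T) \<Longrightarrow> g \<in> vcar (dual T) \<Longrightarrow> (\<And>t. t \<in> vcar T \<Longrightarrow> f t = g t) \<Longrightarrow> f = g"
  by (rule ext, case_tac "x \<in> vcar T") (simp_all add: dual_def)

text \<open>A functional in \<open>dual T\<close> vanishes off the carrier of \<open>T\<close>, so linearity of a dual-valued map may be
  tested pointwise on the carrier.\<close>

lemma lin_into_dual:
  assumes V: "vspace V" and T: "vspace T" and F: "\<And>v. v \<in> vcar V \<Longrightarrow> F v \<in> vcar (dual T)"
    and l: "\<And>t. t \<in> vcar T \<Longrightarrow> lin V ground (\<lambda>v. F v t)"
  shows "lin V (dual T) F"
proof (rule linI)
  fix v w assume vw: "v \<in> vcar V" "w \<in> vcar V"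
  show "F (v + w) = F v + F w"
  proof (rule dual_eqI)
    show "F (v + w) \<in> vcar (dual T)" "F v + F w \<in> vcar (dual T)"
      using vw V T F by (auto intro: vspace_add[OF vspace_dual] simp: vspace_add)
    show "F (v + w) t = (F v + F w) t" if "t \<in> vcar T" for t
      using lin_add[OF l[OF that] vw] by (simp add: plus_fun_def)
  qed
next
  fix c v assume v: "v \<in> vcar V"
  show "F (vscl V c v) = vscl (dual T) c (F v)"
  proof (rule dual_eqI)
    show "F (vscl V c v) \<in> vcar (dual T)" "vscl (dual T) c (F v) \<in> vcar (dual T)"
      using v V T F by (auto intro: vspace_scale[OF vspace_dual] simp: vspace_scale simp del: vscl_dual)
    show "F (vscl V c v) t = vscl (dual T) c (F v) t" if "t \<in> vcar T" for t
      using lin_scale[OF l[OF that] v] by (simp add: fscale_def)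
  qed
qed (rule F)

lemma lin_times: "lin V ground f \<Longrightarrow> lin V ground (\<lambda>v. f v * c)" "lin V ground f \<Longrightarrow> lin V ground (\<lambda>v. c * f v)"
  by (auto simp: lin_def algebra_simps)

lemma tensor_eqI_slices:
  assumes "vspace X" "vspace Y" and E: "\<And>\<epsilon>. \<epsilon> \<in> E \<Longrightarrow> lin Y ground \<epsilon>"
    and sep: "\<And>y. y \<in> vcar Y \<Longrightarrow> \<forall>\<epsilon>\<in>E. \<epsilon> y = 0 \<Longrightarrow> y = 0"
    and st: "s \<in> vcar (X \<otimes> Y)" "t \<in> vcar (X \<otimes> Y)"
    and slices: "\<And>\<epsilon>. \<epsilon> \<in> E \<Longrightarrow> id_eps X Y \<epsilon> s = id_eps X Y \<epsilon> t"
  shows "s = t"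
proof -
  let ?d = "s + fscale (-1) t"
  have m: "fscale (-1) t \<in> vcar (X \<otimes> Y)" using vspace_scale[OF vspace_tensor st(2), of "-1"] by simp
  have d: "?d \<in> vcar (X \<otimes> Y)" using st m by (simp add: vspace_add)
  have "?d = 0"
  proof (rule tensor_zero_if_slices_zero[OF assms(1,2) E sep d])
    fix \<epsilon> assume \<epsilon>: "\<epsilon> \<in> E"
    have l: "lin (X \<otimes> Y) X (id_eps X Y \<epsilon>)" using assms(1) E[OF \<epsilon>] by simp
    have in_X: "id_eps X Y \<epsilon> t \<in> vcar X" using lin_mem[OF l st(2)] .
    have "id_eps X Y \<epsilon> ?d = vscl X 1 (id_eps X Y \<epsilon> t) + vscl X (-1) (id_eps X Y \<epsilon> t)"
      using lin_add[OF l st(1) m] lin_scale[OF l st(2), of "-1"] slices[OF \<epsilon>] assms(1)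
      by (simp add: vspace_def vector_space_def)
    also have "\<dots> = 0" using assms(1) by (simp add: vscl_add_left[symmetric])
    finally show "id_eps X Y \<epsilon> ?d = 0" .
  qed
  then show ?thesis by (simp add: fscale_def fun_eq_iff plus_fun_def zero_fun_def)
qed

context
  fixes A :: "('k::field, 'a::ab_group_add) vsp" and B :: "('k, 'b::ab_group_add) vsp"
    and P :: "('k, 'p::ab_group_add) vsp" and Q :: "('k, 'q::ab_group_add) vsp" and N
  assumes vs: "vspace A" "vspace B" "vspace P" "vspace Q"
    and N: "\<And>\<eta> x y. \<eta> \<in> vcar B \<Longrightarrow> x \<in> vcar P \<Longrightarrow> y \<in> vcar Q \<Longrightarrow> lin A ground (\<lambda>\<xi>. N \<xi> \<eta> x y)"
      "\<And>\<xi> x y. \<xi> \<in> vcar A \<Longrightarrow> x \<in> vcar P \<Longrightarrow> y \<in> vcar Q \<Longrightarrow> lin B ground (\<lambda>\<eta>. N \<xi> \<eta> x y)"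
      "\<And>\<xi> \<eta> y. \<xi> \<in> vcar A \<Longrightarrow> \<eta> \<in> vcar B \<Longrightarrow> y \<in> vcar Q \<Longrightarrow> lin P ground (\<lambda>x. N \<xi> \<eta> x y)"
      "\<And>\<xi> \<eta> x. \<xi> \<in> vcar A \<Longrightarrow> \<eta> \<in> vcar B \<Longrightarrow> x \<in> vcar P \<Longrightarrow> lin Q ground (\<lambda>y. N \<xi> \<eta> x y)"
begin

text \<open>A form linear in each of four arguments induces a linear map \<open>A \<otimes> B \<rightarrow> (P \<otimes> Q)'\<close>. The embeddings of tensor
  products into duals and the three dual-valued maps are all instances.\<close>

lemma bilin_quadrilinear_inner: "\<xi> \<in> vcar A \<Longrightarrow> \<eta> \<in> vcar B \<Longrightarrow> bilin P Q ground (N \<xi> \<eta>)"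
  using N(3,4) by (intro bilinI) auto

lemma lift_quadrilinear_dual: "\<xi> \<in> vcar A \<Longrightarrow> \<eta> \<in> vcar B \<Longrightarrow> lift P Q ground (N \<xi> \<eta>) \<in> vcar (dual (P \<otimes> Q))"
  using lin_lift[OF _ bilin_quadrilinear_inner] lift_outside[OF _ bilin_quadrilinear_inner]
  by (simp add: dual_def)

lemma bilin_quadrilinear: "bilin A B (dual (P \<otimes> Q)) (\<lambda>\<xi> \<eta>. lift P Q ground (N \<xi> \<eta>))"
  using vs N
  by (intro bilinI lin_into_dual lin_lift_parameter) (auto simp: lift_quadrilinear_dual bilin_quadrilinear_inner)

lemma lin_quadrilinear: "lin (A \<otimes> B) (dual (P \<otimes> Q)) (lift A B (dual (P \<otimes> Q)) (\<lambda>\<xi> \<eta>. lift P Q ground (N \<xi> \<eta>)))"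
  using bilin_quadrilinear by (simp add: lin_lift)

lemma quadrilinear_tens:
  "\<xi> \<in> vcar A \<Longrightarrow> \<eta> \<in> vcar B \<Longrightarrow> x \<in> vcar P \<Longrightarrow> y \<in> vcar Q \<Longrightarrow>
   lift A B (dual (P \<otimes> Q)) (\<lambda>\<xi> \<eta>. lift P Q ground (N \<xi> \<eta>)) (tens A B \<xi> \<eta>) (tens P Q x y) = N \<xi> \<eta> x y"
  using bilin_quadrilinear bilin_quadrilinear_inner by (simp add: lift_tens)

end

context
  fixes A :: "('k::field, 'a::ab_group_add) vsp" and B :: "('k, 'b::ab_group_add) vsp"
    and P :: "('k, 'p::ab_group_add) vsp" and Q :: "('k, 'q::ab_group_add) vsp" and p q
  assumes vs: "vspace A" "vspace B" "vspace P" "vspace Q"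
    and p: "\<And>x. x \<in> vcar P \<Longrightarrow> lin A ground (\<lambda>\<xi>. p \<xi> x)" "\<And>\<xi>. \<xi> \<in> vcar A \<Longrightarrow> lin P ground (p \<xi>)"
    and q: "\<And>y. y \<in> vcar Q \<Longrightarrow> lin B ground (\<lambda>\<eta>. q \<eta> y)" "\<And>\<eta>. \<eta> \<in> vcar B \<Longrightarrow> lin Q ground (q \<eta>)"
begin

lemma lin_tensor_embed: "lin (A \<otimes> B) (dual (P \<otimes> Q)) (tensor_embed A B P Q p q)"
  unfolding tensor_embed_def by (rule lin_quadrilinear) (auto intro: lin_times p q vs)

lemma tensor_embed_tens:
  "\<xi> \<in> vcar A \<Longrightarrow> \<eta> \<in> vcar B \<Longrightarrow> x \<in> vcar P \<Longrightarrow> y \<in> vcar Q \<Longrightarrow>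
   tensor_embed A B P Q p q (tens A B \<xi> \<eta>) (tens P Q x y) = p \<xi> x * q \<eta> y"
  unfolding tensor_embed_def by (rule quadrilinear_tens) (auto intro: lin_times p q vs)

lemma tensor_embed_id_eps:
  assumes "t \<in> vcar (A \<otimes> B)" "x \<in> vcar P" "y \<in> vcar Q"
  shows "tensor_embed A B P Q p q t (tens P Q x y) = p (id_eps A B (\<lambda>\<eta>. q \<eta> y) t) x"
proof (rule tensor_eqI[OF _ _ _ _ assms(1)])
  show "lin (A \<otimes> B) ground (\<lambda>t. p (id_eps A B (\<lambda>\<eta>. q \<eta> y) t) x)"
    by (rule lin_comp[OF p(1)[OF assms(2)]]) (use assms vs q in auto)
  show "lin (A \<otimes> B) ground (\<lambda>t. tensor_embed A B P Q p q t (tens P Q x y))"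
    by (rule lin_dual_apply[OF lin_tensor_embed])
qed (use assms vs q lin_scale[OF p(1)] in \<open>auto simp: tensor_embed_tens\<close>)

lemma tensor_embed_eps_id:
  assumes "t \<in> vcar (A \<otimes> B)" "x \<in> vcar P" "y \<in> vcar Q"
  shows "tensor_embed A B P Q p q t (tens P Q x y) = q (eps_id A B (\<lambda>\<xi>. p \<xi> x) t) y"
proof (rule tensor_eqI[OF _ _ _ _ assms(1)])
  show "lin (A \<otimes> B) ground (\<lambda>t. q (eps_id A B (\<lambda>\<xi>. p \<xi> x) t) y)"
    by (rule lin_comp[OF q(1)[OF assms(3)]]) (use assms vs p in auto)
  show "lin (A \<otimes> B) ground (\<lambda>t. tensor_embed A B P Q p q t (tens P Q x y))"
    by (rule lin_dual_apply[OF lin_tensor_embed])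
qed (use assms vs p lin_scale[OF q(1)] in \<open>auto simp: tensor_embed_tens\<close>)

text \<open>Fixing \<open>y \<in> Q\<close>, the values on \<open>x \<otimes> y\<close> determine the slice along \<open>y\<close> because \<open>P\<close> separates \<open>A\<close>; the slices
  determine the tensor because \<open>Q\<close> separates \<open>B\<close>.\<close>

lemma tensor_embed_eq_imp_eq:
  assumes sepA: "\<And>\<xi> \<xi>'. \<xi> \<in> vcar A \<Longrightarrow> \<xi>' \<in> vcar A \<Longrightarrow> \<forall>x\<in>vcar P. p \<xi> x = p \<xi>' x \<Longrightarrow> \<xi> = \<xi>'"
    and sepB: "\<And>\<eta> \<eta>'. \<eta> \<in> vcar B \<Longrightarrow> \<eta>' \<in> vcar B \<Longrightarrow> \<forall>y\<in>vcar Q. q \<eta> y = q \<eta>' y \<Longrightarrow> \<eta> = \<eta>'"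
    and st: "s \<in> vcar (A \<otimes> B)" "t \<in> vcar (A \<otimes> B)"
    and eq: "\<And>x y. x \<in> vcar P \<Longrightarrow> y \<in> vcar Q \<Longrightarrow>
      tensor_embed A B P Q p q s (tens P Q x y) = tensor_embed A B P Q p q t (tens P Q x y)"
  shows "s = t"
proof (rule tensor_eqI_slices[where E = "(\<lambda>y \<eta>. q \<eta> y) ` vcar Q", OF vs(1,2) _ _ st])
  show "lin B ground \<epsilon>" if "\<epsilon> \<in> (\<lambda>y \<eta>. q \<eta> y) ` vcar Q" for \<epsilon> using that q by auto
  show "\<eta> = 0" if "\<eta> \<in> vcar B" "\<forall>\<epsilon>\<in>(\<lambda>y \<eta>. q \<eta> y) ` vcar Q. \<epsilon> \<eta> = 0" for \<eta>
    by (rule sepB) (use that vs vspace_zero[OF vs(2)] lin_zero[OF vs(2) ground_simps(1) q(1)] in auto)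
  show "id_eps A B \<epsilon> s = id_eps A B \<epsilon> t" if \<epsilon>: "\<epsilon> \<in> (\<lambda>y \<eta>. q \<eta> y) ` vcar Q" for \<epsilon>
  proof -
    obtain y where y: "y \<in> vcar Q" "\<epsilon> = (\<lambda>\<eta>. q \<eta> y)" using \<epsilon> by blast
    show ?thesis
      by (rule sepA) (use y st eq vs q in \<open>auto simp: tensor_embed_id_eps[symmetric] id_eps_in\<close>)
  qed
qed

lemma inj_tensor_embed:
  assumes "\<And>\<xi> \<xi>'. \<xi> \<in> vcar A \<Longrightarrow> \<xi>' \<in> vcar A \<Longrightarrow> \<forall>x\<in>vcar P. p \<xi> x = p \<xi>' x \<Longrightarrow> \<xi> = \<xi>'"
    and "\<And>\<eta> \<eta>'. \<eta> \<in> vcar B \<Longrightarrow> \<eta>' \<in> vcar B \<Longrightarrow> \<forall>y\<in>vcar Q. q \<eta> y = q \<eta>' y \<Longrightarrow> \<eta> = \<eta>'"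
  shows "inj_on (tensor_embed A B P Q p q) (vcar (A \<otimes> B))"
  by (rule inj_onI, rule tensor_embed_eq_imp_eq) (use assms in auto)

end

text \<open>A map with values in an embedded copy of \<open>B\<close>, pulled back to \<open>B\<close>: applied to the three dual-valued
  maps, this shows that bijectivity makes them linear bijections between the tensor products.\<close>

lemma bij_lin_via_embedding:
  assumes A: "vspace A" and B: "vspace B" and F: "lin A D F" and e: "lin B D e" and inj: "inj_on e (vcar B)"
    and bij: "bij_betw F (vcar A) (e ` vcar B)"
  shows "bij_lin A B (\<lambda>t. inv_into (vcar B) e (F t))"
    and "t \<in> vcar A \<Longrightarrow> e (inv_into (vcar B) e (F t)) = F t"
proof -
  let ?R = "\<lambda>t. inv_into (vcar B) e (F t)"
  have F_in: "F t \<in> e ` vcar B" if "t \<in> vcar A" for t using that bij by (auto simp: bij_betw_def)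
  have R_in: "?R t \<in> vcar B" and eR: "e (?R t) = F t" if "t \<in> vcar A" for t
    using inv_into_into[OF F_in[OF that]] f_inv_into_f[OF F_in[OF that]] by auto
  show "t \<in> vcar A \<Longrightarrow> e (?R t) = F t" by (rule eR)
  have "lin A B ?R"
  proof (rule linI)
    fix s t assume st: "s \<in> vcar A" "t \<in> vcar A"
    then have u: "s + t \<in> vcar A" using A by (simp add: vspace_add)
    have "e (?R (s + t)) = e (?R s + ?R t)"
      unfolding eR[OF u] using st by (simp add: eR R_in lin_add[OF e] lin_add[OF F])
    then show "?R (s + t) = ?R s + ?R t"
      using R_in[OF u] st by (intro inj_onD[OF inj]) (simp_all add: R_in vspace_add[OF B])
  next
    fix c t assume t: "t \<in> vcar A"
    then have u: "vscl A c t \<in> vcar A" using A by (simp add: vspace_scale)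
    have "e (?R (vscl A c t)) = e (vscl B c (?R t))"
      unfolding eR[OF u] using t by (simp add: eR R_in lin_scale[OF e] lin_scale[OF F])
    then show "?R (vscl A c t) = vscl B c (?R t)"
      using R_in[OF u] t by (intro inj_onD[OF inj]) (simp_all add: R_in vspace_scale[OF B])
  qed (rule R_in)
  moreover have "bij_betw ?R (vcar A) (vcar B)"
    using bij_betw_trans[OF bij bij_betw_inv_into[OF inj_on_imp_bij_betw[OF inj]]] by (simp add: comp_def)
  ultimately show "bij_lin A B ?R" by (simp add: bij_lin_def)
qed

section \<open>Transposed maps\<close>

text \<open>The pairing \<open>\<langle>\<langle>q, s\<rangle>\<rangle>\<close> for arbitrary \<open>q \<in> U \<otimes> U\<close> and \<open>s \<in> H \<otimes> H\<close>. The embedding into the dual pairs the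
  factors in parallel, and the flip nests them.\<close>

definition nested_pairing ::
  "('k::field, 'h::ab_group_add) vsp \<Rightarrow> ('k, 'h \<Rightarrow> 'k) vsp
    \<Rightarrow> ('k, 'h \<Rightarrow> 'k, 'h \<Rightarrow> 'k) tens \<Rightarrow> ('k, 'h, 'h) tens \<Rightarrow> 'k" where
  "nested_pairing H U q s = emb_UU H U q (flip s)"

definition full_transpose ::
  "('k::field, 'h::ab_group_add) vsp \<Rightarrow> ('k, 'h \<Rightarrow> 'k) vsp
    \<Rightarrow> (('k, 'h \<Rightarrow> 'k, 'h \<Rightarrow> 'k) tens \<Rightarrow> ('k, 'h \<Rightarrow> 'k, 'h \<Rightarrow> 'k) tens)
    \<Rightarrow> (('k, 'h, 'h) tens \<Rightarrow> ('k, 'h, 'h) tens) \<Rightarrow> bool" where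
  "full_transpose H U Q \<Theta> \<longleftrightarrow> (\<forall>q \<in> vcar (U \<otimes> U). \<forall>s \<in> vcar (H \<otimes> H).
     nested_pairing H U (Q q) s = nested_pairing H U q (\<Theta> s))"

text \<open>In place of functionals \<open>f \<in> H'\<close> applied to both sides, the defining formula of \<open>\<Psi>\<^sub>U\<^sub>H\<close> is stated as an equation in
  \<open>H\<close>: \<open>(id \<otimes> ev\<^sub>b)(R(g \<otimes> a)) = (g \<otimes> id)(\<Phi>(a \<otimes> b))\<close>.\<close>

definition half_transpose ::
  "('k::field, 'h::ab_group_add) vsp \<Rightarrow> ('k, 'h \<Rightarrow> 'k) vsp
    \<Rightarrow> (('k, 'h \<Rightarrow> 'k, 'h) tens \<Rightarrow> ('k, 'h, 'h \<Rightarrow> 'k) tens)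
    \<Rightarrow> (('k, 'h, 'h) tens \<Rightarrow> ('k, 'h, 'h) tens) \<Rightarrow> bool" where
  "half_transpose H U R \<Phi> \<longleftrightarrow> (\<forall>g \<in> vcar U. \<forall>a \<in> vcar H. \<forall>b \<in> vcar H.
     id_eps H U (\<lambda>f. f b) (R (tens U H g a)) = eps_id H H g (\<Phi> (tens H H a b)))"

locale function_space =
  fixes H :: "('k::field, 'h::ab_group_add) vsp" and U :: "('k, 'h \<Rightarrow> 'k) vsp"
  assumes H [simp]: "vspace H" and U: "subvsp U (dual H)"
begin

lemma vspace_U [simp]: "vspace U"
  using U by (simp add: subvsp_def)

lemma vscl_U [simp]: "vscl U = fscale"
  using U by (simp add: subvsp_def)

lemma U_dual: "f \<in> vcar U \<Longrightarrow> f \<in> vcar (dual H)"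
  using U by (auto simp: subvsp_def)

lemma U_lin [simp]: "f \<in> vcar U \<Longrightarrow> lin H ground f"
  by (rule dual_lin[OF U_dual])

lemma lin_eval [simp]: "lin U ground (\<lambda>f. f b)"
  by (rule linI) (simp_all add: plus_fun_def fscale_def)

lemma U_eqI: "f \<in> vcar U \<Longrightarrow> g \<in> vcar U \<Longrightarrow> \<forall>x\<in>vcar H. f x = g x \<Longrightarrow> f = g"
  by (rule dual_eqI[of _ H]) (auto intro: U_dual)

lemma lin_emb_UU: "lin (U \<otimes> U) (dual (H \<otimes> H)) (emb_UU H U)"
  unfolding emb_UU_def by (rule lin_tensor_embed) simp_all

lemma inj_emb_UU: "inj_on (emb_UU H U) (vcar (U \<otimes> U))"
  unfolding emb_UU_def by (rule inj_tensor_embed) (auto intro: U_eqI)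

lemma lin_nested_pairing_left [simp]: "lin (U \<otimes> U) ground (\<lambda>q. nested_pairing H U q s)"
  unfolding nested_pairing_def by (rule lin_dual_apply[OF lin_emb_UU])

lemma lin_nested_pairing_right [simp]: "q \<in> vcar (U \<otimes> U) \<Longrightarrow> lin (H \<otimes> H) ground (nested_pairing H U q)"
  unfolding nested_pairing_def
  by (rule lin_comp[OF dual_lin[OF lin_mem[OF lin_emb_UU]] lin_flip])

lemma nested_pairing_tens [simp]:
  "f \<in> vcar U \<Longrightarrow> g \<in> vcar U \<Longrightarrow> a \<in> vcar H \<Longrightarrow> b \<in> vcar H \<Longrightarrow>
   nested_pairing H U (tens U U f g) (tens H H a b) = f b * g a"
  by (simp add: nested_pairing_def emb_UU_def tensor_embed_tens)

lemma nested_pairing_flip: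
  assumes "q \<in> vcar (U \<otimes> U)" "s \<in> vcar (H \<otimes> H)"
  shows "nested_pairing H U (flip q) (flip s) = nested_pairing H U q s"
proof (rule tensor_eqI[OF _ _ _ _ assms(1)])
  show "lin (U \<otimes> U) ground (\<lambda>q. nested_pairing H U (flip q) (flip s))"
    by (rule lin_comp[OF lin_nested_pairing_left lin_flip])
  fix f g assume fg [simp]: "f \<in> vcar U" "g \<in> vcar U"
  show "nested_pairing H U (flip (tens U U f g)) (flip s) = nested_pairing H U (tens U U f g) s"
    by (rule tensor_eqI[OF _ _ _ _ assms(2)]) (auto intro: lin_comp[OF lin_nested_pairing_right lin_flip])
qed simp_all

lemma nested_pairing_eqI:
  assumes "q \<in> vcar (U \<otimes> U)" "r \<in> vcar (U \<otimes> U)"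
    and "\<And>s. s \<in> vcar (H \<otimes> H) \<Longrightarrow> nested_pairing H U q s = nested_pairing H U r s"
  shows "q = r"
proof (rule inj_onD[OF inj_emb_UU _ assms(1,2)])
  show "emb_UU H U q = emb_UU H U r"
  proof (rule dual_eqI)
    show "emb_UU H U q s = emb_UU H U r s" if "s \<in> vcar (H \<otimes> H)" for s
      using assms(3)[of "flip s"] that by (simp add: nested_pairing_def)
  qed (use assms(1,2) in \<open>auto intro: lin_mem[OF lin_emb_UU]\<close>)
qed

lemma tensor_eqI_eval:
  assumes "vspace X" "s \<in> vcar (X \<otimes> U)" "t \<in> vcar (X \<otimes> U)"
    and "\<And>b. b \<in> vcar H \<Longrightarrow> id_eps X U (\<lambda>f. f b) s = id_eps X U (\<lambda>f. f b) t"
  shows "s = t"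
proof (rule tensor_eqI_slices[where E = "(\<lambda>b f. f b) ` vcar H", OF assms(1) vspace_U _ _ assms(2,3)])
  show "f = 0" if "f \<in> vcar U" "\<forall>\<epsilon>\<in>(\<lambda>b f. f b) ` vcar H. \<epsilon> f = 0" for f
    by (rule U_eqI) (use that vspace_zero[OF vspace_U] in \<open>auto simp: zero_fun_apply\<close>)
qed (use assms(4) in auto)

lemma tensor_eqI_nested_pairing:
  assumes "vspace X" "s \<in> vcar (X \<otimes> (U \<otimes> U))" "t \<in> vcar (X \<otimes> (U \<otimes> U))"
    and "\<And>w. w \<in> vcar (H \<otimes> H) \<Longrightarrow>
      id_eps X (U \<otimes> U) (\<lambda>q. nested_pairing H U q w) s = id_eps X (U \<otimes> U) (\<lambda>q. nested_pairing H U q w) t"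
  shows "s = t"
proof (rule tensor_eqI_slices[where E = "(\<lambda>w q. nested_pairing H U q w) ` vcar (H \<otimes> H)",
      OF assms(1) vspace_tensor _ _ assms(2,3)])
  show "q = 0" if "q \<in> vcar (U \<otimes> U)" "\<forall>\<epsilon>\<in>(\<lambda>w q. nested_pairing H U q w) ` vcar (H \<otimes> H). \<epsilon> q = 0" for q
    by (rule nested_pairing_eqI)
      (use that lin_zero[OF vspace_tensor ground_simps(1) lin_nested_pairing_left] in \<open>auto simp: vspace_zero\<close>)
qed (use assms(4) in auto)

subsection \<open>The transpose of a braiding is a braiding\<close>

text \<open>The nested pairing of three factors,
  \<open>\<langle>f \<otimes> g \<otimes> h, a \<otimes> b \<otimes> c\<rangle> = f(c) g(b) h(a)\<close>. Moving \<open>a\<close> behind \<open>b \<otimes> c\<close> makes it a parallel pairing of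
  \<open>(U \<otimes> U) \<otimes> U\<close> with \<open>(H \<otimes> H) \<otimes> H\<close>.\<close>

definition triple_pairing where
  "triple_pairing t z =
     tensor_embed (U \<otimes> U) U (H \<otimes> H) H (nested_pairing H U) (\<lambda>f x. f x) t (flip (assoc H H H z))"

lemma lin_triple_pairing_left: "lin (U \<otimes> U \<otimes> U) ground (\<lambda>t. triple_pairing t z)"
  unfolding triple_pairing_def by (rule lin_dual_apply[OF lin_tensor_embed]) simp_all

lemma triple_embed_dual:
  "t \<in> vcar (U \<otimes> U \<otimes> U) \<Longrightarrow>
   tensor_embed (U \<otimes> U) U (H \<otimes> H) H (nested_pairing H U) (\<lambda>f x. f x) t \<in> vcar (dual (H \<otimes> H \<otimes> H))"
  by (rule lin_mem[OF lin_tensor_embed]) simp_all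

lemma lin_triple_pairing_right:
  "t \<in> vcar (U \<otimes> U \<otimes> U) \<Longrightarrow> lin (H \<otimes> H \<otimes> H) ground (triple_pairing t)"
  unfolding triple_pairing_def
  by (rule lin_comp[OF dual_lin[OF triple_embed_dual] lin_comp[OF lin_flip lin_assoc]]) simp_all

lemma triple_pairing_outer:
  "q \<in> vcar (U \<otimes> U) \<Longrightarrow> h \<in> vcar U \<Longrightarrow> a \<in> vcar H \<Longrightarrow> w \<in> vcar (H \<otimes> H) \<Longrightarrow>
   triple_pairing (tens (U \<otimes> U) U q h) (assoc_inv H H H (tens H (H \<otimes> H) a w)) = nested_pairing H U q w * h a"
  by (simp add: triple_pairing_def tensor_embed_tens)

text \<open>Together with \<open>triple_pairing_outer\<close>: the first two factors of \<open>U \<otimes> U \<otimes> U\<close> are paired with the last two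
  of \<open>H \<otimes> H \<otimes> H\<close>, and vice versa.\<close>

lemma triple_pairing_inner:
  assumes f: "f \<in> vcar U" and q: "q \<in> vcar (U \<otimes> U)" and w: "w \<in> vcar (H \<otimes> H)" and c: "c \<in> vcar H"
  shows "triple_pairing (assoc_inv U U U (tens U (U \<otimes> U) f q)) (tens (H \<otimes> H) H w c) = f c * nested_pairing H U q w"
proof (rule tensor_eqI[OF _ _ _ _ q])
  show "lin (U \<otimes> U) ground (\<lambda>q. triple_pairing (assoc_inv U U U (tens U (U \<otimes> U) f q)) (tens (H \<otimes> H) H w c))"
    by (rule lin_comp[OF lin_triple_pairing_left lin_comp[OF lin_assoc_inv lin_tens_right]]) (simp_all add: f)
  show "lin (U \<otimes> U) ground (\<lambda>q. f c * nested_pairing H U q w)" by (intro lin_times) simp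
  fix g h assume [simp]: "g \<in> vcar U" "h \<in> vcar U"
  show "triple_pairing (assoc_inv U U U (tens U (U \<otimes> U) f (tens U U g h))) (tens (H \<otimes> H) H w c)
      = f c * nested_pairing H U (tens U U g h) w"
  proof (rule tensor_eqI[OF _ _ _ _ w])
    show "lin (H \<otimes> H) ground (\<lambda>w. triple_pairing (assoc_inv U U U (tens U (U \<otimes> U) f (tens U U g h))) (tens (H \<otimes> H) H w c))"
      by (rule lin_comp[OF lin_triple_pairing_right lin_tens_left]) (simp_all add: f c)
    show "lin (H \<otimes> H) ground (\<lambda>w. f c * nested_pairing H U (tens U U g h) w)" by (intro lin_times) simp
    fix a b assume [simp]: "a \<in> vcar H" "b \<in> vcar H"
    show "triple_pairing (assoc_inv U U U (tens U (U \<otimes> U) f (tens U U g h))) (tens (H \<otimes> H) H (tens H H a b) c)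
        = f c * nested_pairing H U (tens U U g h) (tens H H a b)"
      using triple_pairing_outer[of "tens U U f g" h a "tens H H b c"] f c by simp
  qed simp_all
qed simp_all

lemma triple_pairing_eqI:
  assumes st: "s \<in> vcar (U \<otimes> U \<otimes> U)" "t \<in> vcar (U \<otimes> U \<otimes> U)"
    and eq: "\<And>z. z \<in> vcar (H \<otimes> H \<otimes> H) \<Longrightarrow> triple_pairing s z = triple_pairing t z"
  shows "s = t"
proof (rule tensor_embed_eq_imp_eq[of "U \<otimes> U" U "H \<otimes> H" H "nested_pairing H U" "\<lambda>f x. f x", OF _ _ _ _ _ _ _ _ _ _ st])
  fix w x assume "w \<in> vcar (H \<otimes> H)" "x \<in> vcar H"
  then show "tensor_embed (U \<otimes> U) U (H \<otimes> H) H (nested_pairing H U) (\<lambda>f x. f x) s (tens (H \<otimes> H) H w x)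
      = tensor_embed (U \<otimes> U) U (H \<otimes> H) H (nested_pairing H U) (\<lambda>f x. f x) t (tens (H \<otimes> H) H w x)"
    using eq[of "assoc_inv H H H (tens H (H \<otimes> H) x w)"] by (simp add: triple_pairing_def assoc_inv_in)
qed (auto intro: U_eqI nested_pairing_eqI)

text \<open>Under the triple pairing \<open>P\<^sub>1\<^sub>2\<close> is the transpose of \<open>\<Psi>\<^sub>2\<^sub>3\<close> and \<open>P\<^sub>2\<^sub>3\<close> that of \<open>\<Psi>\<^sub>1\<^sub>2\<close>. Hence \<open>P\<^sub>1\<^sub>2 P\<^sub>2\<^sub>3 P\<^sub>1\<^sub>2\<close> is
  the transpose of \<open>\<Psi>\<^sub>2\<^sub>3 \<Psi>\<^sub>1\<^sub>2 \<Psi>\<^sub>2\<^sub>3\<close> and \<open>P\<^sub>2\<^sub>3 P\<^sub>1\<^sub>2 P\<^sub>2\<^sub>3\<close> that of \<open>\<Psi>\<^sub>1\<^sub>2 \<Psi>\<^sub>2\<^sub>3 \<Psi>\<^sub>1\<^sub>2\<close>.\<close>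

lemma left_hexagon_full_transpose:
  assumes P [simp]: "lin (U \<otimes> U) (U \<otimes> U) P" and \<Psi> [simp]: "lin (H \<otimes> H) (H \<otimes> H) \<Psi>"
    and tr: "full_transpose H U P \<Psi>" and hex: "left_hexagon H \<Psi> H \<Psi>"
  shows "left_hexagon U P U P"
proof -
  have tr': "nested_pairing H U (P q) s = nested_pairing H U q (\<Psi> s)"
    if "q \<in> vcar (U \<otimes> U)" "s \<in> vcar (H \<otimes> H)" for q s
    using tr that by (simp add: full_transpose_def)
  have 1: "triple_pairing (psi_id U U U P t) z = triple_pairing t (id_psi H H H \<Psi> z)"
    if t: "t \<in> vcar (U \<otimes> U \<otimes> U)" and z: "z \<in> vcar (H \<otimes> H \<otimes> H)" for t z
  proof (rule tensor_eqI[OF _ _ _ _ t])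
    fix q h assume [simp]: "q \<in> vcar (U \<otimes> U)" "h \<in> vcar U"
    have [simp]: "P q \<in> vcar (U \<otimes> U)" by (rule lin_mem[OF P]) simp
    show "triple_pairing (psi_id U U U P (tens (U \<otimes> U) U q h)) z
        = triple_pairing (tens (U \<otimes> U) U q h) (id_psi H H H \<Psi> z)"
      by (rule tensor_eq_assocI[where F = "triple_pairing (psi_id U U U P (tens (U \<otimes> U) U q h))"
            and G = "\<lambda>z. triple_pairing (tens (U \<otimes> U) U q h) (id_psi H H H \<Psi> z)", OF _ _ _ _ _ _ _ z])
        (auto intro!: lin_triple_pairing_right lin_comp[OF lin_triple_pairing_right]
          simp: triple_pairing_outer tr' lin_mem[OF \<Psi>])
  qed (auto intro: lin_comp[OF lin_triple_pairing_left] lin_triple_pairing_left)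
  have 2: "triple_pairing (id_psi U U U P t) z = triple_pairing t (psi_id H H H \<Psi> z)"
    if t: "t \<in> vcar (U \<otimes> U \<otimes> U)" and z: "z \<in> vcar (H \<otimes> H \<otimes> H)" for t z
  proof (rule tensor_eq_assocI[OF _ _ _ _ _ _ _ t])
    fix f q assume [simp]: "f \<in> vcar U" "q \<in> vcar (U \<otimes> U)"
    have [simp]: "P q \<in> vcar (U \<otimes> U)" by (rule lin_mem[OF P]) simp
    show "triple_pairing (id_psi U U U P (assoc_inv U U U (tens U (U \<otimes> U) f q))) z
        = triple_pairing (assoc_inv U U U (tens U (U \<otimes> U) f q)) (psi_id H H H \<Psi> z)"
      by (rule tensor_eqI[where F = "triple_pairing (id_psi U U U P (assoc_inv U U U (tens U (U \<otimes> U) f q)))"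
            and G = "\<lambda>z. triple_pairing (assoc_inv U U U (tens U (U \<otimes> U) f q)) (psi_id H H H \<Psi> z)", OF _ _ _ _ z])
        (auto intro!: lin_triple_pairing_right lin_comp[OF lin_triple_pairing_right]
          simp: triple_pairing_inner tr' lin_mem[OF \<Psi>] assoc_inv_in)
  qed (auto intro: lin_comp[OF lin_triple_pairing_left] lin_triple_pairing_left)
  show ?thesis
    unfolding left_hexagon_def
  proof
    fix t assume t: "t \<in> vcar (U \<otimes> U \<otimes> U)"
    show "psi_id U U U P (id_psi U U U P (psi_id U U U P t)) = id_psi U U U P (psi_id U U U P (id_psi U U U P t))"
    proof (rule triple_pairing_eqI)
      fix z assume z: "z \<in> vcar (H \<otimes> H \<otimes> H)"
      have "psi_id H H H \<Psi> (id_psi H H H \<Psi> (psi_id H H H \<Psi> z)) = id_psi H H H \<Psi> (psi_id H H H \<Psi> (id_psi H H H \<Psi> z))"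
        using hex z by (simp add: left_hexagon_def)
      then show "triple_pairing (psi_id U U U P (id_psi U U U P (psi_id U U U P t))) z
          = triple_pairing (id_psi U U U P (psi_id U U U P (id_psi U U U P t))) z"
        using t z by (simp add: 1 2 psi_id_in id_psi_in)
    qed (use t in \<open>simp_all add: psi_id_in id_psi_in\<close>)
  qed
qed

end


context function_space
begin

section \<open>Half transposes\<close>

context
  fixes R :: "('k, 'h \<Rightarrow> 'k, 'h) tens \<Rightarrow> ('k, 'h, 'h \<Rightarrow> 'k) tens" and \<Phi>
  assumes R [simp]: "lin (U \<otimes> H) (H \<otimes> U) R" and \<Phi> [simp]: "lin (H \<otimes> H) (H \<otimes> H) \<Phi>"
    and half: "half_transpose H U R \<Phi>"
begin

lemma half_transpose_apply:
  "g \<in> vcar U \<Longrightarrow> a \<in> vcar H \<Longrightarrow> b \<in> vcar H \<Longrightarrow>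
   id_eps H U (\<lambda>f. f b) (R (tens U H g a)) = eps_id H H g (\<Phi> (tens H H a b))"
  using half by (simp add: half_transpose_def)

lemma \<Phi>_in [simp]: "t \<in> vcar (H \<otimes> H) \<Longrightarrow> \<Phi> t \<in> vcar (H \<otimes> H)"
  by (rule lin_mem[OF \<Phi>])

lemma R_in [simp]: "t \<in> vcar (U \<otimes> H) \<Longrightarrow> R t \<in> vcar (H \<otimes> U)"
  by (rule lin_mem[OF R])

text \<open>If \<open>\<Phi>(c \<otimes> b) = \<Sum> p \<otimes> q\<close>, then evaluating \<open>(id \<otimes> R)(r \<otimes> c)\<close> at \<open>b\<close> gives
  \<open>\<Sum> (id \<otimes> ev\<^sub>p)(r) \<otimes> q\<close>: the functional produced by \<open>r\<close> is consumed by the first factor of \<open>\<Phi>(c \<otimes> b)\<close>.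
  The lift expresses this without choosing a decomposition of \<open>\<Phi>(c \<otimes> b)\<close>.\<close>

lemma slice_id_psi_half_transpose:
  assumes r: "r \<in> vcar (H \<otimes> U)" and c: "c \<in> vcar H" and b: "b \<in> vcar H"
  shows "id_eps (H \<otimes> H) U (\<lambda>f. f b) (id_psi H U H R (tens (H \<otimes> U) H r c))
    = lift H H (H \<otimes> H) (\<lambda>p q. tens H H (id_eps H U (\<lambda>f. f p) r) q) (\<Phi> (tens H H c b))"
proof -
  have ev: "lin H H (\<lambda>p. id_eps H U (\<lambda>f. f p) r)" if "r \<in> vcar (H \<otimes> U)" for r
    by (rule lin_id_eps_parameter) (use that in simp_all)
  have bil: "bilin H H (H \<otimes> H) (\<lambda>p q. tens H H (id_eps H U (\<lambda>f. f p) r) q)" if "r \<in> vcar (H \<otimes> U)" for r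
    by (rule bilin_tmap) (simp_all add: ev that)
  show ?thesis
  proof (rule tensor_eqI[where F = "\<lambda>r. id_eps (H \<otimes> H) U (\<lambda>f. f b) (id_psi H U H R (tens (H \<otimes> U) H r c))", OF _ _ _ _ r])
    show "lin (H \<otimes> U) (H \<otimes> H) (\<lambda>r. id_eps (H \<otimes> H) U (\<lambda>f. f b) (id_psi H U H R (tens (H \<otimes> U) H r c)))"
      by (intro lin_comp[OF lin_id_eps] lin_comp[OF lin_id_psi] lin_tens_left) (simp_all add: c)
    show "lin (H \<otimes> U) (H \<otimes> H) (\<lambda>r. lift H H (H \<otimes> H) (\<lambda>p q. tens H H (id_eps H U (\<lambda>f. f p) r) q) (\<Phi> (tens H H c b)))"
      by (rule lin_lift_parameter) (auto intro!: lin_comp[OF lin_tens_left lin_id_eps] simp: bil b c)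
    fix x g assume [simp]: "x \<in> vcar H" "g \<in> vcar U"
    have slice: "id_eps (H \<otimes> H) U (\<lambda>f. f b) (assoc_inv H H U (tens H (H \<otimes> U) x s)) = tens H H x (id_eps H U (\<lambda>f. f b) s)"
      if s: "s \<in> vcar (H \<otimes> U)" for s
      by (rule tensor_eqI[OF _ _ _ _ s])
        (auto intro!: lin_comp[OF lin_id_eps] lin_comp[OF lin_assoc_inv] lin_comp[OF lin_tens_right]
            lin_tens_right simp: lin_scale[OF lin_tens_right, simplified])
    have "lift H H (H \<otimes> H) (\<lambda>p q. tens H H (id_eps H U (\<lambda>f. f p) (tens H U x g)) q) s = tens H H x (eps_id H H g s)"
      if s: "s \<in> vcar (H \<otimes> H)" for s
    proof (rule tensor_eqI[OF _ _ _ _ s])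
      show "lin (H \<otimes> H) (H \<otimes> H) (lift H H (H \<otimes> H) (\<lambda>p q. tens H H (id_eps H U (\<lambda>f. f p) (tens H U x g)) q))"
        by (rule lin_lift[OF vspace_tensor bil]) simp
      show "lin (H \<otimes> H) (H \<otimes> H) (\<lambda>s. tens H H x (eps_id H H g s))"
        by (rule lin_comp[OF lin_tens_right lin_eps_id]) simp_all
      fix p q assume [simp]: "p \<in> vcar H" "q \<in> vcar H"
      show "lift H H (H \<otimes> H) (\<lambda>p q. tens H H (id_eps H U (\<lambda>f. f p) (tens H U x g)) q) (tens H H p q)
          = tens H H x (eps_id H H g (tens H H p q))"
        using lin_scale[OF lin_tens_left[of H H q]] lin_scale[OF lin_tens_right[of H H x]]
        by (subst lift_tens[OF vspace_tensor bil]) simp_all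
    qed simp
    then show "id_eps (H \<otimes> H) U (\<lambda>f. f b) (id_psi H U H R (tens (H \<otimes> U) H (tens H U x g) c))
        = lift H H (H \<otimes> H) (\<lambda>p q. tens H H (id_eps H U (\<lambda>f. f p) (tens H U x g)) q) (\<Phi> (tens H H c b))"
      by (simp add: slice half_transpose_apply b c)
  qed simp
qed

text \<open>Apply the preceding lemma to \<open>r = R(g \<otimes> a)\<close>; its evaluation at \<open>p\<close> is again given by the half
  transpose, now as \<open>(g \<otimes> id)(\<Phi>(a \<otimes> p))\<close>.\<close>

lemma half_transpose_right:
  assumes g [simp]: "g \<in> vcar U" and s: "s \<in> vcar (H \<otimes> H)" and b [simp]: "b \<in> vcar H"
  shows "id_eps (H \<otimes> H) U (\<lambda>f. f b) (id_psi H U H R (psi_id U H H R (assoc_inv U H H (tens U (H \<otimes> H) g s))))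
    = tmap (H \<otimes> H) H H H (eps_id H H g) id (psi_id H H H \<Phi> (id_psi H H H \<Phi> (tens (H \<otimes> H) H s b)))"
proof -
  let ?L = "\<lambda>s. id_eps (H \<otimes> H) U (\<lambda>f. f b) (id_psi H U H R (psi_id U H H R (assoc_inv U H H (tens U (H \<otimes> H) g s))))"
    and ?G = "\<lambda>s. tmap (H \<otimes> H) H H H (eps_id H H g) id (psi_id H H H \<Phi> (id_psi H H H \<Phi> (tens (H \<otimes> H) H s b)))"
  show ?thesis
  proof (rule tensor_eqI[where F = ?L and G = ?G, OF _ _ _ _ s])
  show "lin (H \<otimes> H) (H \<otimes> H) ?L"
    by (intro lin_comp[OF lin_id_eps] lin_comp[OF lin_id_psi] lin_comp[OF lin_psi_id] lin_comp[OF lin_assoc_inv]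
      lin_tens_right) simp_all
  show "lin (H \<otimes> H) (H \<otimes> H) ?G"
    by (intro lin_comp[OF lin_tmap] lin_comp[OF lin_id_psi] lin_comp[OF lin_psi_id] lin_tens_left) simp_all
  fix a c assume [simp]: "a \<in> vcar H" "c \<in> vcar H"
  have bil: "bilin H H (H \<otimes> H) (\<lambda>p q. tens H H (id_eps H U (\<lambda>f. f p) (R (tens U H g a))) q)"
    by (rule bilin_tmap) (auto intro: lin_id_eps_parameter)
  have "lift H H (H \<otimes> H) (\<lambda>p q. tens H H (id_eps H U (\<lambda>f. f p) (R (tens U H g a))) q) w
      = tmap (H \<otimes> H) H H H (eps_id H H g) id (psi_id H H H \<Phi> (assoc_inv H H H (tens H (H \<otimes> H) a w)))"
    if w: "w \<in> vcar (H \<otimes> H)" for w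
  proof (rule tensor_eqI[OF _ _ _ _ w])
    show "lin (H \<otimes> H) (H \<otimes> H) (lift H H (H \<otimes> H) (\<lambda>p q. tens H H (id_eps H U (\<lambda>f. f p) (R (tens U H g a))) q))"
      by (rule lin_lift) (simp_all add: bil)
    show "lin (H \<otimes> H) (H \<otimes> H)
       (\<lambda>w. tmap (H \<otimes> H) H H H (eps_id H H g) id (psi_id H H H \<Phi> (assoc_inv H H H (tens H (H \<otimes> H) a w))))"
      by (intro lin_comp[OF lin_tmap] lin_comp[OF lin_psi_id] lin_comp[OF lin_assoc_inv] lin_tens_right) simp_all
  qed (simp_all add: lift_tens bil half_transpose_apply)
  then show "?L (tens H H a c) = ?G (tens H H a c)"
    by (simp add: slice_id_psi_half_transpose)
  qed simp
qed

text \<open>Evaluated at \<open>b\<close>, the two sides are \<open>g \<otimes> id \<otimes> id\<close> applied to the two sides of the mixed braid relation at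
  \<open>s \<otimes> b\<close>, because \<open>\<Theta>\<close> on the last two factors commutes with \<open>g\<close> on the first.\<close>

lemma right_hexagon_half_transpose:
  assumes \<Theta> [simp]: "lin (H \<otimes> H) (H \<otimes> H) \<Theta>" and hex: "left_hexagon H \<Theta> H \<Phi>"
  shows "right_hexagon H \<Theta> U R"
  unfolding right_hexagon_def
proof
  fix t assume t: "t \<in> vcar (U \<otimes> H \<otimes> H)"
  have [simp]: "\<Theta> s \<in> vcar (H \<otimes> H)" if "s \<in> vcar (H \<otimes> H)" for s using that by (rule lin_mem[OF \<Theta>])
  show "id_psi H U H R (psi_id U H H R (id_psi U H H \<Theta> t)) = psi_id H H U \<Theta> (id_psi H U H R (psi_id U H H R t))"
  proof (rule tensor_eq_assocI[where F = "\<lambda>t. id_psi H U H R (psi_id U H H R (id_psi U H H \<Theta> t))"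
        and G = "\<lambda>t. psi_id H H U \<Theta> (id_psi H U H R (psi_id U H H R t))", OF _ _ _ _ _ _ _ t])
    fix g s assume [simp]: "g \<in> vcar U" and s [simp]: "s \<in> vcar (H \<otimes> H)"
    show "id_psi H U H R (psi_id U H H R (id_psi U H H \<Theta> (assoc_inv U H H (tens U (H \<otimes> H) g s))))
      = psi_id H H U \<Theta> (id_psi H U H R (psi_id U H H R (assoc_inv U H H (tens U (H \<otimes> H) g s))))"
      (is "?l = psi_id H H U \<Theta> ?r")
    proof (rule tensor_eqI_eval[of "H \<otimes> H"])
      fix b assume b [simp]: "b \<in> vcar H"
      let ?G = "tmap (H \<otimes> H) H H H (eps_id H H g) id"
      have r: "?r \<in> vcar (H \<otimes> H \<otimes> U)" by (simp add: id_psi_in psi_id_in assoc_inv_in)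
      have G: "?G (id_psi H H H \<Theta> z) = \<Theta> (?G z)" if z: "z \<in> vcar (H \<otimes> H \<otimes> H)" for z
      proof (rule tensor_eq_assocI[OF _ _ _ _ _ _ _ z])
        fix x w assume [simp]: "x \<in> vcar H" "w \<in> vcar (H \<otimes> H)"
        have slice: "?G (assoc_inv H H H (tens H (H \<otimes> H) x w)) = fscale (g x) w" if w: "w \<in> vcar (H \<otimes> H)" for w
          by (rule tensor_eqI[OF _ _ _ _ w])
            (auto intro!: lin_comp[OF lin_tmap] lin_comp[OF lin_assoc_inv] lin_tens_right
               lin_scaling[of "H \<otimes> H" _ "\<lambda>x. x", simplified] simp: lin_scale[OF lin_tens_left, simplified])
        show "?G (id_psi H H H \<Theta> (assoc_inv H H H (tens H (H \<otimes> H) x w))) = \<Theta> (?G (assoc_inv H H H (tens H (H \<otimes> H) x w)))"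
          using lin_scale[OF \<Theta>, of w "g x"] by (simp add: slice)
      qed (auto intro!: lin_comp[OF lin_tmap] lin_comp[OF \<Theta>])
      have "id_eps (H \<otimes> H) U (\<lambda>f. f b) ?l = ?G (psi_id H H H \<Phi> (id_psi H H H \<Phi> (tens (H \<otimes> H) H (\<Theta> s) b)))"
        by (simp add: half_transpose_right)
      also have "\<dots> = ?G (id_psi H H H \<Theta> (psi_id H H H \<Phi> (id_psi H H H \<Phi> (tens (H \<otimes> H) H s b))))"
        using hex[unfolded left_hexagon_def, rule_format, of "tens (H \<otimes> H) H s b"] by simp
      also have "\<dots> = \<Theta> (id_eps (H \<otimes> H) U (\<lambda>f. f b) ?r)"
        by (simp add: G half_transpose_right psi_id_in id_psi_in)
      also have "\<dots> = id_eps (H \<otimes> H) U (\<lambda>f. f b) (psi_id H H U \<Theta> ?r)"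
        unfolding psi_id_def[of H H U \<Theta>] using r by (simp add: id_eps_tmap)
      finally show "id_eps (H \<otimes> H) U (\<lambda>f. f b) ?l = id_eps (H \<otimes> H) U (\<lambda>f. f b) (psi_id H H U \<Theta> ?r)" .
    qed (simp_all add: id_psi_in psi_id_in assoc_inv_in)
  qed (auto intro!: lin_comp[OF lin_id_psi] lin_comp[OF lin_psi_id])
qed

text \<open>Evaluated at \<open>b\<close>, multiplying before or after \<open>R\<close> gives \<open>g \<otimes> id\<close> applied to \<open>\<Phi>(m(s) \<otimes> b)\<close> and to
  \<open>(id \<otimes> m) \<Phi>\<^sub>1\<^sub>2 \<Phi>\<^sub>2\<^sub>3 (s \<otimes> b)\<close>.\<close>

lemma mult_compat_right_half_transpose:
  assumes m [simp]: "lin (H \<otimes> H) H m" and u: "\<forall>e. u = Some e \<longrightarrow> e \<in> vcar H"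
    and compat: "mult_compat_left H H \<Phi> m u"
  shows "mult_compat_right U H R m u"
  unfolding mult_compat_right_def
proof (intro conjI ballI allI impI)
  have [simp]: "m s \<in> vcar H" if "s \<in> vcar (H \<otimes> H)" for s using that by (rule lin_mem[OF m])
  fix t assume t: "t \<in> vcar (U \<otimes> H \<otimes> H)"
  show "R (tmap U (H \<otimes> H) U H id m (assoc U H H t)) = tmap (H \<otimes> H) U H U m id (id_psi H U H R (psi_id U H H R t))"
  proof (rule tensor_eq_assocI[where F = "\<lambda>t. R (tmap U (H \<otimes> H) U H id m (assoc U H H t))"
        and G = "\<lambda>t. tmap (H \<otimes> H) U H U m id (id_psi H U H R (psi_id U H H R t))", OF _ _ _ _ _ _ _ t])
    fix g s assume [simp]: "g \<in> vcar U" "s \<in> vcar (H \<otimes> H)"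
    let ?t = "assoc_inv U H H (tens U (H \<otimes> H) g s)"
    show "R (tmap U (H \<otimes> H) U H id m (assoc U H H ?t)) = tmap (H \<otimes> H) U H U m id (id_psi H U H R (psi_id U H H R ?t))"
    proof (rule tensor_eqI_eval[of H])
      fix b assume b [simp]: "b \<in> vcar H"
      let ?G = "tmap (H \<otimes> H) H H H (eps_id H H g) id" and ?z = "psi_id H H H \<Phi> (id_psi H H H \<Phi> (tens (H \<otimes> H) H s b))"
      have z: "?z \<in> vcar (H \<otimes> H \<otimes> H)" by (simp add: id_psi_in psi_id_in)
      have "id_eps H U (\<lambda>f. f b) (R (tmap U (H \<otimes> H) U H id m (assoc U H H ?t))) = eps_id H H g (\<Phi> (tens H H (m s) b))"
        by (simp add: half_transpose_apply)
      also have "\<Phi> (tens H H (m s) b) = tmap H (H \<otimes> H) H H id m (assoc H H H ?z)"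
        using compat[unfolded mult_compat_left_def, THEN conjunct1, rule_format, of "tens (H \<otimes> H) H s b"] by simp
      also have "eps_id H H g \<dots> = m (eps_id H (H \<otimes> H) g (assoc H H H ?z))"
        by (rule eps_id_tmap) (simp_all add: assoc_in z)
      also have "eps_id H (H \<otimes> H) g (assoc H H H ?z) = ?G ?z"
        by (rule tensor3_eqI[OF _ _ _ _ _ _ _ z])
          (auto intro!: lin_comp[OF lin_eps_id] simp: lin_scale[OF lin_tens_left, simplified])
      also have "m \<dots> = id_eps H U (\<lambda>f. f b) (tmap (H \<otimes> H) U H U m id (id_psi H U H R (psi_id U H H R ?t)))"
        by (simp add: id_eps_tmap half_transpose_right id_psi_in psi_id_in assoc_inv_in)
      finally show "id_eps H U (\<lambda>f. f b) (R (tmap U (H \<otimes> H) U H id m (assoc U H H ?t)))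
        = id_eps H U (\<lambda>f. f b) (tmap (H \<otimes> H) U H U m id (id_psi H U H R (psi_id U H H R ?t)))" .
    qed (auto intro!: lin_mem[OF lin_tmap] simp: id_psi_in psi_id_in assoc_inv_in)
  qed (auto intro!: lin_comp[OF lin_tmap] lin_comp[OF R] lin_comp[OF lin_id_psi])
next
  fix e g assume e: "u = Some e" and g [simp]: "g \<in> vcar U"
  have [simp]: "e \<in> vcar H" using u e by blast
  show "R (tens U H g e) = tens H U e g"
  proof (rule tensor_eqI_eval[of H])
    fix b assume [simp]: "b \<in> vcar H"
    have "\<Phi> (tens H H e b) = tens H H b e" using compat e by (simp add: mult_compat_left_def)
    then show "id_eps H U (\<lambda>f. f b) (R (tens U H g e)) = id_eps H U (\<lambda>f. f b) (tens H U e g)"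
      by (simp add: half_transpose_apply)
  qed simp_all
qed

text \<open>Evaluated at \<open>b\<close>, the two sides are \<open>g \<otimes> id \<otimes> id\<close> applied to \<open>(id \<otimes> \<Delta>) \<Phi>(a \<otimes> b)\<close> and to
  \<open>\<Phi>\<^sub>1\<^sub>2 \<Phi>\<^sub>2\<^sub>3 (\<Delta>(a) \<otimes> b)\<close>.\<close>

lemma comult_compat_right_half_transpose:
  assumes \<Delta> [simp]: "lin H (H \<otimes> H) \<Delta>" and \<epsilon> [simp]: "lin H ground \<epsilon>"
    and compat: "comult_compat_left H H \<Phi> \<Delta> \<epsilon>"
  shows "comult_compat_right U H R \<Delta> \<epsilon>"
  unfolding comult_compat_right_def
proof (intro conjI ballI)
  have [simp]: "\<Delta> x \<in> vcar (H \<otimes> H)" if "x \<in> vcar H" for x using that by (rule lin_mem[OF \<Delta>])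
  fix t assume t: "t \<in> vcar (U \<otimes> H)"
  show "tmap H U (H \<otimes> H) U \<Delta> id (R t) = id_psi H U H R (psi_id U H H R (assoc_inv U H H (tmap U H U (H \<otimes> H) id \<Delta> t)))"
  proof (rule tensor_eqI[where F = "\<lambda>t. tmap H U (H \<otimes> H) U \<Delta> id (R t)"
       and G = "\<lambda>t. id_psi H U H R (psi_id U H H R (assoc_inv U H H (tmap U H U (H \<otimes> H) id \<Delta> t)))", OF _ _ _ _ t])
    fix g a assume [simp]: "g \<in> vcar U" "a \<in> vcar H"
    let ?r = "id_psi H U H R (psi_id U H H R (assoc_inv U H H (tmap U H U (H \<otimes> H) id \<Delta> (tens U H g a))))"
    show "tmap H U (H \<otimes> H) U \<Delta> id (R (tens U H g a)) = ?r"
    proof (rule tensor_eqI_eval[of "H \<otimes> H"])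
      fix b assume [simp]: "b \<in> vcar H"
      let ?G = "tmap (H \<otimes> H) H H H (eps_id H H g) id"
        and ?z = "psi_id H H H \<Phi> (id_psi H H H \<Phi> (tens (H \<otimes> H) H (\<Delta> a) b))"
      have z: "?z \<in> vcar (H \<otimes> H \<otimes> H)" by (simp add: id_psi_in psi_id_in)
      have "id_eps (H \<otimes> H) U (\<lambda>f. f b) (tmap H U (H \<otimes> H) U \<Delta> id (R (tens U H g a)))
          = \<Delta> (eps_id H H g (\<Phi> (tens H H a b)))"
        by (simp add: id_eps_tmap half_transpose_apply)
      also have "\<dots> = eps_id H (H \<otimes> H) g (tmap H H H (H \<otimes> H) id \<Delta> (\<Phi> (tens H H a b)))"
        by (simp add: eps_id_tmap)
      also have "tmap H H H (H \<otimes> H) id \<Delta> (\<Phi> (tens H H a b)) = assoc H H H ?z"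
        using compat by (simp add: comult_compat_left_def)
      also have "eps_id H (H \<otimes> H) g (assoc H H H ?z) = ?G ?z"
        by (rule tensor3_eqI[OF _ _ _ _ _ _ _ z])
          (auto intro!: lin_comp[OF lin_eps_id] simp: lin_scale[OF lin_tens_left, simplified])
      also have "\<dots> = id_eps (H \<otimes> H) U (\<lambda>f. f b) ?r"
        by (simp add: half_transpose_right)
      finally show "id_eps (H \<otimes> H) U (\<lambda>f. f b) (tmap H U (H \<otimes> H) U \<Delta> id (R (tens U H g a)))
        = id_eps (H \<otimes> H) U (\<lambda>f. f b) ?r" .
    qed (auto intro!: lin_mem[OF lin_tmap] simp: id_psi_in psi_id_in assoc_inv_in)
  qed (auto intro!: lin_comp[OF lin_tmap] lin_comp[OF lin_assoc_inv] lin_comp[OF lin_psi_id] lin_comp[OF lin_id_psi])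
  show "eps_id H U \<epsilon> (R t) = id_eps U H \<epsilon> t"
  proof (rule tensor_eqI[where F = "\<lambda>t. eps_id H U \<epsilon> (R t)", OF _ _ _ _ t])
    fix g a assume [simp]: "g \<in> vcar U" "a \<in> vcar H"
    show "eps_id H U \<epsilon> (R (tens U H g a)) = id_eps U H \<epsilon> (tens U H g a)"
    proof (rule U_eqI)
      show "\<forall>b\<in>vcar H. eps_id H U \<epsilon> (R (tens U H g a)) b = id_eps U H \<epsilon> (tens U H g a) b"
      proof
        fix b assume [simp]: "b \<in> vcar H"
        \<comment> \<open>Functionals acting on different factors commute.\<close>
        have swap: "eps_id H U \<epsilon> r b = \<epsilon> (id_eps H U (\<lambda>f. f b) r)" if r: "r \<in> vcar (H \<otimes> U)" for r
          by (rule tensor_eqI[OF _ _ _ _ r])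
            (auto intro!: lin_comp[OF lin_eval] lin_comp[OF \<epsilon>] simp: fscale_def lin_scale[OF \<epsilon>])
        have swap': "\<epsilon> (eps_id H H g s) = g (id_eps H H \<epsilon> s)" if s: "s \<in> vcar (H \<otimes> H)" for s
          by (rule tensor_eqI[OF _ _ _ _ s])
            (auto intro!: lin_comp[OF U_lin] lin_comp[OF \<epsilon>] simp: lin_scale[OF \<epsilon>] lin_scale[OF U_lin])
        have "eps_id H U \<epsilon> (R (tens U H g a)) b = \<epsilon> (eps_id H H g (\<Phi> (tens H H a b)))"
          by (simp add: swap half_transpose_apply)
        also have "\<dots> = g (eps_id H H \<epsilon> (tens H H a b))"
          using compat by (simp add: swap' comult_compat_left_def)
        finally show "eps_id H U \<epsilon> (R (tens U H g a)) b = id_eps U H \<epsilon> (tens U H g a) b"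
          by (simp add: lin_scale[OF U_lin] fscale_def)
      qed
    qed (auto intro!: eps_id_in vspace_scale[OF vspace_U, simplified])
  qed (auto intro!: lin_comp[OF lin_eps_id])
qed

text \<open>For \<open>q = f \<otimes> g\<close> and \<open>w = b \<otimes> c\<close> the inner application of \<open>R\<close> transposes \<open>g\<close> against \<open>\<Phi>(a \<otimes> b)\<close>, and the outer one
  transposes \<open>f\<close> against \<open>\<Phi>\<close> of the result and \<open>c\<close>: both sides equal
  \<open>(f \<otimes> id) \<Phi>((g \<otimes> id) \<Phi>(a \<otimes> b) \<otimes> c)\<close>.\<close>

lemma half_transpose_left:
  assumes q: "q \<in> vcar (U \<otimes> U)" and a [simp]: "a \<in> vcar H" and w: "w \<in> vcar (H \<otimes> H)"
  shows "id_eps H (U \<otimes> U) (\<lambda>q. nested_pairing H U q w)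
      (assoc H U U (psi_id U H U R (id_psi U U H R (tens (U \<otimes> U) H q a))))
    = eps_id (H \<otimes> H) H (nested_pairing H U q)
        (id_psi H H H \<Phi> (psi_id H H H \<Phi> (assoc_inv H H H (tens H (H \<otimes> H) a w))))"
proof -
  let ?L = "\<lambda>w q. id_eps H (U \<otimes> U) (\<lambda>q. nested_pairing H U q w)
      (assoc H U U (psi_id U H U R (id_psi U U H R (tens (U \<otimes> U) H q a))))"
    and ?G = "\<lambda>w q. eps_id (H \<otimes> H) H (nested_pairing H U q)
        (id_psi H H H \<Phi> (psi_id H H H \<Phi> (assoc_inv H H H (tens H (H \<otimes> H) a w))))"
  have scale_left: "tens H H (vscl H k x) c = fscale k (tens H H x c)" if "x \<in> vcar H" "c \<in> vcar H" for k x c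
    using lin_scale[OF lin_tens_left[OF H H that(2)] that(1)] by simp
  have scale_\<Phi>: "\<Phi> (fscale k t) = fscale k (\<Phi> t)" if "t \<in> vcar (H \<otimes> H)" for k t
    using lin_scale[OF \<Phi> that] by simp
  have scale_eps: "eps_id H H f (fscale k t) = vscl H k (eps_id H H f t)"
    if "f \<in> vcar U" "t \<in> vcar (H \<otimes> H)" for f k t
    using lin_scale[OF lin_eps_id that(2)] that(1) by simp
  show ?thesis
  proof (rule tensor_eqI[where F = "?L w" and G = "?G w", OF _ _ _ _ q])
    show "lin (U \<otimes> U) H (?L w)"
      by (intro lin_comp[OF lin_id_eps] lin_comp[OF lin_assoc] lin_comp[OF lin_psi_id] lin_comp[OF lin_id_psi]
        lin_tens_left) simp_all
    show "lin (U \<otimes> U) H (?G w)"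
      by (rule lin_eps_id_parameter) (simp_all add: id_psi_in psi_id_in assoc_inv_in w)
    fix f g assume f [simp]: "f \<in> vcar U" and g [simp]: "g \<in> vcar U"
    show "?L w (tens U U f g) = ?G w (tens U U f g)"
    proof (rule tensor_eqI[where F = "\<lambda>w. ?L w (tens U U f g)" and G = "\<lambda>w. ?G w (tens U U f g)", OF _ _ _ _ w])
      show "lin (H \<otimes> H) H (\<lambda>w. ?L w (tens U U f g))"
        by (rule lin_id_eps_parameter) (simp_all add: id_psi_in psi_id_in assoc_in assoc_inv_in)
      show "lin (H \<otimes> H) H (\<lambda>w. ?G w (tens U U f g))"
        by (intro lin_comp[OF lin_eps_id] lin_comp[OF lin_assoc_inv] lin_comp[OF lin_psi_id] lin_comp[OF lin_id_psi]
          lin_tens_right) simp_all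
      fix b c assume b [simp]: "b \<in> vcar H" and c [simp]: "c \<in> vcar H"
      \<comment> \<open>\<open>1\<close> and \<open>2\<close> bring the left-hand side to the common form, \<open>3\<close> and \<open>4\<close> the right-hand side.\<close>
      have 1: "id_eps H (U \<otimes> U) (\<lambda>q. nested_pairing H U q (tens H H b c)) (assoc H U U (tens (H \<otimes> U) U z h))
          = vscl H (h b) (id_eps H U (\<lambda>f. f c) z)" if [simp]: "h \<in> vcar U" and z: "z \<in> vcar (H \<otimes> U)" for h z
        by (rule tensor_eqI[OF _ _ _ _ z])
          (auto intro!: lin_comp[OF lin_id_eps] lin_comp[OF lin_assoc] lin_tens_left lin_scaling
            simp: vscl_assoc mult.commute)
      have 2: "id_eps H (U \<otimes> U) (\<lambda>q. nested_pairing H U q (tens H H b c))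
            (assoc H U U (psi_id U H U R (assoc_inv U H U (tens U (H \<otimes> U) f r))))
          = eps_id H H f (\<Phi> (tens H H (id_eps H U (\<lambda>f. f b) r) c))" if r: "r \<in> vcar (H \<otimes> U)" for r
      proof (rule tensor_eqI[OF _ _ _ _ r])
        show "lin (H \<otimes> U) H (\<lambda>r. eps_id H H f (\<Phi> (tens H H (id_eps H U (\<lambda>f. f b) r) c)))"
          by (intro lin_comp[OF lin_eps_id] lin_comp[OF \<Phi>] lin_comp[OF lin_tens_left] lin_id_eps) simp_all
        show "lin (H \<otimes> U) H (\<lambda>r. id_eps H (U \<otimes> U) (\<lambda>q. nested_pairing H U q (tens H H b c))
            (assoc H U U (psi_id U H U R (assoc_inv U H U (tens U (H \<otimes> U) f r)))))"
          by (intro lin_comp[OF lin_id_eps] lin_comp[OF lin_assoc] lin_comp[OF lin_psi_id]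
            lin_comp[OF lin_assoc_inv] lin_tens_right) simp_all
        fix x h assume [simp]: "x \<in> vcar H" "h \<in> vcar U"
        show "id_eps H (U \<otimes> U) (\<lambda>q. nested_pairing H U q (tens H H b c))
            (assoc H U U (psi_id U H U R (assoc_inv U H U (tens U (H \<otimes> U) f (tens H U x h)))))
          = eps_id H H f (\<Phi> (tens H H (id_eps H U (\<lambda>f. f b) (tens H U x h)) c))"
          by (simp add: 1 half_transpose_apply scale_left scale_\<Phi> scale_eps)
      qed simp
      have 3: "eps_id (H \<otimes> H) H (nested_pairing H U (tens U U f g)) (assoc_inv H H H (tens H (H \<otimes> H) p v))
          = vscl H (g p) (eps_id H H f v)" if [simp]: "p \<in> vcar H" and v: "v \<in> vcar (H \<otimes> H)" for p v
        by (rule tensor_eqI[OF _ _ _ _ v])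
          (auto intro!: lin_comp[OF lin_eps_id] lin_comp[OF lin_assoc_inv] lin_tens_right lin_scaling
            simp: vscl_assoc mult.commute)
      have 4: "eps_id (H \<otimes> H) H (nested_pairing H U (tens U U f g)) (id_psi H H H \<Phi> (tens (H \<otimes> H) H u c))
          = eps_id H H f (\<Phi> (tens H H (eps_id H H g u) c))" if u: "u \<in> vcar (H \<otimes> H)" for u
      proof (rule tensor_eqI[OF _ _ _ _ u])
        show "lin (H \<otimes> H) H (\<lambda>u. eps_id H H f (\<Phi> (tens H H (eps_id H H g u) c)))"
          by (intro lin_comp[OF lin_eps_id] lin_comp[OF \<Phi>] lin_comp[OF lin_tens_left] lin_eps_id) simp_all
        show "lin (H \<otimes> H) H (\<lambda>u. eps_id (H \<otimes> H) H (nested_pairing H U (tens U U f g))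
            (id_psi H H H \<Phi> (tens (H \<otimes> H) H u c)))"
          by (intro lin_comp[OF lin_eps_id] lin_comp[OF lin_id_psi] lin_tens_left) simp_all
        fix x y assume [simp]: "x \<in> vcar H" "y \<in> vcar H"
        show "eps_id (H \<otimes> H) H (nested_pairing H U (tens U U f g)) (id_psi H H H \<Phi> (tens (H \<otimes> H) H (tens H H x y) c))
          = eps_id H H f (\<Phi> (tens H H (eps_id H H g (tens H H x y)) c))"
          by (simp add: 3 scale_left scale_\<Phi> scale_eps)
      qed simp
      show "?L (tens H H b c) (tens U U f g) = ?G (tens H H b c) (tens U U f g)"
        by (simp add: 2 4 half_transpose_apply)
    qed simp
  qed simp
qed

text \<open>Paired with \<open>w\<close>, the two sides are \<open>\<langle>\<langle>q, -\<rangle>\<rangle> \<otimes> id\<close> applied to the two sides of the mixed braid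
  relation at \<open>a \<otimes> w\<close>: on the left \<open>Q\<close> acts before \<open>R\<close> and is transposed to \<open>\<Theta>\<^sub>1\<^sub>2\<close> after \<open>\<Phi>\<close>, on the right it
  acts last and is transposed to \<open>\<Theta>\<close> acting on \<open>w\<close>.\<close>

lemma left_hexagon_half_transpose:
  assumes Q [simp]: "lin (U \<otimes> U) (U \<otimes> U) Q" and \<Theta> [simp]: "lin (H \<otimes> H) (H \<otimes> H) \<Theta>"
    and tr: "full_transpose H U Q \<Theta>" and hex: "right_hexagon H \<Theta> H \<Phi>"
  shows "left_hexagon U Q H R"
  unfolding left_hexagon_def
proof
  have [simp]: "Q q \<in> vcar (U \<otimes> U)" if "q \<in> vcar (U \<otimes> U)" for q using that by (rule lin_mem[OF Q])
  have [simp]: "\<Theta> s \<in> vcar (H \<otimes> H)" if "s \<in> vcar (H \<otimes> H)" for s using that by (rule lin_mem[OF \<Theta>])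
  fix t assume t: "t \<in> vcar (U \<otimes> U \<otimes> H)"
  show "psi_id U H U R (id_psi U U H R (psi_id U U H Q t)) = id_psi H U U Q (psi_id U H U R (id_psi U U H R t))"
  proof (rule tensor_eqI[where F = "\<lambda>t. psi_id U H U R (id_psi U U H R (psi_id U U H Q t))"
        and G = "\<lambda>t. id_psi H U U Q (psi_id U H U R (id_psi U U H R t))", OF _ _ _ _ t])
    fix q a assume q [simp]: "q \<in> vcar (U \<otimes> U)" and [simp]: "a \<in> vcar H"
    let ?x = "\<lambda>q. psi_id U H U R (id_psi U U H R (tens (U \<otimes> U) H q a))"
    have x [simp]: "?x q \<in> vcar (H \<otimes> U \<otimes> U)" if "q \<in> vcar (U \<otimes> U)" for q
      using that by (simp add: psi_id_in id_psi_in)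
    have "assoc H U U (?x (Q q)) = tmap H (U \<otimes> U) H (U \<otimes> U) id Q (assoc H U U (?x q))"
    proof (rule tensor_eqI_nested_pairing[of H])
      fix w assume w [simp]: "w \<in> vcar (H \<otimes> H)"
      let ?z = "\<lambda>w. id_psi H H H \<Phi> (psi_id H H H \<Phi> (assoc_inv H H H (tens H (H \<otimes> H) a w)))"
      have z [simp]: "?z w \<in> vcar (H \<otimes> H \<otimes> H)" if "w \<in> vcar (H \<otimes> H)" for w
        using that by (simp add: psi_id_in id_psi_in assoc_inv_in)
      have \<Theta>_z: "psi_id H H H \<Theta> (?z w) = ?z (\<Theta> w)"
        using hex[unfolded right_hexagon_def, rule_format, of "assoc_inv H H H (tens H (H \<otimes> H) a w)"]
        by (simp add: assoc_inv_in)
      have "id_eps H (U \<otimes> U) (\<lambda>q. nested_pairing H U q w) (assoc H U U (?x (Q q)))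
          = eps_id (H \<otimes> H) H (nested_pairing H U (Q q)) (?z w)"
        by (simp add: half_transpose_left)
      also have "\<dots> = eps_id (H \<otimes> H) H (\<lambda>s. nested_pairing H U q (\<Theta> s)) (?z w)"
        by (rule eps_id_cong) (use tr in \<open>auto intro: lin_comp[OF lin_nested_pairing_right \<Theta>] simp: full_transpose_def\<close>)
      also have "\<dots> = eps_id (H \<otimes> H) H (nested_pairing H U q) (psi_id H H H \<Theta> (?z w))"
        unfolding psi_id_def[of H H H \<Theta>] by (rule eps_id_tmap_left[symmetric]) simp_all
      also have "\<dots> = id_eps H (U \<otimes> U) (\<lambda>q. nested_pairing H U q (\<Theta> w)) (assoc H U U (?x q))"
        by (simp add: \<Theta>_z half_transpose_left)
      also have "\<dots> = id_eps H (U \<otimes> U) (\<lambda>q. nested_pairing H U (Q q) w) (assoc H U U (?x q))"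
        by (rule id_eps_cong)
          (use tr in \<open>auto intro: lin_comp[OF lin_nested_pairing_left Q] simp: full_transpose_def assoc_in\<close>)
      also have "\<dots> = id_eps H (U \<otimes> U) (\<lambda>q. nested_pairing H U q w)
          (tmap H (U \<otimes> U) H (U \<otimes> U) id Q (assoc H U U (?x q)))"
        by (rule id_eps_tmap_right[symmetric]) (simp_all add: assoc_in)
      finally show "id_eps H (U \<otimes> U) (\<lambda>q. nested_pairing H U q w) (assoc H U U (?x (Q q)))
          = id_eps H (U \<otimes> U) (\<lambda>q. nested_pairing H U q w)
              (tmap H (U \<otimes> U) H (U \<otimes> U) id Q (assoc H U U (?x q)))" .
    qed (auto intro!: lin_mem[OF lin_tmap] simp: assoc_in)
    then have "assoc_inv H U U (assoc H U U (?x (Q q)))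
        = assoc_inv H U U (tmap H (U \<otimes> U) H (U \<otimes> U) id Q (assoc H U U (?x q)))" by (rule arg_cong[where f = "assoc_inv H U U"])
    then show "psi_id U H U R (id_psi U U H R (psi_id U U H Q (tens (U \<otimes> U) H q a))) = id_psi H U U Q (?x q)"
      by (simp add: id_psi_def[of H U U Q])
  qed (auto intro!: lin_comp[OF lin_id_psi] lin_comp[OF lin_psi_id])
qed

end

end

section \<open>The dual-valued maps as transposes\<close>

lemma dual_separates:
  fixes H :: "('k::field, 'h::ab_group_add) vsp"
  assumes H: "vspace H" and "x \<in> vcar H" "y \<in> vcar H" "\<forall>f\<in>vcar (dual H). f x = f y"
  shows "x = y"
proof (rule ccontr)
  assume "x \<noteq> y"
  then obtain \<phi> where \<phi>: "Vector_Spaces.linear (vscl H) (*) \<phi>" "\<phi> x \<noteq> \<phi> y"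
    using H by (auto simp: vspace_def elim: separating_functional)
  have "(\<lambda>z. if z \<in> vcar H then \<phi> z else 0) \<in> vcar (dual H)"
    using \<phi>(1) H by (auto simp: dual_def lin_def Vector_Spaces.linear_iff vspace_add vspace_scale)
  then show False using assms \<phi>(2) by force
qed

context
  fixes H :: "('k::field, 'h::ab_group_add) vsp"
  assumes H [simp]: "vspace H"
begin

lemma bilin_pairing: "lin H ground f \<Longrightarrow> lin H ground g \<Longrightarrow> bilin H H ground (\<lambda>x y. f y * g x)"
  by (intro bilinI lin_times)

lemma lin_pairing: "lin H ground f \<Longrightarrow> lin H ground g \<Longrightarrow> lin (H \<otimes> H) ground (pairing H f g)"
  unfolding pairing_def by (simp add: lin_lift bilin_pairing)

lemma pairing_tens:
  "lin H ground f \<Longrightarrow> lin H ground g \<Longrightarrow> x \<in> vcar H \<Longrightarrow> y \<in> vcar H \<Longrightarrow> pairing H f g (tens H H x y) = f y * g x"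
  unfolding pairing_def by (simp add: lift_tens bilin_pairing)

lemma pairing_eps_id:
  assumes f: "lin H ground f" and g: "lin H ground g" and s: "s \<in> vcar (H \<otimes> H)"
  shows "pairing H f g s = f (eps_id H H g s)"
  by (rule tensor_eqI[OF _ _ _ _ s])
    (use f g lin_scale[OF f] in \<open>auto intro: lin_comp[OF f] lin_pairing simp: pairing_tens\<close>)

lemma pairing_id_eps:
  assumes f: "lin H ground f" and g: "lin H ground g" and s: "s \<in> vcar (H \<otimes> H)"
  shows "pairing H f g s = g (id_eps H H f s)"
  by (rule tensor_eqI[OF _ _ _ _ s])
    (use f g lin_scale[OF g] in \<open>auto intro: lin_comp[OF g] lin_pairing simp: pairing_tens\<close>)

lemma lin_pairing_parameter:
  assumes F: "subvsp F (dual H)" and h: "lin H ground h" and s: "s \<in> vcar (H \<otimes> H)"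
  shows "lin F ground (\<lambda>f. pairing H f h s)" "lin F ground (\<lambda>f. pairing H h f s)"
proof -
  interpret F: function_space H F using F by unfold_locales simp_all
  show "lin F ground (\<lambda>f. pairing H f h s)" "lin F ground (\<lambda>f. pairing H h f s)"
    unfolding pairing_def by (rule lin_lift_parameter; use h s in \<open>auto intro: bilin_pairing lin_times\<close>)+
qed

lemma lin_pairing_arguments:
  assumes "lin (H \<otimes> H) (H \<otimes> H) \<Phi>" "lin H ground f" "lin H ground g"
  shows "a \<in> vcar H \<Longrightarrow> lin H ground (\<lambda>b. pairing H f g (\<Phi> (tens H H a b)))"
    and "b \<in> vcar H \<Longrightarrow> lin H ground (\<lambda>a. pairing H f g (\<Phi> (tens H H a b)))"
  by (auto intro!: lin_comp[OF lin_pairing] lin_comp[OF assms(1)] lin_tens_left lin_tens_right assms)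

end

context function_space
begin

lemma subvsp_dual_refl: "subvsp (dual H) (dual H)"
  by (simp add: subvsp_def)

lemma pairing_nested_pairing:
  assumes [simp]: "f \<in> vcar U" "g \<in> vcar U" and s: "s \<in> vcar (H \<otimes> H)"
  shows "pairing H f g s = nested_pairing H U (tens U U f g) s"
  by (rule tensor_eqI[OF _ _ _ _ s]) (auto intro: lin_pairing simp: pairing_tens)

lemma full_transpose_mirror:
  assumes Q: "lin (U \<otimes> U) (U \<otimes> U) Q" and \<Theta>: "lin (H \<otimes> H) (H \<otimes> H) \<Theta>" and tr: "full_transpose H U Q \<Theta>"
  shows "full_transpose H U (mirror Q) (mirror \<Theta>)"
  unfolding full_transpose_def mirror_def
proof (intro ballI)
  fix q s assume q: "q \<in> vcar (U \<otimes> U)" and s: "s \<in> vcar (H \<otimes> H)"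
  have "nested_pairing H U (flip (Q (flip q))) s = nested_pairing H U (Q (flip q)) (flip s)"
    using nested_pairing_flip[of "Q (flip q)" "flip s"] q s lin_mem[OF Q] by simp
  also have "\<dots> = nested_pairing H U (flip q) (\<Theta> (flip s))"
    using tr q s by (simp add: full_transpose_def)
  also have "\<dots> = nested_pairing H U q (flip (\<Theta> (flip s)))"
    using nested_pairing_flip[of q "flip (\<Theta> (flip s))"] q s lin_mem[OF \<Theta>] by simp
  finally show "nested_pairing H U (flip (Q (flip q))) s = nested_pairing H U q (flip (\<Theta> (flip s)))" .
qed

context
  fixes \<Phi> assumes \<Phi>: "lin (H \<otimes> H) (H \<otimes> H) \<Phi>"
begin

lemma \<Phi>_tens_in: "a \<in> vcar H \<Longrightarrow> b \<in> vcar H \<Longrightarrow> \<Phi> (tens H H a b) \<in> vcar (H \<otimes> H)"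
  by (rule lin_mem[OF \<Phi>]) simp

lemma psi_UU_transpose:
  assumes bij: "bij_UU H \<Phi> U"
  shows "bij_lin (U \<otimes> U) (U \<otimes> U) (psi_UU H \<Phi> U)" and "full_transpose H U (psi_UU H \<Phi> U) \<Phi>"
proof -
  have F: "lin (U \<otimes> U) (dual (H \<otimes> H)) (form_UU H \<Phi> U)"
    unfolding form_UU_def
    by (rule lin_quadrilinear)
      (auto intro: lin_pairing_parameter lin_pairing_arguments \<Phi> U \<Phi>_tens_in)
  have F_tens: "form_UU H \<Phi> U (tens U U f g) (tens H H b a) = pairing H f g (\<Phi> (tens H H a b))"
    if "f \<in> vcar U" "g \<in> vcar U" "a \<in> vcar H" "b \<in> vcar H" for f g a b
    unfolding form_UU_def
    by (rule quadrilinear_tens)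
      (use that in \<open>auto intro: lin_pairing_parameter lin_pairing_arguments \<Phi> U \<Phi>_tens_in\<close>)
  note R = bij_lin_via_embedding[OF vspace_tensor vspace_tensor F lin_emb_UU inj_emb_UU bij[unfolded bij_UU_def],
      folded psi_UU_def]
  show "bij_lin (U \<otimes> U) (U \<otimes> U) (psi_UU H \<Phi> U)" by (rule R(1))
  show "full_transpose H U (psi_UU H \<Phi> U) \<Phi>"
    unfolding full_transpose_def
  proof (intro ballI)
    fix q s assume q: "q \<in> vcar (U \<otimes> U)" and s: "s \<in> vcar (H \<otimes> H)"
    have "form_UU H \<Phi> U q (flip s) = nested_pairing H U q (\<Phi> s)"
    proof (rule tensor_eqI[where F = "\<lambda>q. form_UU H \<Phi> U q (flip s)", OF _ _ _ _ q])
      show "lin (U \<otimes> U) ground (\<lambda>q. form_UU H \<Phi> U q (flip s))" by (rule lin_dual_apply[OF F])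
      fix f g assume [simp]: "f \<in> vcar U" "g \<in> vcar U"
      show "form_UU H \<Phi> U (tens U U f g) (flip s) = nested_pairing H U (tens U U f g) (\<Phi> s)"
        by (rule tensor_eqI[where F = "\<lambda>s. form_UU H \<Phi> U (tens U U f g) (flip s)"
              and G = "\<lambda>s. nested_pairing H U (tens U U f g) (\<Phi> s)", OF _ _ _ _ s])
          (auto intro: lin_comp[OF dual_lin[OF lin_mem[OF F]] lin_flip] lin_comp[OF lin_nested_pairing_right \<Phi>]
            simp: F_tens pairing_nested_pairing \<Phi>_tens_in)
    qed simp_all
    then show "nested_pairing H U (psi_UU H \<Phi> U q) s = nested_pairing H U q (\<Phi> s)"
      using R(2)[OF q] by (simp add: nested_pairing_def)
  qed
qed

text \<open>The defining formula says that \<open>(id \<otimes> ev\<^sub>b)(\<Psi>\<^sub>U\<^sub>H(g \<otimes> a))\<close> and \<open>(g \<otimes> id)(\<Phi>(a \<otimes> b))\<close> have the same value under every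
  \<open>f \<in> H'\<close>.\<close>

lemma psi_UH_transpose:
  assumes bij: "bij_UH H \<Phi> U"
  shows "bij_lin (U \<otimes> H) (H \<otimes> U) (psi_UH H \<Phi> U)" and "half_transpose H U (psi_UH H \<Phi> U) \<Phi>"
proof -
  interpret D: function_space H "dual H" by unfold_locales (simp_all add: subvsp_dual_refl)
  have F: "lin (U \<otimes> H) (dual (dual H \<otimes> H)) (form_UH H \<Phi> U)"
    unfolding form_UH_def
    by (rule lin_quadrilinear)
      (auto intro: lin_pairing_parameter lin_pairing_arguments \<Phi> U \<Phi>_tens_in subvsp_dual_refl)
  have F_tens: "form_UH H \<Phi> U (tens U H g a) (tens (dual H) H f b) = pairing H f g (\<Phi> (tens H H a b))"
    if "f \<in> vcar (dual H)" "g \<in> vcar U" "a \<in> vcar H" "b \<in> vcar H" for f g a b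
    unfolding form_UH_def
    by (rule quadrilinear_tens)
      (use that in \<open>auto intro: lin_pairing_parameter lin_pairing_arguments \<Phi> U \<Phi>_tens_in subvsp_dual_refl\<close>)
  have e: "lin (H \<otimes> U) (dual (dual H \<otimes> H)) (emb_HU H U)"
    unfolding emb_HU_def by (rule lin_tensor_embed) simp_all
  have e_id_eps: "emb_HU H U t (tens (dual H) H f b) = f (id_eps H U (\<lambda>h. h b) t)"
    if "f \<in> vcar (dual H)" "b \<in> vcar H" "t \<in> vcar (H \<otimes> U)" for f b t
    unfolding emb_HU_def by (rule tensor_embed_id_eps) (use that in simp_all)
  have inj: "inj_on (emb_HU H U) (vcar (H \<otimes> U))"
    unfolding emb_HU_def
    by (rule inj_tensor_embed) (auto intro: U_eqI dual_separates[OF H])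
  note R = bij_lin_via_embedding[OF vspace_tensor vspace_tensor F e inj bij[unfolded bij_UH_def],
      folded psi_UH_def]
  show b: "bij_lin (U \<otimes> H) (H \<otimes> U) (psi_UH H \<Phi> U)" by (rule R(1))
  show "half_transpose H U (psi_UH H \<Phi> U) \<Phi>"
    unfolding half_transpose_def
  proof (intro ballI)
    fix g a b assume gab: "g \<in> vcar U" "a \<in> vcar H" "b \<in> vcar H"
    have r: "psi_UH H \<Phi> U (tens U H g a) \<in> vcar (H \<otimes> U)"
      by (rule lin_mem[of "U \<otimes> H" "H \<otimes> U" "psi_UH H \<Phi> U"]) (use R(1) gab in \<open>simp_all add: bij_lin_def\<close>)
    have "f (id_eps H U (\<lambda>h. h b) (psi_UH H \<Phi> U (tens U H g a))) = f (eps_id H H g (\<Phi> (tens H H a b)))"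
      if "f \<in> vcar (dual H)" for f
      using e_id_eps[OF that gab(3) r] R(2)[of "tens U H g a"] F_tens[OF that gab]
        pairing_eps_id[OF H D.U_lin[OF that] U_lin[OF gab(1)] \<Phi>_tens_in[OF gab(2,3)]] gab by simp
    then show "id_eps H U (\<lambda>h. h b) (psi_UH H \<Phi> U (tens U H g a)) = eps_id H H g (\<Phi> (tens H H a b))"
      by (intro dual_separates[OF H]) (use gab r in \<open>auto simp: id_eps_in eps_id_in \<Phi>_tens_in\<close>)
  qed
qed

text \<open>The formula gives \<open>(ev\<^sub>a \<otimes> id)(\<Psi>\<^sub>H\<^sub>U(b \<otimes> f)) = (id \<otimes> f)(\<Phi>(a \<otimes> b))\<close>; the flip turns this into a half
  transpose of the mirrored map.\<close>

lemma psi_HU_transpose: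
  assumes bij: "bij_HU H \<Phi> U"
  shows "bij_lin (H \<otimes> U) (U \<otimes> H) (psi_HU H \<Phi> U)" and "half_transpose H U (mirror (psi_HU H \<Phi> U)) (mirror \<Phi>)"
proof -
  interpret D: function_space H "dual H" by unfold_locales (simp_all add: subvsp_dual_refl)
  have F: "lin (H \<otimes> U) (dual (H \<otimes> dual H)) (form_HU H \<Phi> U)"
    unfolding form_HU_def
    by (rule lin_quadrilinear)
      (auto intro: lin_pairing_parameter lin_pairing_arguments \<Phi> U \<Phi>_tens_in subvsp_dual_refl)
  have F_tens: "form_HU H \<Phi> U (tens H U b f) (tens H (dual H) a g) = pairing H f g (\<Phi> (tens H H a b))"
    if "g \<in> vcar (dual H)" "f \<in> vcar U" "a \<in> vcar H" "b \<in> vcar H" for f g a b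
    unfolding form_HU_def
    by (rule quadrilinear_tens)
      (use that in \<open>auto intro: lin_pairing_parameter lin_pairing_arguments \<Phi> U \<Phi>_tens_in subvsp_dual_refl\<close>)
  have e: "lin (U \<otimes> H) (dual (H \<otimes> dual H)) (emb_UH H U)"
    unfolding emb_UH_def by (rule lin_tensor_embed) simp_all
  have e_eps_id: "emb_UH H U t (tens H (dual H) a g) = g (eps_id U H (\<lambda>h. h a) t)"
    if "g \<in> vcar (dual H)" "a \<in> vcar H" "t \<in> vcar (U \<otimes> H)" for g a t
    unfolding emb_UH_def by (rule tensor_embed_eps_id) (use that in simp_all)
  have inj: "inj_on (emb_UH H U) (vcar (U \<otimes> H))"
    unfolding emb_UH_def
    by (rule inj_tensor_embed) (auto intro: U_eqI dual_separates[OF H])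
  note R = bij_lin_via_embedding[OF vspace_tensor vspace_tensor F e inj bij[unfolded bij_HU_def],
      folded psi_HU_def]
  show b: "bij_lin (H \<otimes> U) (U \<otimes> H) (psi_HU H \<Phi> U)" by (rule R(1))
  show "half_transpose H U (mirror (psi_HU H \<Phi> U)) (mirror \<Phi>)"
    unfolding half_transpose_def mirror_tens
  proof (intro ballI)
    fix f b a assume fba: "f \<in> vcar U" "b \<in> vcar H" "a \<in> vcar H"
    have r: "psi_HU H \<Phi> U (tens H U b f) \<in> vcar (U \<otimes> H)"
      by (rule lin_mem[of "H \<otimes> U" "U \<otimes> H" "psi_HU H \<Phi> U"]) (use R(1) fba in \<open>simp_all add: bij_lin_def\<close>)
    have "g (eps_id U H (\<lambda>h. h a) (psi_HU H \<Phi> U (tens H U b f))) = g (id_eps H H f (\<Phi> (tens H H a b)))"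
      if "g \<in> vcar (dual H)" for g
      using e_eps_id[OF that fba(3) r] R(2)[of "tens H U b f"] F_tens[OF that fba(1,3,2)]
        pairing_id_eps[OF H U_lin[OF fba(1)] D.U_lin[OF that] \<Phi>_tens_in[OF fba(3,2)]] fba by simp
    then have "eps_id U H (\<lambda>h. h a) (psi_HU H \<Phi> U (tens H U b f)) = id_eps H H f (\<Phi> (tens H H a b))"
      by (intro dual_separates[OF H]) (use fba r in \<open>auto simp: id_eps_in eps_id_in \<Phi>_tens_in\<close>)
    then show "id_eps H U (\<lambda>h. h a) (flip (psi_HU H \<Phi> U (tens H U b f))) = eps_id H H f (flip (\<Phi> (tens H H a b)))"
      using fba r by (simp add: id_eps_flip eps_id_flip \<Phi>_tens_in)
  qed
qed

end

end

section \<open>Dual braidings\<close>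

theorem lemma4p1:
  fixes H :: "('k::field, 'h::ab_group_add) vsp"
    and \<Psi> :: "('k, 'h, 'h) tens \<Rightarrow> ('k, 'h, 'h) tens"
    and U :: "('k, 'h \<Rightarrow> 'k) vsp"
  assumes "braiding H \<Psi>"
    and "subvsp U (dual H)"
    and "nondegenerate H U"
    and "bij_UU H \<Psi> U"
  shows
    "braiding U (psi_UU H \<Psi> U)
    \<and> (\<forall>\<Phi> \<in> {\<Psi>, inv_braiding H \<Psi>}. bij_UH H \<Phi> U \<longrightarrow>
          left_braided U (psi_UU H \<Psi> U) H (psi_UH H \<Phi> U)
        \<and> left_braided U (inv_braiding U (psi_UU H \<Psi> U)) H (psi_UH H \<Phi> U)
        \<and> right_braided H \<Psi> U (psi_UH H \<Phi> U)
        \<and> right_braided H (inv_braiding H \<Psi>) U (psi_UH H \<Phi> U)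
        \<and> (\<forall>m u. braided_algebra H \<Psi> m u \<longrightarrow> mult_compat_right U H (psi_UH H \<Phi> U) m u)
        \<and> (\<forall>\<Delta> \<epsilon>. braided_coalgebra H \<Psi> \<Delta> \<epsilon> \<longrightarrow> comult_compat_right U H (psi_UH H \<Phi> U) \<Delta> \<epsilon>))
    \<and> (\<forall>\<Phi> \<in> {\<Psi>, inv_braiding H \<Psi>}. bij_HU H \<Phi> U \<longrightarrow>
          left_braided H \<Psi> U (psi_HU H \<Phi> U)
        \<and> left_braided H (inv_braiding H \<Psi>) U (psi_HU H \<Phi> U)
        \<and> right_braided U (psi_UU H \<Psi> U) H (psi_HU H \<Phi> U)
        \<and> right_braided U (inv_braiding U (psi_UU H \<Psi> U)) H (psi_HU H \<Phi> U)
        \<and> (\<forall>m u. braided_algebra H \<Psi> m u \<longrightarrow> mult_compat_left H U (psi_HU H \<Phi> U) m u)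
        \<and> (\<forall>\<Delta> \<epsilon>. braided_coalgebra H \<Psi> \<Delta> \<epsilon> \<longrightarrow> comult_compat_left H U (psi_HU H \<Phi> U) \<Delta> \<epsilon>))"
proof -
  have H: "vspace H" and bij\<Psi>: "bij_lin (H \<otimes> H) (H \<otimes> H) \<Psi>" and hex: "left_hexagon H \<Psi> H \<Psi>"
    using assms(1) by (auto simp: braiding_iff)
  interpret function_space H U by unfold_locales (fact H assms(2))+
  define \<Psi>' where "\<Psi>' = inv_braiding H \<Psi>"
  define P where "P = psi_UU H \<Psi> U"
  define P' where "P' = inv_braiding U P"
  have inv: "inverse_pair H \<Psi> \<Psi>'"
    unfolding \<Psi>'_def using bij\<Psi> by (rule inverse_pair_inv_braiding)
  then have lin\<Psi>: "lin (H \<otimes> H) (H \<otimes> H) \<Psi>" "lin (H \<otimes> H) (H \<otimes> H) \<Psi>'"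
    by (simp_all add: inverse_pair_def)
  have bijP: "bij_lin (U \<otimes> U) (U \<otimes> U) P" and trP: "full_transpose H U P \<Psi>"
    unfolding P_def using psi_UU_transpose[OF lin\<Psi>(1) assms(4)] by auto
  have invP: "inverse_pair U P P'"
    unfolding P'_def using bijP by (rule inverse_pair_inv_braiding)
  then have linP: "lin (U \<otimes> U) (U \<otimes> U) P" "lin (U \<otimes> U) (U \<otimes> U) P'"
    by (simp_all add: inverse_pair_def)
  have hexP: "left_hexagon U P U P" by (rule left_hexagon_full_transpose[OF linP(1) lin\<Psi>(1) trP hex])
  have braiding_P: "braiding U P" "braiding U P'"
    using hexP bijP braiding_inverse[OF vspace_U invP] by (auto simp: braiding_iff)
  have braiding_\<Psi>: "braiding H \<Psi>" "braiding H \<Psi>'"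
    using assms(1) braiding_inverse[OF H inv hex] by auto
  \<comment> \<open>The inverse of a transpose is the transpose of the inverse.\<close>
  have trP': "full_transpose H U P' \<Psi>'"
    unfolding full_transpose_def
  proof (intro ballI)
    fix q s assume q: "q \<in> vcar (U \<otimes> U)" and s: "s \<in> vcar (H \<otimes> H)"
    have "nested_pairing H U (P (P' q)) (\<Psi>' s) = nested_pairing H U (P' q) (\<Psi> (\<Psi>' s))"
      using trP q s lin_mem[OF linP(2)] lin_mem[OF lin\<Psi>(2)] by (simp add: full_transpose_def)
    then show "nested_pairing H U (P' q) s = nested_pairing H U q (\<Psi>' s)"
      using q s inv invP by (simp add: inverse_pair_def)
  qed
  have mult: "mult_compat_left H H \<Phi> m u \<and> mult_compat_right H H \<Phi> m u"
      and unit: "\<forall>e. u = Some e \<longrightarrow> e \<in> vcar H" and m: "lin (H \<otimes> H) H m"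
    if \<Phi>: "\<Phi> \<in> {\<Psi>, \<Psi>'}" and alg: "braided_algebra H \<Psi> m u" for \<Phi> m u
  proof -
    have compat: "mult_compat_left H H \<Psi> m u" "mult_compat_right H H \<Psi> m u"
      using alg by (simp_all add: braided_algebra_def)
    show u: "\<forall>e. u = Some e \<longrightarrow> e \<in> vcar H" and m: "lin (H \<otimes> H) H m"
      using alg by (simp_all add: braided_algebra_def is_algebra_def)
    show "mult_compat_left H H \<Phi> m u \<and> mult_compat_right H H \<Phi> m u"
      using \<Phi> compat mult_compat_left_of_inverse[OF H inv m u compat(2)]
        mult_compat_right_of_inverse[OF H inv m u compat(1)] by auto
  qed
  have comult: "comult_compat_left H H \<Phi> \<Delta> \<epsilon> \<and> comult_compat_right H H \<Phi> \<Delta> \<epsilon>"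
      and \<Delta>: "lin H (H \<otimes> H) \<Delta>" and \<epsilon>: "lin H ground \<epsilon>"
    if \<Phi>: "\<Phi> \<in> {\<Psi>, \<Psi>'}" and coalg: "braided_coalgebra H \<Psi> \<Delta> \<epsilon>" for \<Phi> \<Delta> \<epsilon>
  proof -
    have compat: "comult_compat_left H H \<Psi> \<Delta> \<epsilon>" "comult_compat_right H H \<Psi> \<Delta> \<epsilon>"
      using coalg by (simp_all add: braided_coalgebra_def)
    show \<Delta>: "lin H (H \<otimes> H) \<Delta>" and \<epsilon>: "lin H ground \<epsilon>"
      using coalg by (simp_all add: braided_coalgebra_def is_coalgebra_def)
    show "comult_compat_left H H \<Phi> \<Delta> \<epsilon> \<and> comult_compat_right H H \<Phi> \<Delta> \<epsilon>"
      using \<Phi> compat comult_compat_left_of_inverse[OF H inv \<Delta> compat(2)]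
        comult_compat_right_of_inverse[OF H inv \<Delta> \<epsilon> compat(1)] by auto
  qed
  have UH: "left_braided U P H (psi_UH H \<Phi> U) \<and> left_braided U P' H (psi_UH H \<Phi> U)
      \<and> right_braided H \<Psi> U (psi_UH H \<Phi> U) \<and> right_braided H \<Psi>' U (psi_UH H \<Phi> U)
      \<and> (\<forall>m u. braided_algebra H \<Psi> m u \<longrightarrow> mult_compat_right U H (psi_UH H \<Phi> U) m u)
      \<and> (\<forall>\<Delta> \<epsilon>. braided_coalgebra H \<Psi> \<Delta> \<epsilon> \<longrightarrow> comult_compat_right U H (psi_UH H \<Phi> U) \<Delta> \<epsilon>)"
    if \<Phi>: "\<Phi> \<in> {\<Psi>, \<Psi>'}" and bij: "bij_UH H \<Phi> U" for \<Phi>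
  proof -
    have l: "lin (H \<otimes> H) (H \<otimes> H) \<Phi>" using \<Phi> lin\<Psi> by auto
    have bijR: "bij_lin (U \<otimes> H) (H \<otimes> U) (psi_UH H \<Phi> U)" and half: "half_transpose H U (psi_UH H \<Phi> U) \<Phi>"
      using psi_UH_transpose[OF l bij] by auto
    then have R: "lin (U \<otimes> H) (H \<otimes> U) (psi_UH H \<Phi> U)" by (simp add: bij_lin_def)
    have hexs: "left_hexagon H \<Theta> H \<Phi>" "right_hexagon H \<Theta> H \<Phi>" if "\<Theta> \<in> {\<Psi>, \<Psi>'}" for \<Theta>
      by (rule mixed_hexagons[OF H inv hex that \<Phi>])+
    have "left_hexagon U P H (psi_UH H \<Phi> U)" "left_hexagon U P' H (psi_UH H \<Phi> U)"
      using left_hexagon_half_transpose[OF R l half linP(1) lin\<Psi>(1) trP hexs(2)]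
        left_hexagon_half_transpose[OF R l half linP(2) lin\<Psi>(2) trP' hexs(2)] by simp_all
    moreover have "right_hexagon H \<Psi> U (psi_UH H \<Phi> U)" "right_hexagon H \<Psi>' U (psi_UH H \<Phi> U)"
      using right_hexagon_half_transpose[OF R l half lin\<Psi>(1) hexs(1)]
        right_hexagon_half_transpose[OF R l half lin\<Psi>(2) hexs(1)] by simp_all
    moreover have "mult_compat_right U H (psi_UH H \<Phi> U) m u" if "braided_algebra H \<Psi> m u" for m u
      by (rule mult_compat_right_half_transpose[OF R l half m[OF \<Phi> that] unit[OF \<Phi> that]
            mult[OF \<Phi> that, THEN conjunct1]])
    moreover have "comult_compat_right U H (psi_UH H \<Phi> U) \<Delta> \<epsilon>" if "braided_coalgebra H \<Psi> \<Delta> \<epsilon>" for \<Delta> \<epsilon>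
      by (rule comult_compat_right_half_transpose[OF R l half \<Delta>[OF \<Phi> that] \<epsilon>[OF \<Phi> that]
            comult[OF \<Phi> that, THEN conjunct1]])
    ultimately show ?thesis
      using braiding_P braiding_\<Psi> bijR by (simp add: left_braided_iff right_braided_iff)
  qed
  have HU: "left_braided H \<Psi> U (psi_HU H \<Phi> U) \<and> left_braided H \<Psi>' U (psi_HU H \<Phi> U)
      \<and> right_braided U P H (psi_HU H \<Phi> U) \<and> right_braided U P' H (psi_HU H \<Phi> U)
      \<and> (\<forall>m u. braided_algebra H \<Psi> m u \<longrightarrow> mult_compat_left H U (psi_HU H \<Phi> U) m u)
      \<and> (\<forall>\<Delta> \<epsilon>. braided_coalgebra H \<Psi> \<Delta> \<epsilon> \<longrightarrow> comult_compat_left H U (psi_HU H \<Phi> U) \<Delta> \<epsilon>)"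
    if \<Phi>: "\<Phi> \<in> {\<Psi>, \<Psi>'}" and bij: "bij_HU H \<Phi> U" for \<Phi>
  proof -
    have l: "lin (H \<otimes> H) (H \<otimes> H) \<Phi>" using \<Phi> lin\<Psi> by auto
    have bijR: "bij_lin (H \<otimes> U) (U \<otimes> H) (psi_HU H \<Phi> U)"
      and half: "half_transpose H U (mirror (psi_HU H \<Phi> U)) (mirror \<Phi>)"
      using psi_HU_transpose[OF l bij] by auto
    then have R: "lin (H \<otimes> U) (U \<otimes> H) (psi_HU H \<Phi> U)" by (simp add: bij_lin_def)
    note mirrored = lin_mirror[OF R] lin_mirror[OF l] half
    have hexs: "left_hexagon H \<Theta> H \<Phi>" "right_hexagon H \<Theta> H \<Phi>" if "\<Theta> \<in> {\<Psi>, \<Psi>'}" for \<Theta>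
      by (rule mixed_hexagons[OF H inv hex that \<Phi>])+
    have right_hex: "right_hexagon U Q H (psi_HU H \<Phi> U)"
      if "\<Theta> \<in> {\<Psi>, \<Psi>'}" and Q: "lin (U \<otimes> U) (U \<otimes> U) Q" and \<Theta>: "lin (H \<otimes> H) (H \<otimes> H) \<Theta>"
        and tr: "full_transpose H U Q \<Theta>" for Q \<Theta>
    proof -
      have "right_hexagon H (mirror \<Theta>) H (mirror \<Phi>)"
        using hexs(1)[OF that(1)] \<Theta> l by (simp add: right_hexagon_mirror_iff)
      then have "left_hexagon U (mirror Q) H (mirror (psi_HU H \<Phi> U))"
        by (rule left_hexagon_half_transpose[OF mirrored lin_mirror[OF Q] lin_mirror[OF \<Theta>]
              full_transpose_mirror[OF Q \<Theta> tr]])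
      then show ?thesis using Q R by (simp add: left_hexagon_mirror_iff)
    qed
    have left_hex: "left_hexagon H \<Theta> U (psi_HU H \<Phi> U)"
      if "\<Theta> \<in> {\<Psi>, \<Psi>'}" and \<Theta>: "lin (H \<otimes> H) (H \<otimes> H) \<Theta>" for \<Theta>
    proof -
      have "left_hexagon H (mirror \<Theta>) H (mirror \<Phi>)"
        using hexs(2)[OF that(1)] \<Theta> l by (simp add: left_hexagon_mirror_iff)
      then have "right_hexagon H (mirror \<Theta>) U (mirror (psi_HU H \<Phi> U))"
        by (rule right_hexagon_half_transpose[OF mirrored lin_mirror[OF \<Theta>]])
      then show ?thesis using \<Theta> R by (simp add: right_hexagon_mirror_iff)
    qed
    have "mult_compat_left H U (psi_HU H \<Phi> U) m u" if alg: "braided_algebra H \<Psi> m u" for m u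
    proof -
      note m = m[OF \<Phi> alg]
      have "mult_compat_left H H (mirror \<Phi>) (\<lambda>t. m (flip t)) u"
        using mult[OF \<Phi> alg] m l by (simp add: mult_compat_left_mirror_iff)
      then have "mult_compat_right U H (mirror (psi_HU H \<Phi> U)) (\<lambda>t. m (flip t)) u"
        by (rule mult_compat_right_half_transpose[OF mirrored lin_comp[OF m lin_flip] unit[OF \<Phi> alg]])
      then show ?thesis using m R by (simp add: mult_compat_right_mirror_iff)
    qed
    moreover have "comult_compat_left H U (psi_HU H \<Phi> U) \<Delta> \<epsilon>" if coalg: "braided_coalgebra H \<Psi> \<Delta> \<epsilon>" for \<Delta> \<epsilon>
    proof -
      note \<Delta> = \<Delta>[OF \<Phi> coalg] and \<epsilon> = \<epsilon>[OF \<Phi> coalg]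
      have "comult_compat_left H H (mirror \<Phi>) (\<lambda>x. flip (\<Delta> x)) \<epsilon>"
        using comult[OF \<Phi> coalg] \<Delta> \<epsilon> l by (simp add: comult_compat_left_mirror_iff)
      then have "comult_compat_right U H (mirror (psi_HU H \<Phi> U)) (\<lambda>x. flip (\<Delta> x)) \<epsilon>"
        by (rule comult_compat_right_half_transpose[OF mirrored lin_comp[OF lin_flip \<Delta>] \<epsilon>])
      then show ?thesis using \<Delta> \<epsilon> R by (simp add: comult_compat_right_mirror_iff)
    qed
    ultimately show ?thesis
      using right_hex[OF _ linP(1) lin\<Psi>(1) trP] right_hex[OF _ linP(2) lin\<Psi>(2) trP']
        left_hex[OF _ lin\<Psi>(1)] left_hex[OF _ lin\<Psi>(2)] braiding_P braiding_\<Psi> bijR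
      by (simp add: left_braided_iff right_braided_iff)
  qed
  show ?thesis
    using braiding_P(1) UH HU unfolding P_def[symmetric] P'_def[symmetric] \<Psi>'_def[symmetric] by simp
qed

end
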